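(* Let $B_t$ be a planar Brownian motion started at $0$, and let $\hat\tau$ be the infimum of the times $t\ge0$ such that $B_t\in(-1,1)$ and the closed curve formed by the path $\{B_s\}_{0\le s\le t}$ followed by the real segment joining $B_t$ to $0$ is not homotopic to a point in $\mathbb{C}\setminus\{-1,1\}$. Then $B_{\hat\tau}$ has density on $(-1,1)$ with respect to arclength given, for $w\in(-1,1)$, by $$\rho^0_{\hat\tau}(w)=\frac{2}{\pi^2\sqrt{1-w^2}}\sum_{\substack{n=-\infty\\ n\ne0}}^{\infty}\frac{1}{\big|\frac2\pi\sin^{-1}w+2n\big|\sqrt{\big(\frac2\pi\sin^{-1}w+2n\big)^2-1}}.$$
   Context: $\sin^{-1}$ denotes the principal branch of arcsine with values in $[-\frac\pi2,\frac\pi2]$. Planar Brownian motion started at $0$ almost surely never hits $-1$ or $1$, so the homotopy condition makes sense almost surely. $\rho^0_{\hat\tau}$ denotes the density of $B_{\hat\tau}$ with respect to arclength when $B_0=0$. *)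

theory Defs
  imports "HOL-Probability.Probability" "HOL-Analysis.Analysis"
begin

locale planar_brownian_motion = prob_space M
  for M :: "'w measure" and B :: "real \<Rightarrow> 'w \<Rightarrow> complex" +
  assumes random_variable: "\<And>t. 0 \<le> t \<Longrightarrow> random_variable borel (B t)"
    and start_0: "AE \<omega> in M. B 0 \<omega> = 0"
    and indep_increments:
      "\<And>(t :: nat \<Rightarrow> real) n. 0 \<le> t 0 \<Longrightarrow> mono t \<Longrightarrow>
        indep_vars (\<lambda>_. borel) (\<lambda>i \<omega>. B (t (Suc i)) \<omega> - B (t i) \<omega>) {..<n}"
    and indep_coordinates:
      "\<And>s t. 0 \<le> s \<Longrightarrow> s < t \<Longrightarrow>
        indep_var borel (\<lambda>\<omega>. Re (B t \<omega> - B s \<omega>)) borel (\<lambda>\<omega>. Im (B t \<omega> - B s \<omega>))"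
    and normal_Re:
      "\<And>s t. 0 \<le> s \<Longrightarrow> s < t \<Longrightarrow>
        distributed M lborel (\<lambda>\<omega>. Re (B t \<omega> - B s \<omega>)) (normal_density 0 (sqrt (t - s)))"
    and normal_Im:
      "\<And>s t. 0 \<le> s \<Longrightarrow> s < t \<Longrightarrow>
        distributed M lborel (\<lambda>\<omega>. Im (B t \<omega> - B s \<omega>)) (normal_density 0 (sqrt (t - s)))"
    and continuous_paths: "AE \<omega> in M. continuous_on {0..} (\<lambda>t. B t \<omega>)"

definition slit :: "complex set" where
  "slit = complex_of_real ` {-1<..<1}"

definition closed_up_path :: "(real \<Rightarrow> complex) \<Rightarrow> real \<Rightarrow> real \<Rightarrow> complex" where
  "closed_up_path b t = (\<lambda>s. b (t * s)) +++ linepath (b t) 0"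

text \<open>Free homotopy of loops, to some constant loop in the set.\<close>

definition null_homotopic_loop :: "complex set \<Rightarrow> (real \<Rightarrow> complex) \<Rightarrow> bool" where
  "null_homotopic_loop S \<gamma> \<longleftrightarrow> (\<exists>a. homotopic_loops S \<gamma> (\<lambda>_. a))"

definition winding_times :: "(real \<Rightarrow> complex) \<Rightarrow> real set" where
  "winding_times b =
    {t. 0 \<le> t \<and> b t \<in> slit \<and> \<not> null_homotopic_loop (- {-1, 1}) (closed_up_path b t)}"

text \<open>The infimum is taken in the extended reals, so that it is \<open>\<infinity>\<close> when there is no such time.\<close>

definition tau_hat :: "(real \<Rightarrow> complex) \<Rightarrow> ereal" where
  "tau_hat b = Inf (ereal ` winding_times b)"

text \<open>Meaningful when \<^term>\<open>winding_times b \<noteq> {}\<close>; otherwise \<^const>\<open>real_of_ereal\<close>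
  sends \<open>\<infinity>\<close> to 0. As a function of the sample point this is measurable in general only up
  to null sets, since a Brownian motion has its path properties (continuity, start at 0, avoidance
  of \<open>\<plusminus>1\<close>) only almost surely; its law is therefore taken on the completed space.\<close>

definition B_tau_hat :: "(real \<Rightarrow> complex) \<Rightarrow> complex" where
  "B_tau_hat b = b (real_of_ereal (tau_hat b))"

text \<open>For \<open>\<bar>w\<bar> < 1\<close> the summed terms are positive and decay like \<open>1/n\<^sup>2\<close>, so this is a convergent
  sum. Values outside the interval carry no meaning.\<close>

definition rho :: "real \<Rightarrow> real" where
  "rho w = 2 / (pi\<^sup>2 * sqrt (1 - w\<^sup>2)) *
    (\<Sum>\<^sub>\<infinity>n\<in>UNIV - {0::int}.
      1 / (\<bar>2 / pi * arcsin w + 2 * of_int n\<bar> * sqrt ((2 / pi * arcsin w + 2 * of_int n)\<^sup>2 - 1)))"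

end

theory Submission
  imports Defs "HOL-Complex_Analysis.Complex_Analysis" "HOL-Real_Asymp.Real_Asymp"
begin

text \<open>
  The map \<open>F \<zeta> = sin (\<pi> \<zeta> / (1 + \<zeta>\<^sup>2))\<close> sends the unit disc to the plane with \<open>F 0 = 0\<close> and has no critical point:
  \<open>\<zeta> \<mapsto> z = 2 \<zeta> / (1 + \<zeta>\<^sup>2)\<close> maps the disc conformally onto the plane slit along the real rays
  \<open>\<bar>x\<bar> \<ge> 1\<close>, and \<open>z \<mapsto> sin (\<pi> z / 2)\<close> is the universal orbifold covering with branch values \<open>\<plusminus>1\<close>.
  Lift the Brownian path through \<open>F\<close> for as long as possible. While the lift exists, a crossing of \<open>(-1, 1)\<close> closes
  up to a loop that lifts to the (contractible) slit plane, so it is null-homotopic; when the lift leaves the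
  disc, it has reached a ray, and the winding number of \<open>1 - \<gamma>\<^sup>2 = cos\<^sup>2 (\<pi> z / 2)\<close> about 0 is not 0. Hence the
  exit time of the lift is the time in question.

  The exit point of the lift is uniform on the circle. Instead of stochastic calculus this uses a grid of
  times: a step along an inverse branch of \<open>F\<close> preserves the mean of a holomorphic function
  exactly, since increments are rotation invariant and steps that leave the domain of the branch are
  suppressed. The suppressed steps disappear in the limit of fine grids. So \<open>\<phi> (exit point)\<close> has mean \<open>\<phi> 0\<close> for all
  \<open>\<phi>\<close> holomorphic in the disc and continuous on its closure, and logarithms as test functions give the
  law of its real part \<open>V\<close>. The density is then that of \<open>sin (\<pi> / (2 V))\<close>.
\<close>


section \<open>Mean values of rotation invariant increments\<close>

text \<open>Inverse branches of \<open>F\<close> have no common radius near the unit circle. The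
  grid walk is therefore frozen once it leaves a disc of radius \<rho> < 1; the mesh is refined at
  fixed \<rho>, then \<rho> tends to 1, then the time horizon to infinity. Exit in finite time needs
  its own argument, because \<open>F\<close> is unbounded near \<plusminus>\<i>: a surviving lift
  either sits near \<plusminus>\<i>, which a harmonic function makes unlikely, or keeps the Brownian
  point in a fixed disc, which the spreading of the normal law makes unlikely.

  Paths are good only almost surely and the exit point comes from limits and choices, so measurable
  versions are carried along and compared almost everywhere.

  A uniform exit point gives \<open>1 / V\<close> the density 1 / (pi |x| sqrt (x^2 - 1)) on |x| >
  1. The map sin (pi x / 2) collects one preimage of w from each interval (2n - 1, 2n + 1); the
  middle one carries no mass, so n = 0 is missing. One factor 1 / pi comes from this density, and 2
  / (pi sqrt (1 - w^2)) is the derivative of (2 / pi) arcsin w.\<close>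

lemma nn_integral_lborel_shear_fst:
  fixes f :: "real \<times> real \<Rightarrow> ennreal"
  assumes [measurable]: "f \<in> borel_measurable (borel \<Otimes>\<^sub>M borel)"
  shows "(\<integral>\<^sup>+p. f (fst p + a * snd p, snd p) \<partial>(lborel \<Otimes>\<^sub>M lborel)) = (\<integral>\<^sup>+p. f p \<partial>(lborel \<Otimes>\<^sub>M lborel))"
proof -
  have "(\<integral>\<^sup>+p. f (fst p + a * snd p, snd p) \<partial>(lborel \<Otimes>\<^sub>M lborel)) =
      (\<integral>\<^sup>+y. \<integral>\<^sup>+x. f (x + a * y, y) \<partial>lborel \<partial>lborel)"
    by (subst lborel_pair.nn_integral_snd[symmetric]) (auto simp: case_prod_beta)
  also have "\<dots> = (\<integral>\<^sup>+y. \<integral>\<^sup>+x. f (x, y) \<partial>lborel \<partial>lborel)"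
  proof (rule nn_integral_cong)
    fix y :: real
    show "(\<integral>\<^sup>+x. f (x + a * y, y) \<partial>lborel) = (\<integral>\<^sup>+x. f (x, y) \<partial>lborel)"
      using nn_integral_real_affine[of "\<lambda>x. f (x, y)" 1 "a * y"] by (simp add: add.commute)
  qed
  also have "\<dots> = (\<integral>\<^sup>+p. f p \<partial>(lborel \<Otimes>\<^sub>M lborel))"
    by (subst lborel_pair.nn_integral_snd[symmetric]) auto
  finally show ?thesis .
qed

lemma nn_integral_lborel_shear_snd:
  fixes f :: "real \<times> real \<Rightarrow> ennreal"
  assumes [measurable]: "f \<in> borel_measurable (borel \<Otimes>\<^sub>M borel)"
  shows "(\<integral>\<^sup>+p. f (fst p, snd p + a * fst p) \<partial>(lborel \<Otimes>\<^sub>M lborel)) = (\<integral>\<^sup>+p. f p \<partial>(lborel \<Otimes>\<^sub>M lborel))"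
proof -
  have "(\<integral>\<^sup>+p. f (fst p, snd p + a * fst p) \<partial>(lborel \<Otimes>\<^sub>M lborel)) =
      (\<integral>\<^sup>+x. \<integral>\<^sup>+y. f (x, y + a * x) \<partial>lborel \<partial>lborel)"
    by (subst lborel.nn_integral_fst[symmetric]) (auto simp: case_prod_beta)
  also have "\<dots> = (\<integral>\<^sup>+x. \<integral>\<^sup>+y. f (x, y) \<partial>lborel \<partial>lborel)"
  proof (rule nn_integral_cong)
    fix x :: real
    show "(\<integral>\<^sup>+y. f (x, y + a * x) \<partial>lborel) = (\<integral>\<^sup>+y. f (x, y) \<partial>lborel)"
      using nn_integral_real_affine[of "\<lambda>y. f (x, y)" 1 "a * x"] by (simp add: add.commute)
  qed
  also have "\<dots> = (\<integral>\<^sup>+p. f p \<partial>(lborel \<Otimes>\<^sub>M lborel))"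
    by (subst lborel.nn_integral_fst[symmetric]) auto
  finally show ?thesis .
qed

text \<open>A rotation is a product of three shears, horizontal, vertical, horizontal, with
  horizontal slope \<open>t\<close> = - tan (\<theta> / 2) and vertical slope \<open>s\<close> = sin
  \<theta>; each preserves Lebesgue measure. The tangent is undefined exactly at the half turn
  \<open>c = -1\<close>.\<close>

lemma nn_integral_lborel_rotate_aux:
  fixes f :: "real \<times> real \<Rightarrow> ennreal"
  assumes [measurable]: "f \<in> borel_measurable (borel \<Otimes>\<^sub>M borel)"
    and cs: "c\<^sup>2 + s\<^sup>2 = 1" "c \<noteq> -1"
  shows "(\<integral>\<^sup>+p. f (c * fst p - s * snd p, s * fst p + c * snd p) \<partial>(lborel \<Otimes>\<^sub>M lborel))
    = (\<integral>\<^sup>+p. f p \<partial>(lborel \<Otimes>\<^sub>M lborel))"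
proof -
  define t where "t = - s / (1 + c)"
  have "1 + c \<noteq> 0" using cs by auto
  then have t: "t * (1 + c) = - s" by (simp add: t_def)
  have "(1 + c) * (1 + s * t) = 1 + c + s * (t * (1 + c))" by (simp add: algebra_simps)
  also have "\<dots> = 1 + c - s\<^sup>2" unfolding t by (simp add: power2_eq_square)
  also have "\<dots> = (1 + c) * c" using cs(1) by (simp add: power2_eq_square algebra_simps)
  finally have "(1 + c) * (1 + s * t) = (1 + c) * c" .
  then have st: "1 + s * t = c" using \<open>1 + c \<noteq> 0\<close> by simp
  define g where "g = (\<lambda>p. f (fst p + t * snd p, snd p))"
  define h where "h = (\<lambda>p. g (fst p, snd p + s * fst p))"
  have [measurable]: "g \<in> borel_measurable (borel \<Otimes>\<^sub>M borel)" "h \<in> borel_measurable (borel \<Otimes>\<^sub>M borel)"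
    unfolding g_def h_def by measurable
  have "(\<integral>\<^sup>+p. f p \<partial>(lborel \<Otimes>\<^sub>M lborel)) = (\<integral>\<^sup>+p. g p \<partial>(lborel \<Otimes>\<^sub>M lborel))"
    unfolding g_def by (rule nn_integral_lborel_shear_fst[symmetric]) simp
  also have "\<dots> = (\<integral>\<^sup>+p. h p \<partial>(lborel \<Otimes>\<^sub>M lborel))"
    unfolding h_def by (rule nn_integral_lborel_shear_snd[symmetric]) simp
  also have "\<dots> = (\<integral>\<^sup>+p. h (fst p + t * snd p, snd p) \<partial>(lborel \<Otimes>\<^sub>M lborel))"
    by (rule nn_integral_lborel_shear_fst[symmetric]) simp
  also have "\<dots> = (\<integral>\<^sup>+p. f (c * fst p - s * snd p, s * fst p + c * snd p) \<partial>(lborel \<Otimes>\<^sub>M lborel))"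
  proof (rule nn_integral_cong)
    fix p :: "real \<times> real"
    have y: "snd p + s * (fst p + t * snd p) = s * fst p + c * snd p"
      unfolding st[symmetric] by (simp add: algebra_simps)
    have "fst p + t * snd p + t * (snd p + s * (fst p + t * snd p)) = (1 + s * t) * fst p + t * (1 + (1 + s * t)) * snd p"
      by (simp add: algebra_simps)
    also have "\<dots> = c * fst p - s * snd p" using t st by simp
    finally show "h (fst p + t * snd p, snd p) = f (c * fst p - s * snd p, s * fst p + c * snd p)"
      by (simp add: h_def g_def y)
  qed
  finally show ?thesis by simp
qed

lemma nn_integral_lborel_rotate:
  fixes f :: "real \<times> real \<Rightarrow> ennreal"
  assumes [measurable]: "f \<in> borel_measurable (borel \<Otimes>\<^sub>M borel)"
    and cs: "c\<^sup>2 + s\<^sup>2 = 1"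
  shows "(\<integral>\<^sup>+p. f (c * fst p - s * snd p, s * fst p + c * snd p) \<partial>(lborel \<Otimes>\<^sub>M lborel))
    = (\<integral>\<^sup>+p. f p \<partial>(lborel \<Otimes>\<^sub>M lborel))"
proof (cases "c = -1")
  case False then show ?thesis using nn_integral_lborel_rotate_aux assms by blast
next
  case True
  then have s: "s = 0" using cs by simp
  \<comment> \<open>The half turn is the square of the quarter turn \<open>c = 0\<close>,
    \<open>s = 1\<close>, to which the shear decomposition applies.\<close>
  define g where "g p = f (- snd p, fst p)" for p
  have [measurable]: "g \<in> borel_measurable (borel \<Otimes>\<^sub>M borel)"
    unfolding g_def by measurable
  show ?thesis
    using nn_integral_lborel_rotate_aux[of f 0 1] nn_integral_lborel_rotate_aux[of g 0 1]
    by (simp add: True s g_def)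
qed

text \<open>The joint density of two independent centred normal coordinates with equal deviation is
  a function of x^2 + y^2 alone, and Lebesgue measure on the plane is rotation invariant.\<close>

lemma (in prob_space) distr_rotate_complex_normal:
  fixes X :: "'a \<Rightarrow> complex"
  assumes [measurable]: "random_variable borel X"
    and ind: "indep_var borel (\<lambda>\<omega>. Re (X \<omega>)) borel (\<lambda>\<omega>. Im (X \<omega>))"
    and nRe: "distributed M lborel (\<lambda>\<omega>. Re (X \<omega>)) (normal_density 0 \<sigma>)"
    and nIm: "distributed M lborel (\<lambda>\<omega>. Im (X \<omega>)) (normal_density 0 \<sigma>)"
    and u: "norm u = 1"
  shows "distr M borel (\<lambda>\<omega>. u * X \<omega>) = distr M borel X"
proof (rule measure_eqI)
  define d where "d p = ennreal (normal_density 0 \<sigma> (fst p)) * ennreal (normal_density 0 \<sigma> (snd p))" for p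
  have [measurable]: "d \<in> borel_measurable (borel \<Otimes>\<^sub>M borel)"
    unfolding d_def by measurable
  have "indep_var lborel (\<lambda>\<omega>. Re (X \<omega>)) lborel (\<lambda>\<omega>. Im (X \<omega>))"
    using indep_var_compose[OF ind, of "\<lambda>x. x" lborel "\<lambda>x. x" lborel] by (simp add: comp_def)
  from distributed_joint_indep[OF _ _ nRe nIm this]
  have D: "distributed M (lborel \<Otimes>\<^sub>M lborel) (\<lambda>\<omega>. (Re (X \<omega>), Im (X \<omega>))) d"
    by (simp add: lborel.sigma_finite_measure_axioms d_def[abs_def] case_prod_beta')
  fix A assume "A \<in> sets (distr M borel (\<lambda>\<omega>. u * X \<omega>))"
  then have [measurable]: "A \<in> sets borel" by simp
  have I: "(\<integral>\<^sup>+\<omega>. f (X \<omega>) \<partial>M) = (\<integral>\<^sup>+p. d p * f (Complex (fst p) (snd p)) \<partial>(lborel \<Otimes>\<^sub>M lborel))"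
    if [measurable]: "f \<in> borel_measurable borel" for f :: "complex \<Rightarrow> ennreal"
  proof -
    have "(\<lambda>p. f (Complex (fst p) (snd p))) \<in> borel_measurable (borel \<Otimes>\<^sub>M borel)"
      by (simp add: Complex_eq)
    then show ?thesis
      using distributed_nn_integral[OF D, of "\<lambda>p. f (Complex (fst p) (snd p))"] by simp
  qed
  have cs: "(Re u)\<^sup>2 + (Im u)\<^sup>2 = 1" using u by (simp add: cmod_def)
  have dd: "d (Re u * fst p - Im u * snd p, Im u * fst p + Re u * snd p) = d p" for p
  proof -
    have "(Re u * fst p - Im u * snd p)\<^sup>2 + (Im u * fst p + Re u * snd p)\<^sup>2
      = ((Re u)\<^sup>2 + (Im u)\<^sup>2) * ((fst p)\<^sup>2 + (snd p)\<^sup>2)" by (simp add: power2_eq_square algebra_simps)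
    then have e: "(Re u * fst p - Im u * snd p)\<^sup>2 + (Im u * fst p + Re u * snd p)\<^sup>2 = (fst p)\<^sup>2 + (snd p)\<^sup>2"
      using cs by simp
    have n: "normal_density 0 \<sigma> x * normal_density 0 \<sigma> y =
        (1 / sqrt (2 * pi * \<sigma>\<^sup>2))\<^sup>2 * exp (- (x\<^sup>2 + y\<^sup>2) / (2 * \<sigma>\<^sup>2))" for x y
    proof -
      have "- (x\<^sup>2 + y\<^sup>2) / (2 * \<sigma>\<^sup>2) = - (x\<^sup>2) / (2 * \<sigma>\<^sup>2) + - (y\<^sup>2) / (2 * \<sigma>\<^sup>2)"
        by (simp only: add_divide_distrib[symmetric] minus_add_distrib)
      then show ?thesis
        by (simp only: normal_density_def exp_add power2_eq_square[of "1 / sqrt _"] mult_ac diff_zero)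
    qed
    show ?thesis
      unfolding d_def by (simp add: ennreal_mult'[symmetric] n e)
  qed
  let ?f = "indicator A :: complex \<Rightarrow> ennreal"
  define F where "F p = d p * ?f (Complex (fst p) (snd p))" for p
  have [measurable]: "F \<in> borel_measurable (borel \<Otimes>\<^sub>M borel)"
    unfolding F_def by (simp add: Complex_eq)
  have "emeasure (distr M borel (\<lambda>\<omega>. u * X \<omega>)) A = (\<integral>\<^sup>+\<omega>. ?f (u * X \<omega>) \<partial>M)"
    by (subst nn_integral_indicator[symmetric], simp, subst nn_integral_distr) auto
  also have "\<dots> = (\<integral>\<^sup>+p. d p * ?f (u * Complex (fst p) (snd p)) \<partial>(lborel \<Otimes>\<^sub>M lborel))"
    by (rule I) measurable
  also have "\<dots> = (\<integral>\<^sup>+p. F (Re u * fst p - Im u * snd p, Im u * fst p + Re u * snd p) \<partial>(lborel \<Otimes>\<^sub>M lborel))"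
    unfolding F_def dd
    by (intro nn_integral_cong arg_cong2[where f="(*)"] arg_cong[where f="?f"] refl)
       (simp add: complex_eq_iff)
  also have "\<dots> = (\<integral>\<^sup>+p. F p \<partial>(lborel \<Otimes>\<^sub>M lborel))"
    by (rule nn_integral_lborel_rotate) (use cs in auto)
  also have "\<dots> = (\<integral>\<^sup>+\<omega>. ?f (X \<omega>) \<partial>M)" unfolding F_def by (rule I[symmetric]) measurable
  also have "\<dots> = emeasure (distr M borel X) A"
    by (subst nn_integral_indicator[symmetric], simp, subst nn_integral_distr) auto
  finally show "emeasure (distr M borel (\<lambda>\<omega>. u * X \<omega>)) A = emeasure (distr M borel X) A" .
qed simp

section \<open>Means of holomorphic functions under rotation invariant laws\<close>

lemma circle_mean_value:
  fixes \<psi> :: "complex \<Rightarrow> complex"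
  assumes h: "\<psi> holomorphic_on ball 0 r" and \<delta>: "norm \<delta> < r"
  shows "((\<lambda>t. \<psi> (\<delta> * exp (2 * of_real pi * \<i> * of_real t))) has_integral \<psi> 0) {0..1}"
proof -
  have "(\<lambda>u. \<psi> (\<delta> * u)) holomorphic_on cball 0 1"
  proof -
    have "(\<lambda>u. \<delta> * u) ` cball 0 1 \<subseteq> ball 0 r"
    proof clarsimp
      fix u :: complex assume "norm u \<le> 1"
      then have "norm \<delta> * norm u \<le> norm \<delta>" by (simp add: mult_left_le)
      with \<delta> show "norm (\<delta> * u) < r" by (simp add: norm_mult)
    qed
    then show ?thesis
      using holomorphic_on_compose_gen[of "\<lambda>u. \<delta> * u" "cball 0 1" \<psi> "ball 0 r"] h
      by (auto simp: comp_def intro!: holomorphic_intros)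
  qed
  \<comment> \<open>Cauchy's formula on the unit circle for the rescaled function; the division by
    \<open>u\<close> cancels against the derivative of the circle parametrisation.\<close>
  from Cauchy_integral_circlepath_simple[OF this, of 0]
  have "((\<lambda>u. \<psi> (\<delta> * u) / u) has_contour_integral (2 * of_real pi * \<i> * \<psi> 0)) (circlepath 0 1)"
    by simp
  then have "((\<lambda>t. \<psi> (\<delta> * exp (2 * of_real pi * \<i> * of_real t)) * (2 * of_real pi * \<i>)) has_integral (2 * of_real pi * \<i> * \<psi> 0)) {0..1}"
    unfolding has_contour_integral
    by (subst (asm) has_integral_cong[where g="\<lambda>t. \<psi> (\<delta> * exp (2 * of_real pi * \<i> * of_real t)) * (2 * of_real pi * \<i>)"])
      (simp only: vector_derivative_circlepath, simp add: circlepath)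
  from has_integral_mult_left[OF this, of "1 / (2 * of_real pi * \<i>)"]
  show ?thesis by simp
qed

text \<open>Since the law is unchanged by every rotation, the mean equals its average over a uniform
  angle; Fubini moves that average inside, where it is the constant \<open>c\<close> for every value
  of \<open>X\<close>.\<close>

lemma (in prob_space) expectation_circle_mean:
  fixes X :: "'a \<Rightarrow> complex" and \<Psi> :: "complex \<Rightarrow> complex"
  assumes X[measurable]: "random_variable borel X" and \<Psi>[measurable]: "\<Psi> \<in> borel_measurable borel"
    and rot: "\<And>u. norm u = 1 \<Longrightarrow> distr M borel (\<lambda>\<omega>. u * X \<omega>) = distr M borel X"
    and bd: "\<And>x. norm (\<Psi> x) \<le> C"
    and mean: "\<And>\<delta>. ((\<lambda>t. \<Psi> (\<delta> * exp (2 * of_real pi * \<i> * of_real t))) has_integral c) {0..1}"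
  shows "expectation (\<lambda>\<omega>. \<Psi> (X \<omega>)) = c"
proof -
  define N where "N = restrict_space lborel {0..1::real}"
  define e where "e t = exp (2 * of_real pi * \<i> * of_real t)" for t :: real
  have [measurable]: "e \<in> borel_measurable borel"
    unfolding e_def by (intro borel_measurable_continuous_onI continuous_intros)
  have eN[measurable]: "e \<in> borel_measurable N"
    unfolding N_def by (intro measurable_restrict_space1) simp
  have ne: "norm (e t) = 1" for t by (simp add: e_def norm_exp_eq_Re)
  interpret N: finite_measure N
    unfolding N_def by (rule finite_measureI) (simp add: emeasure_restrict_space space_restrict_space)
  interpret P: pair_sigma_finite M N ..
  have sN: "measure N (space N) = 1"
    unfolding N_def by (simp add: measure_restrict_space space_restrict_space)
  interpret MN: finite_measure "M \<Otimes>\<^sub>M N"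
    by (rule finite_measureI)
       (simp add: space_pair_measure N.emeasure_pair_measure_Times ennreal_mult_eq_top_iff emeasure_eq_measure N.emeasure_eq_measure)
  have int: "integrable (M \<Otimes>\<^sub>M N) (\<lambda>(\<omega>, t). \<Psi> (X \<omega> * e t))"
    by (rule MN.integrable_const_bound[where B=C]) (auto simp: bd)
  have 1: "(\<integral>\<omega>. \<Psi> (X \<omega> * e t) \<partial>M) = expectation (\<lambda>\<omega>. \<Psi> (X \<omega>))" for t
  proof -
    have "(\<integral>\<omega>. \<Psi> (X \<omega> * e t) \<partial>M) = (\<integral>x. \<Psi> x \<partial>distr M borel (\<lambda>\<omega>. e t * X \<omega>))"
      by (subst integral_distr) (auto simp: mult.commute)
    also have "\<dots> = expectation (\<lambda>\<omega>. \<Psi> (X \<omega>))"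
      unfolding rot[OF ne] by (subst integral_distr) auto
    finally show ?thesis .
  qed
  have 2: "(\<integral>t. \<Psi> (x * e t) \<partial>N) = c" for x
  proof -
    have "set_integrable lborel {0..1} (\<lambda>t. \<Psi> (x * e t))"
      unfolding set_integrable_def
      by (rule integrableI_bounded_set_indicator[where B=C]) (auto simp: bd)
    from set_borel_integral_eq_integral(2)[OF this] mean[of x]
    show ?thesis unfolding N_def
      by (subst integral_restrict_space) (auto simp: set_lebesgue_integral_def e_def integral_unique)
  qed
  have "c = (\<integral>\<omega>. (\<integral>t. \<Psi> (X \<omega> * e t) \<partial>N) \<partial>M)"
    by (simp add: 2 prob_space)
  also have "\<dots> = (\<integral>t. (\<integral>\<omega>. \<Psi> (X \<omega> * e t) \<partial>M) \<partial>N)"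
    by (rule P.Fubini_integral[OF int, symmetric])
  also have "\<dots> = expectation (\<lambda>\<omega>. \<Psi> (X \<omega>))"
    by (simp add: 1 sN)
  finally show ?thesis by simp
qed

text \<open>The cut at radius \<open>r\<close> is radial, so the truncated function still averages
  to \<open>\<psi> 0\<close> on each circle around 0: inside by holomorphy, outside because it is
  constant. This is what lets steps that are too long be suppressed without bias.\<close>

lemma (in prob_space) expectation_holomorphic_truncated:
  fixes X :: "'a \<Rightarrow> complex" and \<psi> :: "complex \<Rightarrow> complex"
  assumes X: "random_variable borel X"
    and rot: "\<And>u. norm u = 1 \<Longrightarrow> distr M borel (\<lambda>\<omega>. u * X \<omega>) = distr M borel X"
    and hol: "\<psi> holomorphic_on ball 0 r" and bd: "\<And>x. norm x < r \<Longrightarrow> norm (\<psi> x) \<le> C" and "0 < r"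
  shows "expectation (\<lambda>\<omega>. if norm (X \<omega>) < r then \<psi> (X \<omega>) else \<psi> 0) = \<psi> 0"
proof (rule expectation_circle_mean[OF X _ rot, where \<Psi>="\<lambda>x. if norm x < r then \<psi> x else \<psi> 0"])
  show "norm (if norm x < r then \<psi> x else \<psi> 0) \<le> C" for x using bd[of x] bd[of 0] \<open>0 < r\<close> by simp
  have "(\<lambda>x. if x \<in> ball 0 r then \<psi> x else \<psi> 0) \<in> borel_measurable borel"
    by (intro borel_measurable_continuous_on_if holomorphic_on_imp_continuous_on hol continuous_intros) auto
  then show "(\<lambda>x. if norm x < r then \<psi> x else \<psi> 0) \<in> borel_measurable borel" by simp
  fix \<delta> :: complex
  have n: "norm (\<delta> * exp (2 * of_real pi * \<i> * of_real t)) = norm \<delta>" for t :: real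
    by (simp add: norm_mult norm_exp_eq_Re)
  show "((\<lambda>t. if norm (\<delta> * exp (2 * of_real pi * \<i> * of_real t)) < r
      then \<psi> (\<delta> * exp (2 * of_real pi * \<i> * of_real t)) else \<psi> 0) has_integral \<psi> 0) {0..1}"
    using circle_mean_value[OF hol, of \<delta>] has_integral_const_real[of "\<psi> 0" 0 1] unfolding n
    by (cases "norm \<delta> < r") auto
qed

section \<open>Inverse branches with a uniform radius\<close>

text \<open>The map \<open>G\<close> follows the inverse branch of \<open>F\<close> through \<open>\<zeta>\<close>, with a radius \<open>r\<close> that is uniform
  on \<open>cball 0 \<rho>\<close>; it freezes points outside \<open>cball 0 \<rho>\<close> and ignores displacements of size at least \<open>r\<close>.\<close>

definition branch_step ::
  "(complex \<Rightarrow> complex) \<Rightarrow> real \<Rightarrow> real \<Rightarrow> (complex \<times> complex \<Rightarrow> complex) \<Rightarrow> bool" where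
  "branch_step F \<rho> r G \<longleftrightarrow> 0 < r \<and> G \<in> borel_measurable borel \<and>
    (\<forall>\<zeta> \<delta>. \<rho> < norm \<zeta> \<or> r \<le> norm \<delta> \<longrightarrow> G (\<zeta>, \<delta>) = \<zeta>) \<and>
    (\<forall>\<zeta>. norm \<zeta> \<le> \<rho> \<longrightarrow> G (\<zeta>, 0) = \<zeta> \<and> (\<lambda>\<delta>. G (\<zeta>, \<delta>)) holomorphic_on ball 0 r \<and>
       (\<forall>\<delta>. norm \<delta> < r \<longrightarrow> norm (G (\<zeta>, \<delta>)) < 1 \<and> F (G (\<zeta>, \<delta>)) = F \<zeta> + \<delta>))"

text \<open>The number \<open>e\<close> is a Lebesgue number of the cover of \<open>K\<close> by
  open sets on which \<open>F\<close> is injective.\<close>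

lemma uniform_injectivity_radius:
  assumes hol: "F holomorphic_on S" and S: "open S" and K: "compact K" "K \<subseteq> S"
    and nz: "\<And>z. z \<in> S \<Longrightarrow> deriv F z \<noteq> 0"
  obtains e where "e > 0" "\<And>z. z \<in> K \<Longrightarrow> ball z e \<subseteq> S \<and> inj_on F (ball z e)"
proof -
  define \<G> where "\<G> = {V. open V \<and> V \<subseteq> S \<and> inj_on F V}"
  have "K \<subseteq> \<Union>\<G>"
  proof
    fix z assume "z \<in> K"
    with K have z: "z \<in> S" by auto
    from has_complex_derivative_locally_injective[OF hol z S nz[OF z]]
    obtain r where "r > 0" "ball z r \<subseteq> S" "inj_on F (ball z r)" .
    then show "z \<in> \<Union>\<G>" unfolding \<G>_def by (intro UnionI[of "ball z r"]) auto
  qed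
  from Heine_Borel_lemma[OF K(1) this]
  obtain e where "0 < e" "\<And>x. x \<in> K \<Longrightarrow> \<exists>G \<in> \<G>. ball x e \<subseteq> G"
    unfolding \<G>_def by blast
  then show thesis
    by (intro that[of e]) (auto simp: \<G>_def dest: inj_on_subset)
qed

text \<open>A single inverse branch comes from the inverse function theorem; the work lies in one
  radius for all centres and in joint measurability in centre and displacement. Both come from
  compactness of \<open>cball 0 \<rho>\<close>.\<close>

lemma branch_step_exists:
  assumes hol: "F holomorphic_on ball 0 1" and nz: "\<And>z. norm z < 1 \<Longrightarrow> deriv F z \<noteq> 0"
    and \<rho>: "0 < \<rho>" "\<rho> < 1"
  shows "\<exists>r G. branch_step F \<rho> r G"
proof -
  obtain e where e: "e > 0" "\<And>z. z \<in> cball 0 \<rho> \<Longrightarrow> ball z e \<subseteq> ball 0 1 \<and> inj_on F (ball z e)"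
    by (rule uniform_injectivity_radius[OF hol, of "cball 0 \<rho>"]) (use \<rho> nz in auto)
  \<comment> \<open>Half the injectivity radius, so that the closed discs of radius \<open>t\<close>
    around the centres still lie where \<open>F\<close> is injective.\<close>
  define t where "t = e / 2"
  have t: "0 < t" "t < e" using e by (auto simp: t_def)
  have cont: "continuous_on (ball 0 1) F" using hol by (rule holomorphic_on_imp_continuous_on)
  have in1: "norm z \<le> \<rho> \<Longrightarrow> norm (w - z) < e \<Longrightarrow> norm w < 1" for z w :: complex
    using e(2)[of z] by (auto simp: subset_iff dist_norm norm_minus_commute)
  have inj: "norm z \<le> \<rho> \<Longrightarrow> norm (w - z) < e \<Longrightarrow> norm (w' - z) < e \<Longrightarrow> F w = F w' \<Longrightarrow> w = w'" for z w w' :: complex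
    using e(2)[of z] by (auto simp: inj_on_def dist_norm norm_minus_commute)
  \<comment> \<open>\<open>S\<close> holds the displacements of \<open>F\<close> over the boundary
    circles. It is compact and misses 0 by injectivity, so its distance from 0 bounds a positive
    \<open>r\<close> from above, and the image of \<open>ball z t\<close> contains
    \<open>ball (F z) r\<close>.\<close>
  define S where "S = (\<lambda>(z, u). F (z + u) - F z) ` (cball 0 \<rho> \<times> sphere 0 t)"
  have contS: "continuous_on (cball 0 \<rho> \<times> cball 0 t) (\<lambda>(z, u). F (z + u) - F z)"
  proof -
    have a: "continuous_on (cball 0 \<rho> \<times> cball 0 t) (\<lambda>p. F (fst p + snd p))"
      by (intro continuous_on_compose2[OF cont] continuous_intros) (use in1 t in force)
    have b: "continuous_on (cball 0 \<rho> \<times> cball 0 t) (\<lambda>p. F (fst p))"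
      by (intro continuous_on_compose2[OF cont] continuous_intros) (use \<rho> in auto)
    show ?thesis using continuous_on_diff[OF a b] by (simp add: case_prod_beta')
  qed
  have "compact S" unfolding S_def
    by (intro compact_continuous_image compact_Times continuous_on_subset[OF contS]) auto
  have "0 \<notin> S"
  proof
    assume "0 \<in> S"
    then obtain z u where "norm z \<le> \<rho>" "norm u = t" "F (z + u) = F z" by (auto simp: S_def)
    with inj[of z "z + u" z] t e show False by auto
  qed
  then obtain r where r: "r > 0" "\<And>x. x \<in> S \<Longrightarrow> r \<le> dist 0 x"
    using separate_point_closed[of S 0] compact_imp_closed[OF \<open>compact S\<close>] by blast
  have surj: "ball (F z) r \<subseteq> F ` ball z t" if z: "norm z \<le> \<rho>" for z
  proof (rule ball_subset_open_map_image)
    have sub: "cball z t \<subseteq> ball 0 1" using in1[OF z] t by (auto simp: dist_norm norm_minus_commute)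
    show "continuous_on (closure (ball z t)) F" using t sub by (auto intro: continuous_on_subset[OF cont])
    show "open (F ` interior (ball z t))"
    proof (simp, rule open_mapping_thm3)
      show "F holomorphic_on ball z t" by (rule holomorphic_on_subset[OF hol]) (use sub in auto)
      show "inj_on F (ball z t)" using e(2)[of z] z t by (auto intro: inj_on_subset)
    qed auto
    show "r \<le> norm (F w - F z)" if "w \<in> frontier (ball z t)" for w
    proof -
      have "F w - F z \<in> S" unfolding S_def using that z t
        by (intro rev_image_eqI[of "(z, w - z)"]) (auto simp: dist_norm norm_minus_commute)
      from r(2)[OF this] show ?thesis by (simp add: norm_minus_commute dist_norm)
    qed
  qed (use t r in auto)
  define K where "K = (cball 0 \<rho> :: complex set) \<times> (cball 0 t :: complex set)"
  \<comment> \<open>Keeping the centre as a first coordinate turns the family of branches into one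
    continuous injection on a compact set. Its inverse is continuous jointly in centre and
    displacement, which makes \<open>G\<close> Borel.\<close>
  define \<Phi> where "\<Phi> = (\<lambda>(z, u). (z, F (z + u) - F z))"
  have \<Phi>c: "continuous_on K \<Phi>"
    using continuous_on_Pair[OF continuous_on_fst[OF continuous_on_id] contS]
    unfolding K_def \<Phi>_def by (simp add: case_prod_beta')
  have \<Phi>inj: "inj_on \<Phi> K"
  proof (rule inj_onI, clarsimp simp: K_def \<Phi>_def)
    fix z u v :: complex assume "norm z \<le> \<rho>" "norm u \<le> t" "norm v \<le> t" "F (z + u) = F (z + v)"
    with inj[of z "z + u" "z + v"] t show "u = v" by simp
  qed
  define g where "g = the_inv_into K \<Phi>"
  have gc: "continuous_on (\<Phi> ` K) g"
    unfolding g_def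
    by (rule continuous_on_inv[OF \<Phi>c]) (auto simp: K_def compact_Times the_inv_into_f_f[OF \<Phi>inj[unfolded K_def]])
  define D where "D = (cball 0 \<rho> :: complex set) \<times> (ball 0 r :: complex set)"
  have Dsub: "D \<subseteq> \<Phi> ` K"
  proof clarify
    fix z d assume "(z, d) \<in> D"
    then have z: "norm z \<le> \<rho>" and d: "norm d < r" by (auto simp: D_def)
    have "F z + d \<in> F ` ball z t" using surj[OF z] d by (auto simp: dist_norm)
    then obtain w where "norm (w - z) < t" "F w = F z + d" by (metis dist_commute dist_norm imageE mem_ball)
    then show "(z, d) \<in> \<Phi> ` K"
      using z by (intro rev_image_eqI[of "(z, w - z)"]) (auto simp: \<Phi>_def K_def)
  qed
  define G where "G p = (if p \<in> D then fst p + snd (g p) else fst p)" for p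
  have Gm: "G \<in> borel_measurable borel"
    unfolding G_def
    by (intro borel_measurable_continuous_on_if continuous_intros continuous_on_subset[OF gc Dsub])
       (auto simp: D_def borel_Times)
  have G: "norm (G (z, d) - z) \<le> t \<and> F (G (z, d)) = F z + d" if z: "norm z \<le> \<rho>" and d: "norm d < r" for z d :: complex
  proof -
    have zd: "(z, d) \<in> D" using that by (auto simp: D_def)
    with Dsub obtain z' u where zu: "(z', u) \<in> K" "(z, d) = \<Phi> (z', u)" by auto
    then have "g (z, d) = (z', u)" unfolding g_def by (simp add: the_inv_into_f_f[OF \<Phi>inj])
    with zu zd show ?thesis by (auto simp: \<Phi>_def G_def K_def)
  qed
  have Guniq: "w = G (z, d)" if "norm z \<le> \<rho>" "norm d < r" "norm (w - z) < e" "F w = F z + d" for z d w :: complex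
    using inj[of z w "G (z, d)"] G[of z d] t that by auto
  show ?thesis
    unfolding branch_step_def
  proof (intro exI[of _ r] exI[of _ G] conjI allI impI)
    show "G \<in> borel_measurable borel" "0 < r" by fact+
    show "G (z, d) = z" if "\<rho> < norm z \<or> r \<le> norm d" for z d using that by (auto simp: G_def D_def)
    fix z :: complex assume z: "norm z \<le> \<rho>"
    show "G (z, 0) = z" using Guniq[of z 0 z] z r e by simp
    have hz: "F holomorphic_on ball z e" "inj_on F (ball z e)"
      using e(2)[of z] z hol by (auto intro: holomorphic_on_subset)
    \<comment> \<open>The joint inverse is so far only continuous; holomorphy in the displacement is
      read off from the local holomorphic inverse \<open>h\<close>, using
      \<open>F (G (z, d)) = F z + d\<close>.\<close>
    from holomorphic_has_inverse[OF hz(1) open_ball hz(2)] obtain h where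
      h: "h holomorphic_on F ` ball z e" "\<And>w. w \<in> ball z e \<Longrightarrow> h (F w) = w" by metis
    have im: "(\<lambda>d. F z + d) ` ball 0 r \<subseteq> F ` ball z e"
      using surj[OF z] t by (force simp: dist_norm)
    have eq: "G (z, d) = h (F z + d)" if "norm d < r" for d
      using h(2)[of "G (z, d)"] G[OF z that] t by (simp add: dist_norm norm_minus_commute)
    have "(h \<circ> (\<lambda>d. F z + d)) holomorphic_on ball 0 r"
      by (rule holomorphic_on_compose_gen[OF _ h(1) im]) (intro holomorphic_intros)
    then show "(\<lambda>d. G (z, d)) holomorphic_on ball 0 r"
      by (rule holomorphic_transform) (simp add: eq)
    fix d :: complex assume d: "norm d < r"
    show "norm (G (z, d)) < 1" using in1[OF z, of "G (z, d)"] G[OF z d] t by simp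
    show "F (G (z, d)) = F z + d" using G[OF z d] by simp
  qed
qed

section \<open>The discrete martingale\<close>

text \<open>Discrete version of the lift: \<open>x\<close> is read as the sequence of path
  increments, and the start 0 lies over the start of the path.\<close>

primrec branch_chain :: "(complex \<times> complex \<Rightarrow> complex) \<Rightarrow> (nat \<Rightarrow> complex) \<Rightarrow> nat \<Rightarrow> complex" where
  "branch_chain G x 0 = 0"
| "branch_chain G x (Suc k) = G (branch_chain G x k, x k)"

lemma branch_chain_cong: "(\<And>i. i < k \<Longrightarrow> x i = y i) \<Longrightarrow> branch_chain G x k = branch_chain G y k"
  by (induction k) auto

lemma measurable_branch_chain:
  assumes [measurable]: "G \<in> borel_measurable borel" and "\<And>i. i < k \<Longrightarrow> X i \<in> borel_measurable M"
  shows "(\<lambda>\<omega>. branch_chain G (\<lambda>i. X i \<omega>) k) \<in> borel_measurable M"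
  using assms(2)
proof (induction k)
  case (Suc k)
  then have [measurable]: "(\<lambda>\<omega>. branch_chain G (\<lambda>i. X i \<omega>) k) \<in> borel_measurable M" "X k \<in> borel_measurable M"
    by auto
  show ?case by simp
qed simp

lemma norm_branch_chain_less_1:
  assumes "branch_step F \<rho> r G"
  shows "norm (branch_chain G x k) < 1"
proof (induction k)
  case (Suc k)
  with assms show ?case unfolding branch_step_def
    by simp (metis linorder_not_le)
qed simp

text \<open>A discrete martingale argument: \<open>X k\<close> is independent of the chain after
  \<open>k\<close> steps, and a step from a fixed position \<open>y\<close> preserves the mean of
  \<phi>, either because the chain is frozen at \<open>y\<close> or by the truncated mean value
  property of the branch through \<open>y\<close>.\<close>

lemma (in prob_space) expectation_branch_chain:
  fixes \<phi> :: "complex \<Rightarrow> complex"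
  assumes G: "branch_step F \<rho> r G" and "\<rho> < 1"
    and X: "\<And>i. i < n \<Longrightarrow> random_variable borel (X i)"
    and ind: "indep_vars (\<lambda>_. borel) X {..<n}"
    and rot: "\<And>i u. i < n \<Longrightarrow> norm u = 1 \<Longrightarrow> distr M borel (\<lambda>\<omega>. u * X i \<omega>) = distr M borel (X i)"
    and \<phi>: "continuous_on (cball 0 1) \<phi>" "\<phi> holomorphic_on ball 0 1"
  shows "expectation (\<lambda>\<omega>. \<phi> (branch_chain G (\<lambda>i. X i \<omega>) n)) = \<phi> 0"
proof -
  have Gm[measurable]: "G \<in> borel_measurable borel" using G by (simp add: branch_step_def)
  \<comment> \<open>Extension by 0 makes \<phi> a bounded Borel function on the whole plane; the
    chain stays in the open disc, where \<open>f\<close> and \<phi> agree.\<close>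
  define f where "f x = (if x \<in> cball 0 1 then \<phi> x else 0)" for x
  have [measurable]: "f \<in> borel_measurable borel"
    unfolding f_def by (intro borel_measurable_continuous_on_if \<phi>) auto
  obtain C where C: "\<And>x. norm (f x) \<le> C"
  proof -
    have "bounded (\<phi> ` cball 0 1)" by (intro compact_imp_bounded compact_continuous_image \<phi>) auto
    then obtain C where "\<forall>x\<in>cball 0 1. norm (\<phi> x) \<le> C" by (auto simp: bounded_iff)
    then show thesis by (intro that[of "max C 0"]) (auto simp: f_def le_max_iff_disj)
  qed
  have "k \<le> n \<Longrightarrow> expectation (\<lambda>\<omega>. f (branch_chain G (\<lambda>i. X i \<omega>) k)) = f 0" for k
  proof (induction k)
    case 0 then show ?case by (simp add: prob_space)
  next
    case (Suc k)
    then have k: "k < n" by simp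
    have Xk[measurable]: "random_variable borel (X k)" using X[OF k] .
    let ?Y = "\<lambda>\<omega>. branch_chain G (\<lambda>i. X i \<omega>) k"
    have Y[measurable]: "random_variable borel ?Y"
      by (rule measurable_branch_chain[OF Gm]) (use X k in simp)
    \<comment> \<open>Independence of past and next increment comes from grouping the family over
      the disjoint index sets \<open>{..<k}\<close> and \<open>{k}\<close>.\<close>
    have "indep_var borel ((\<lambda>x. branch_chain G x k) \<circ> (\<lambda>\<omega>. restrict (\<lambda>i. X i \<omega>) {..<k}))
        borel ((\<lambda>x. x k) \<circ> (\<lambda>\<omega>. restrict (\<lambda>i. X i \<omega>) {k}))"
    proof (rule indep_var_compose)
      show "indep_var (PiM {..<k} (\<lambda>_. borel)) (\<lambda>\<omega>. restrict (\<lambda>i. X i \<omega>) {..<k})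
          (PiM {k} (\<lambda>_. borel)) (\<lambda>\<omega>. restrict (\<lambda>i. X i \<omega>) {k})"
        by (rule indep_var_restrict[OF ind]) (use k in auto)
      show "(\<lambda>x. branch_chain G x k) \<in> borel_measurable (PiM {..<k} (\<lambda>_. borel))"
        by (rule measurable_branch_chain[where X="\<lambda>i x. x i"]) (auto intro: Gm)
    qed measurable
    moreover have "branch_chain G (restrict (\<lambda>i. X i \<omega>) {..<k}) k = ?Y \<omega>" for \<omega>
      by (rule branch_chain_cong) simp
    ultimately have I: "indep_var borel ?Y borel (X k)"
      by (simp add: comp_def)
    define DY where "DY = distr M borel ?Y"
    define DX where "DX = distr M borel (X k)"
    interpret DY: prob_space DY unfolding DY_def by (rule prob_space_distr) simp
    interpret DX: prob_space DX unfolding DX_def by (rule prob_space_distr) simp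
    interpret P: pair_prob_space DY DX ..
    have D: "distr M (borel \<Otimes>\<^sub>M borel) (\<lambda>\<omega>. (?Y \<omega>, X k \<omega>)) = DY \<Otimes>\<^sub>M DX"
      using I unfolding indep_var_distribution_eq DY_def DX_def by simp
    have sets[measurable_cong]: "sets DY = sets borel" "sets DX = sets borel" by (auto simp: DY_def DX_def)
    have inner: "(\<integral>z. f (G (y, z)) \<partial>DX) = f y" for y
    proof -
      have eq: "(\<integral>z. f (G (y, z)) \<partial>DX) = expectation (\<lambda>\<omega>. f (G (y, X k \<omega>)))"
        unfolding DX_def by (subst integral_distr) auto
      show ?thesis
      proof (cases "norm y \<le> \<rho>")
        case False
        then have "G (y, z) = y" for z using G by (simp add: branch_step_def)
        then show ?thesis unfolding eq by (simp add: prob_space)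
      next
        case True
        define \<psi> where "\<psi> d = \<phi> (G (y, d))" for d
        have h: "G (y, 0) = y" "(\<lambda>d. G (y, d)) holomorphic_on ball 0 r"
          "\<And>d. norm d < r \<Longrightarrow> norm (G (y, d)) < 1" "0 < r" "\<And>d. r \<le> norm d \<Longrightarrow> G (y, d) = y"
          using G True by (auto simp: branch_step_def)
        have hol: "\<psi> holomorphic_on ball 0 r"
        proof -
          have "(\<lambda>d. G (y, d)) ` ball 0 r \<subseteq> ball 0 1" using h(3) by auto
          from holomorphic_on_compose_gen[OF h(2) \<phi>(2) this] show ?thesis by (simp add: comp_def \<psi>_def[abs_def])
        qed
        have C': "norm (\<psi> d) \<le> C" if "norm d < r" for d
          using C[of "G (y, d)"] h(3)[OF that] by (simp add: \<psi>_def f_def)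
        have "expectation (\<lambda>\<omega>. if norm (X k \<omega>) < r then \<psi> (X k \<omega>) else \<psi> 0) = \<psi> 0"
          by (rule expectation_holomorphic_truncated[OF Xk rot[OF k] hol, where C=C])
             (use C' h(3,4) in auto)
        moreover have "(if norm d < r then \<psi> d else \<psi> 0) = f (G (y, d))" for d
          using h True \<open>\<rho> < 1\<close> by (auto simp: \<psi>_def f_def less_imp_le)
        ultimately show ?thesis using True \<open>\<rho> < 1\<close> unfolding eq by (simp add: \<psi>_def h f_def)
      qed
    qed
    have "sets (DY \<Otimes>\<^sub>M DX) = sets (borel :: (complex \<times> complex) measure)"
      unfolding borel_prod[symmetric] by (rule sets_pair_measure_cong) (fact sets)+
    then have [measurable]: "G \<in> borel_measurable (DY \<Otimes>\<^sub>M DX)"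
      using Gm measurable_cong_sets[OF _ refl] by blast
    have int: "integrable (DY \<Otimes>\<^sub>M DX) (\<lambda>p. f (G p))"
      by (rule P.integrable_const_bound[where B=C]) (auto simp: C)
    have "expectation (\<lambda>\<omega>. f (branch_chain G (\<lambda>i. X i \<omega>) (Suc k))) = (\<integral>p. f (G p) \<partial>(DY \<Otimes>\<^sub>M DX))"
      unfolding D[symmetric] by (subst integral_distr) auto
    also have "\<dots> = (\<integral>y. (\<integral>z. f (G (y, z)) \<partial>DX) \<partial>DY)"
      by (rule P.integral_fst'[OF int, symmetric])
    also have "\<dots> = (\<integral>y. f y \<partial>DY)" by (simp add: inner)
    also have "\<dots> = expectation (\<lambda>\<omega>. f (?Y \<omega>))"
      unfolding DY_def by (subst integral_distr) auto
    finally show ?case using Suc by simp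
  qed
  from this[of n] show ?thesis
    using norm_branch_chain_less_1[OF G] by (simp add: f_def less_imp_le)
qed

section \<open>Lifting paths through a local biholomorphism\<close>

definition is_lift :: "(complex \<Rightarrow> complex) \<Rightarrow> (real \<Rightarrow> complex) \<Rightarrow> real \<Rightarrow> (real \<Rightarrow> complex) \<Rightarrow> bool" where
  "is_lift F b T \<zeta> \<longleftrightarrow> continuous_on {0..T} \<zeta> \<and> \<zeta> 0 = 0 \<and> (\<forall>s\<in>{0..T}. norm (\<zeta> s) < 1 \<and> F (\<zeta> s) = b s)"

definition lift_times :: "(complex \<Rightarrow> complex) \<Rightarrow> (real \<Rightarrow> complex) \<Rightarrow> real set" where
  "lift_times F b = {T. 0 \<le> T \<and> (\<exists>\<zeta>. is_lift F b T \<zeta>)}"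

text \<open>For each \<open>t\<close> some lift over \<open>{0..t}\<close> is chosen and evaluated
  at its end point. By uniqueness of lifts the values for different \<open>t\<close> fit together
  into one path.\<close>

definition the_lift :: "(complex \<Rightarrow> complex) \<Rightarrow> (real \<Rightarrow> complex) \<Rightarrow> real \<Rightarrow> complex" where
  "the_lift F b t = (SOME \<zeta>. is_lift F b t \<zeta>) t"

definition exit_point :: "(complex \<Rightarrow> complex) \<Rightarrow> (real \<Rightarrow> complex) \<Rightarrow> complex" where
  "exit_point F b = Lim (at_left (Sup (lift_times F b))) (the_lift F b)"

text \<open>The lift stopped at its exit time: the times of existence will turn out to form a
  half-open interval starting at 0, so a nonnegative time outside them lies at or after the
  exit.\<close>

definition stopped_lift :: "(complex \<Rightarrow> complex) \<Rightarrow> (real \<Rightarrow> complex) \<Rightarrow> real \<Rightarrow> complex" where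
  "stopped_lift F b T = (if T \<in> lift_times F b then the_lift F b T else exit_point F b)"

lemma is_lift_mono: "is_lift F b T \<zeta> \<Longrightarrow> S \<le> T \<Longrightarrow> is_lift F b S \<zeta>"
  unfolding is_lift_def by (auto intro: continuous_on_subset)

lemma is_lift_cong: "is_lift F b T \<zeta> \<Longrightarrow> 0 \<le> T \<Longrightarrow> (\<And>s. s \<in> {0..T} \<Longrightarrow> \<zeta>' s = \<zeta> s) \<Longrightarrow> is_lift F b T \<zeta>'"
  unfolding is_lift_def using continuous_on_eq[of "{0..T}" \<zeta> \<zeta>'] by simp

text \<open>The coincidence set contains 0, is closed by continuity and open because
  \<open>F\<close> is locally injective, hence is the whole interval.\<close>

lemma is_lift_unique:
  assumes hol: "F holomorphic_on ball 0 1" and nz: "\<And>z. norm z < 1 \<Longrightarrow> deriv F z \<noteq> 0"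
    and l: "is_lift F b T \<zeta>" "is_lift F b T \<zeta>'" and s: "s \<in> {0..T}"
  shows "\<zeta> s = \<zeta>' s"
proof -
  define S where "S = {s \<in> {0..T}. \<zeta> s - \<zeta>' s = 0}"
  have c: "continuous_on {0..T} \<zeta>" "continuous_on {0..T} \<zeta>'" and z: "\<zeta> 0 = 0" "\<zeta>' 0 = 0"
    and eq: "\<And>s. s \<in> {0..T} \<Longrightarrow> F (\<zeta> s) = F (\<zeta>' s)" and n: "\<And>s. s \<in> {0..T} \<Longrightarrow> norm (\<zeta> s) < 1"
    using l by (auto simp: is_lift_def)
  have "closedin (top_of_set {0..T}) S"
    unfolding S_def by (intro continuous_closedin_preimage_constant continuous_intros c)
  moreover have "openin (top_of_set {0..T}) S"
    unfolding openin_contains_ball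
  proof (intro conjI ballI)
    show "S \<subseteq> {0..T}" by (auto simp: S_def)
    fix x assume x: "x \<in> S"
    then have xT: "x \<in> {0..T}" and e: "\<zeta> x = \<zeta>' x" by (auto simp: S_def)
    have "\<zeta> x \<in> ball 0 1" using n[OF xT] by simp
    from has_complex_derivative_locally_injective[OF hol this open_ball nz[OF n[OF xT]]]
    obtain r where r: "r > 0" "inj_on F (ball (\<zeta> x) r)" by metis
    obtain d1 where d1: "d1 > 0" "\<And>y. y \<in> {0..T} \<Longrightarrow> dist y x < d1 \<Longrightarrow> dist (\<zeta> y) (\<zeta> x) < r"
      using c(1)[unfolded continuous_on_iff, rule_format, OF xT r(1)] by blast
    obtain d2 where d2: "d2 > 0" "\<And>y. y \<in> {0..T} \<Longrightarrow> dist y x < d2 \<Longrightarrow> dist (\<zeta>' y) (\<zeta>' x) < r"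
      using c(2)[unfolded continuous_on_iff, rule_format, OF xT r(1)] by blast
    show "\<exists>e>0. ball x e \<inter> {0..T} \<subseteq> S"
    proof (intro exI[of _ "min d1 d2"] conjI subsetI)
      fix y assume "y \<in> ball x (min d1 d2) \<inter> {0..T}"
      then have y: "y \<in> {0..T}" "dist y x < d1" "dist y x < d2" by (simp_all add: dist_commute)
      have "\<zeta> y \<in> ball (\<zeta> x) r" "\<zeta>' y \<in> ball (\<zeta> x) r"
        using d1(2)[OF y(1,2)] d2(2)[OF y(1,3)] unfolding e mem_ball by (metis dist_commute)+
      then have "\<zeta> y = \<zeta>' y" using inj_onD[OF r(2) eq[OF y(1)]] by blast
      with y(1) show "y \<in> S" by (simp add: S_def)
    qed (use d1(1) d2(1) in simp)
  qed
  ultimately have "S = {} \<or> S = {0..T}"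
    using connected_clopen[of "{0..T}"] by auto
  moreover have "0 \<in> S" using z s by (simp add: S_def)
  ultimately have "S = {0..T}" by auto
  then have "s \<in> S" using s by metis
  then show ?thesis by (simp add: S_def)
qed

text \<open>While \<open>b\<close> stays within \<open>r\<close> of \<open>b T\<close>, the single
  branch through \<open>\<zeta> T\<close> continues the lift; the pieces match at \<open>T\<close>
  because displacement 0 leaves the point fixed.\<close>

lemma is_lift_extend:
  assumes G: "branch_step F \<rho> r G" and l: "is_lift F b T \<zeta>" and T: "0 \<le> T" "T \<le> T'"
    and \<rho>: "norm (\<zeta> T) \<le> \<rho>" and b: "continuous_on {T..T'} b" "\<And>u. u \<in> {T..T'} \<Longrightarrow> norm (b u - b T) < r"
  shows "is_lift F b T' (\<lambda>u. if u \<le> T then \<zeta> u else G (\<zeta> T, b u - b T))"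
proof -
  have h: "G (\<zeta> T, 0) = \<zeta> T" "(\<lambda>d. G (\<zeta> T, d)) holomorphic_on ball 0 r"
      "\<And>d. norm d < r \<Longrightarrow> norm (G (\<zeta> T, d)) < 1" "\<And>d. norm d < r \<Longrightarrow> F (G (\<zeta> T, d)) = F (\<zeta> T) + d"
    using G \<rho> by (auto simp: branch_step_def)
  have c: "continuous_on {T..T'} (\<lambda>u. G (\<zeta> T, b u - b T))"
    by (rule continuous_on_compose2[OF holomorphic_on_imp_continuous_on[OF h(2)]])
       (use b in \<open>auto intro!: continuous_intros\<close>)
  have "continuous_on ({0..T} \<union> {T..T'}) (\<lambda>u. if u \<le> T then \<zeta> u else G (\<zeta> T, b u - b T))"
  proof (rule continuous_on_cases[OF _ _ _ c])
    show "\<forall>x. x \<in> {0..T} \<and> \<not> x \<le> T \<or> x \<in> {T..T'} \<and> x \<le> T \<longrightarrow> \<zeta> x = G (\<zeta> T, b x - b T)"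
    proof (intro allI impI)
      fix x assume "x \<in> {0..T} \<and> \<not> x \<le> T \<or> x \<in> {T..T'} \<and> x \<le> T"
      then have "x = T" by auto
      then show "\<zeta> x = G (\<zeta> T, b x - b T)" by (simp add: h(1))
    qed
  qed (use l in \<open>auto simp: is_lift_def\<close>)
  moreover have "{0..T} \<union> {T..T'} = {0..T'}" using T by auto
  ultimately show ?thesis using l h b T unfolding is_lift_def by auto
qed

lemma is_lift_zero: "F 0 = b 0 \<Longrightarrow> is_lift F b 0 (\<lambda>_. 0)"
  by (auto simp: is_lift_def)

section \<open>Lifting one fixed continuous path\<close>

locale path_lifting =
  fixes F :: "complex \<Rightarrow> complex" and b :: "real \<Rightarrow> complex"
  assumes hol: "F holomorphic_on ball 0 1" and nz: "\<And>z. norm z < 1 \<Longrightarrow> deriv F z \<noteq> 0"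
    and b: "continuous_on {0..} b" and b0: "F 0 = b 0"
begin

lemma the_lift_eq: "is_lift F b T \<zeta> \<Longrightarrow> s \<in> {0..T} \<Longrightarrow> the_lift F b s = \<zeta> s"
  unfolding the_lift_def
  by (rule is_lift_unique[OF hol nz someI[of "is_lift F b s"]]) (auto intro: is_lift_mono)

lemma is_lift_the_lift: "T \<in> lift_times F b \<Longrightarrow> is_lift F b T (the_lift F b)"
proof -
  assume "T \<in> lift_times F b"
  then obtain \<zeta> where "is_lift F b T \<zeta>" "0 \<le> T" by (auto simp: lift_times_def)
  then show ?thesis using is_lift_cong the_lift_eq by blast
qed

lemma lift_times_0: "0 \<in> lift_times F b"
  using is_lift_zero[of F b] b0 by (auto simp: lift_times_def)

lemma lift_times_mono: "T \<in> lift_times F b \<Longrightarrow> 0 \<le> S \<Longrightarrow> S \<le> T \<Longrightarrow> S \<in> lift_times F b"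
  unfolding lift_times_def using is_lift_mono by blast

lemma b_cont: "0 \<le> x \<Longrightarrow> r > 0 \<Longrightarrow> \<exists>d>0. \<forall>y\<ge>0. \<bar>y - x\<bar> < d \<longrightarrow> norm (b y - b x) < r"
  using b[unfolded continuous_on_iff, rule_format, of x r] by (auto simp: dist_norm)

lemma lift_times_open:
  assumes T: "T \<in> lift_times F b"
  shows "\<exists>e>0. T + e \<in> lift_times F b"
proof -
  have l: "is_lift F b T (the_lift F b)" and T0: "0 \<le> T" using is_lift_the_lift[OF T] T by (auto simp: lift_times_def)
  \<comment> \<open>The maximum with 1/2 secures a positive radius.\<close>
  define \<rho> where "\<rho> = max (norm (the_lift F b T)) (1/2)"
  have "0 < \<rho>" "\<rho> < 1" using l T0 by (auto simp: \<rho>_def is_lift_def)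
  from branch_step_exists[OF hol nz this] obtain r G where G: "branch_step F \<rho> r G" by auto
  then have "r > 0" by (simp add: branch_step_def)
  from b_cont[OF T0 this] obtain d where d: "d > 0" "\<And>y. y \<ge> 0 \<Longrightarrow> \<bar>y - T\<bar> < d \<Longrightarrow> norm (b y - b T) < r" by blast
  have "is_lift F b (T + d/2) (\<lambda>u. if u \<le> T then the_lift F b u else G (the_lift F b T, b u - b T))"
    by (rule is_lift_extend[OF G l T0]) (use d T0 in \<open>auto simp: \<rho>_def intro: continuous_on_subset[OF b]\<close>)
  then show ?thesis using d T0 by (intro exI[of _ "d/2"]) (auto simp: lift_times_def)
qed

text \<open>With increments below \<open>r\<close> over each mesh interval, chain and lift follow
  the same branch at each step until the lift first exceeds \<rho> at a grid time; there the chain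
  freezes. The index \<open>j\<close> marks that time, or is \<open>k\<close> if it has not come
  before.\<close>

lemma chain_follows_lift:
  assumes G: "branch_step F \<rho> r G" and h: "h \<ge> 0"
    and mesh: "\<And>s u. s \<in> {0..real N * h} \<Longrightarrow> u \<in> {0..real N * h} \<Longrightarrow> \<bar>s - u\<bar> \<le> h \<Longrightarrow> norm (b s - b u) < r"
    and k: "k \<le> N"
  shows "\<exists>j\<le>k. real j * h \<in> lift_times F b \<and>
    branch_chain G (\<lambda>i. b (real (Suc i) * h) - b (real i * h)) k = the_lift F b (real j * h) \<and>
    (j = k \<or> \<rho> < norm (the_lift F b (real j * h))) \<and>
    (\<forall>i<j. norm (the_lift F b (real i * h)) \<le> \<rho>)"
  using k
proof (induction k)
  case 0
  show ?case using lift_times_0 the_lift_eq[OF is_lift_zero, of 0] b0 by auto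
next
  case (Suc k)
  let ?x = "\<lambda>i. b (real (Suc i) * h) - b (real i * h)"
  from Suc obtain j where j: "j \<le> k" "real j * h \<in> lift_times F b"
    "branch_chain G ?x k = the_lift F b (real j * h)"
    "j = k \<or> \<rho> < norm (the_lift F b (real j * h))" "\<And>i. i < j \<Longrightarrow> norm (the_lift F b (real i * h)) \<le> \<rho>" by auto
  show ?case
  proof (cases "\<rho> < norm (the_lift F b (real j * h))")
    case True
    then have "branch_chain G ?x (Suc k) = the_lift F b (real j * h)"
      using G j(3) by (simp add: branch_step_def)
    with j True show ?thesis by (intro exI[of _ j]) auto
  next
    case False
    with j have jk: "j = k" by auto
    let ?T = "real k * h" and ?T' = "real (Suc k) * h"
    have TT: "0 \<le> ?T" "?T \<le> ?T'" "?T' \<le> real N * h"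
      using h Suc.prems by (auto intro!: mult_right_mono)
    have d: "?T' - ?T = h" by (simp add: algebra_simps)
    have "is_lift F b ?T' (\<lambda>u. if u \<le> ?T then the_lift F b u else G (the_lift F b ?T, b u - b ?T))" (is "is_lift F b ?T' ?\<zeta>")
    proof (rule is_lift_extend[OF G is_lift_the_lift TT(1,2)])
      show "?T \<in> lift_times F b" using j jk by simp
      show "norm (the_lift F b ?T) \<le> \<rho>" using False jk by simp
      show "continuous_on {?T..?T'} b" using TT by (auto intro: continuous_on_subset[OF b])
      show "norm (b u - b ?T) < r" if "u \<in> {?T..?T'}" for u
      proof (rule mesh)
        have "0 \<le> u" using that TT(1) by (simp only: atLeastAtMost_iff) linarith
        then show "u \<in> {0..real N * h}" using that TT(3) by auto
        show "?T \<in> {0..real N * h}" using TT unfolding atLeastAtMost_iff by linarith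
        show "\<bar>u - ?T\<bar> \<le> h" using that d by auto
      qed
    qed
    note l = this
    then have T': "?T' \<in> lift_times F b" using TT by (auto simp: lift_times_def)
    have "the_lift F b ?T' = ?\<zeta> ?T'" by (rule the_lift_eq[OF l]) (use TT in auto)
    also have "\<dots> = branch_chain G ?x (Suc k)"
    \<comment> \<open>If \<open>h = 0\<close> both grid times coincide, so the conditional picks its
      first branch, and the step of the chain has displacement 0.\<close>
    proof (cases "h = 0")
      case True
      then show ?thesis using j(3) jk G False by (auto simp: branch_step_def)
    next
      case False
      with h d have "?T < ?T'" by auto
      then show ?thesis using j(3) jk by auto
    qed
    finally show ?thesis using T' j jk False
      by (intro exI[of _ "Suc k"]) (auto simp: less_Suc_eq)
  qed
qed

text \<open>Dyadic grids are nested, so the freezing times decrease under refinement and converge.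
  The lift is continuous at the limit time; unless that time is \<open>T\<close>, the norm of the
  lift exceeds \<rho> at all late freezing times and so is at least \<rho> in the limit.\<close>

lemma chain_limit:
  assumes G: "branch_step F \<rho> r G" and T: "T \<ge> 0"
  defines "c \<equiv> (\<lambda>n. branch_chain G (\<lambda>i. b (real (Suc i) * (T / 2^n)) - b (real i * (T / 2^n))) (2^n))"
  shows "\<exists>u \<in> lift_times F b. u \<le> T \<and> (u = T \<or> \<rho> \<le> norm (the_lift F b u)) \<and> c \<longlonglongrightarrow> the_lift F b u"
proof -
  let ?L = "the_lift F b"
  have r: "r > 0" using G by (simp add: branch_step_def)
  have "uniformly_continuous_on {0..T} b"
    by (intro compact_uniformly_continuous continuous_on_subset[OF b]) auto
  with r obtain d where d: "d > 0" "\<And>s u. s \<in> {0..T} \<Longrightarrow> u \<in> {0..T} \<Longrightarrow> \<bar>s - u\<bar> < d \<Longrightarrow> norm (b s - b u) < r"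
    unfolding uniformly_continuous_on_def dist_norm by (metis real_norm_def)
  have "(\<lambda>n. T / 2^n) \<longlonglongrightarrow> 0" by (rule LIMSEQ_divide_realpow_zero) simp
  then have "\<forall>\<^sub>F n in sequentially. T / 2^n < d" using d(1) by (rule order_tendstoD)
  then obtain N where N: "\<And>n. n \<ge> N \<Longrightarrow> T / 2^n < d" by (auto simp: eventually_sequentially)
  define P where "P n j \<longleftrightarrow> j \<le> 2^n \<and> real j * (T / 2^n) \<in> lift_times F b \<and> c n = ?L (real j * (T / 2^n)) \<and>
    (j = 2^n \<or> \<rho> < norm (?L (real j * (T / 2^n)))) \<and> (\<forall>i<j. norm (?L (real i * (T / 2^n))) \<le> \<rho>)" for n j
  have "\<exists>j. P n j" if "n \<ge> N" for n
    unfolding P_def c_def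
    by (rule chain_follows_lift[OF G, where N="2^n"]) (use N[OF that] T in \<open>auto intro!: d\<close>)
  then obtain J where J: "\<And>n. n \<ge> N \<Longrightarrow> P n (J n)" by metis
  define u where "u n = real (J (n + N)) * (T / 2^(n + N))" for n
  have uA: "u n \<in> lift_times F b" "c (n + N) = ?L (u n)" "u n = T \<or> \<rho> < norm (?L (u n))" "u n \<le> T" "u n \<ge> 0" for n
  proof -
    have Pn: "P (n + N) (J (n + N))" by (rule J) simp
    then have "real (J (n + N)) \<le> 2^(n + N)" unfolding P_def by (metis of_nat_le_iff of_nat_numeral of_nat_power)
    then have "u n \<le> 2^(n + N) * (T / 2^(n + N))" unfolding u_def using T by (intro mult_right_mono) auto
    then show "u n \<le> T" by simp
    show "u n \<ge> 0" using T by (simp add: u_def)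
    show "u n \<in> lift_times F b" "c (n + N) = ?L (u n)" using Pn by (simp_all add: P_def u_def)
    show "u n = T \<or> \<rho> < norm (?L (u n))" using Pn unfolding P_def u_def by fastforce
  qed
  have "decseq u"
  proof (rule decseq_SucI, rule ccontr)
    fix n assume lt: "\<not> u (Suc n) \<le> u n"
    let ?j = "J (n + N)" and ?j' = "J (Suc n + N)" and ?h = "T / 2^(Suc n + N)"
    \<comment> \<open>The coarse freezing time is the grid point of index \<open>2 * ?j\<close> in
      the refined grid. If the finer chain passed it, the lift would be within \<rho> there, so the
      coarse time would be \<open>T\<close>, which cannot be exceeded.\<close>
    have un: "u n = real (2 * ?j) * ?h" by (simp add: u_def)
    have un': "u (Suc n) = real ?j' * ?h" by (simp add: u_def)
    have "2 * ?j < ?j'"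
    proof (rule ccontr)
      assume "\<not> 2 * ?j < ?j'"
      then have "real ?j' * ?h \<le> real (2 * ?j) * ?h" using T by (intro mult_right_mono) auto
      with lt show False unfolding un un' by simp
    qed
    then have "norm (?L (u n)) \<le> \<rho>" using J[of "Suc n + N"] unfolding un P_def by auto
    with uA(3)[of n] have "u n = T" by auto
    with lt uA(4)[of "Suc n"] show False by simp
  qed
  moreover have "\<bar>u i\<bar> \<le> T" for i using uA(4,5)[of i] by simp
  ultimately obtain v where v: "u \<longlonglongrightarrow> v" "\<And>i. v \<le> u i"
    using decseq_convergent[of u 0] uA(5) by metis
  have "0 \<le> v" by (rule LIMSEQ_le_const[OF v(1)]) (use uA(5) in auto)
  moreover have "v \<le> T" using v(2)[of 0] uA(4)[of 0] by simp
  ultimately have v0: "0 \<le> v" "v \<le> T" by auto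
  have vA: "v \<in> lift_times F b" using lift_times_mono[OF uA(1) v0(1) v(2)] .
  have "continuous_on {0..u 0} ?L" using is_lift_the_lift[OF uA(1)] by (simp add: is_lift_def)
  then have lim: "(\<lambda>n. ?L (u n)) \<longlonglongrightarrow> ?L v"
    by (rule continuous_on_tendsto_compose[OF _ v(1)])
       (use v v0 uA(5) \<open>decseq u\<close> in \<open>auto simp: decseq_def\<close>)
  then have "(\<lambda>n. c (n + N)) \<longlonglongrightarrow> ?L v" by (simp add: uA(2))
  then have cl: "c \<longlonglongrightarrow> ?L v" by (rule LIMSEQ_offset)
  have "\<rho> \<le> norm (?L v)" if "v \<noteq> T"
  proof -
    have "\<forall>\<^sub>F n in sequentially. u n < T" using order_tendstoD(2)[OF v(1)] that v0 by simp
    then have "\<forall>\<^sub>F n in sequentially. \<rho> \<le> norm (?L (u n))"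
    proof eventually_elim
      case (elim n)
      then show ?case using uA(3)[of n] by simp
    qed
    with tendsto_norm[OF lim] show ?thesis by (rule tendsto_lowerbound) simp
  qed
  with vA v0 cl show ?thesis by auto
qed

lemma lift_bounded_away:
  assumes "T \<in> lift_times F b"
  shows "\<exists>\<rho><1. \<forall>s\<in>{0..T}. norm (the_lift F b s) \<le> \<rho>"
proof -
  have T: "0 \<le> T" using assms by (simp add: lift_times_def)
  have l: "is_lift F b T (the_lift F b)" by (rule is_lift_the_lift) fact
  have "\<exists>x\<in>{0..T}. \<forall>y\<in>{0..T}. norm (the_lift F b y) \<le> norm (the_lift F b x)"
    by (rule continuous_attains_sup) (use l T in \<open>auto simp: is_lift_def intro: continuous_intros\<close>)
  then show ?thesis using l unfolding is_lift_def by blast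
qed

text \<open>The set of lift times contains 0, is closed downwards and has no largest element;
  bounded by \<open>T\<close>, it is the half-open interval from 0 to its supremum.\<close>

lemma lift_times_eq:
  assumes "T \<notin> lift_times F b" "T \<ge> 0"
  shows "x \<in> lift_times F b \<longleftrightarrow> 0 \<le> x \<and> x < Sup (lift_times F b)" "Sup (lift_times F b) \<le> T" "0 < Sup (lift_times F b)"
proof -
  let ?A = "lift_times F b"
  have ub: "x \<in> ?A \<Longrightarrow> x < T" for x using assms lift_times_mono[of x T] by force
  then have bdd: "bdd_above ?A" by (intro bdd_aboveI[of _ T]) (auto intro: less_imp_le)
  have ne: "?A \<noteq> {}" using lift_times_0 by auto
  show le: "Sup ?A \<le> T" using ub by (intro cSup_least ne) (auto intro: less_imp_le)
  have lt: "x < Sup ?A" if x: "x \<in> ?A" for x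
  proof -
    obtain e where "e > 0" "x + e \<in> ?A" using lift_times_open[OF x] by auto
    then show ?thesis using cSup_upper[OF _ bdd, of "x + e"] by auto
  qed
  show "0 < Sup ?A" using lt[OF lift_times_0] .
  show "x \<in> ?A \<longleftrightarrow> 0 \<le> x \<and> x < Sup ?A"
  proof
    assume x: "x \<in> ?A"
    then have "0 \<le> x" by (auto simp: lift_times_def)
    with lt[OF x] show "0 \<le> x \<and> x < Sup ?A" by simp
  next
    assume x: "0 \<le> x \<and> x < Sup ?A"
    then obtain y where "y \<in> ?A" "x < y" using less_cSup_iff[OF ne bdd] by auto
    then show "x \<in> ?A" using lift_times_mono x by auto
  qed
qed

text \<open>A visit to the disc of radius \<rho> shortly before \<tau> is impossible: the uniform
  branch radius there and the continuity of \<open>b\<close> would extend the lift to \<tau> itself.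
  So the norm of the lift tends to 1, which is stronger than leaving each smaller disc once.\<close>

lemma lift_exits:
  assumes "T \<notin> lift_times F b" "T \<ge> 0" and \<rho>: "\<rho> < 1"
  shows "\<forall>\<^sub>F s in at_left (Sup (lift_times F b)). \<rho> < norm (the_lift F b s)"
proof -
  let ?\<tau> = "Sup (lift_times F b)"
  note A = lift_times_eq[OF assms(1,2)]
  define \<rho>' where "\<rho>' = max \<rho> (1/2)"
  have "0 < \<rho>'" "\<rho>' < 1" using \<rho> by (auto simp: \<rho>'_def)
  from branch_step_exists[OF hol nz this] obtain r G where G: "branch_step F \<rho>' r G" by auto
  then have "r / 2 > 0" by (simp add: branch_step_def)
  from b_cont[OF _ this, of ?\<tau>] A(3) obtain d where d: "d > 0" "\<And>y. y \<ge> 0 \<Longrightarrow> \<bar>y - ?\<tau>\<bar> < d \<Longrightarrow> norm (b y - b ?\<tau>) < r / 2" by auto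
  have main: "\<rho> < norm (the_lift F b s)" if s: "s > max 0 (?\<tau> - d)" "s < ?\<tau>" for s
  proof (rule ccontr)
    assume "\<not> \<rho> < norm (the_lift F b s)"
    then have n: "norm (the_lift F b s) \<le> \<rho>'" by (auto simp: \<rho>'_def)
    have "s \<in> lift_times F b" unfolding A(1) using s by auto
    have "is_lift F b ?\<tau> (\<lambda>u. if u \<le> s then the_lift F b u else G (the_lift F b s, b u - b s))"
    proof (rule is_lift_extend[OF G is_lift_the_lift[OF \<open>s \<in> lift_times F b\<close>] _ _ n])
      show "continuous_on {s..?\<tau>} b" using s by (auto intro: continuous_on_subset[OF b])
      fix u assume u: "u \<in> {s..?\<tau>}"
      have "norm (b u - b s) \<le> norm (b u - b ?\<tau>) + norm (b s - b ?\<tau>)"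
        using norm_triangle_ineq4[of "b u - b ?\<tau>" "b s - b ?\<tau>"] by simp
      also have "\<dots> < r/2 + r/2" by (intro add_strict_mono d(2)) (use u s in auto)
      finally show "norm (b u - b s) < r" by simp
    qed (use s in auto)
    then have "?\<tau> \<in> lift_times F b" using A(3) unfolding lift_times_def mem_Collect_eq by (meson less_imp_le)
    with A(1) show False by blast
  qed
  show ?thesis
    unfolding eventually_at_left[OF A(3)]
    by (intro exI[of _ "max 0 (?\<tau> - d)"]) (use main d(1) A(3) in auto)
qed

text \<open>If the lift lives up to \<open>T\<close>, its norm stays below some
  \<open>q < 1\<close>, so for large \<open>j\<close> only \<open>u j = T\<close> is possible.
  Otherwise the same bound on shorter intervals drives \<open>u\<close> to the exit time.\<close>

lemma stopped_lift_limit: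
  assumes T: "T \<ge> 0"
    and lim: "T \<notin> lift_times F b \<Longrightarrow> (the_lift F b \<longlongrightarrow> L) (at_left (Sup (lift_times F b)))"
    and u: "\<And>j. u j \<in> lift_times F b" "\<And>j. u j \<le> T" "\<And>j. u j = T \<or> \<rho> j \<le> norm (the_lift F b (u j))"
    and \<rho>: "\<rho> \<longlonglongrightarrow> 1"
  shows "(\<lambda>j. the_lift F b (u j)) \<longlonglongrightarrow> stopped_lift F b T"
proof (cases "T \<in> lift_times F b")
  case True
  then obtain q where q: "q < 1" "\<And>s. s \<in> {0..T} \<Longrightarrow> norm (the_lift F b s) \<le> q"
    using lift_bounded_away by blast
  have "\<forall>\<^sub>F j in sequentially. q < \<rho> j" using order_tendstoD(1)[OF \<rho> q(1)] .
  then have "\<forall>\<^sub>F j in sequentially. the_lift F b (u j) = stopped_lift F b T"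
  proof eventually_elim
    case (elim j)
    then have "u j = T" using u(1)[of j] u(2,3)[of j] q(2)[of "u j"] by (auto simp: lift_times_def)
    then show ?case using True by (simp add: stopped_lift_def)
  qed
  then show ?thesis by (rule tendsto_eventually)
next
  case False
  let ?\<tau> = "Sup (lift_times F b)"
  note A = lift_times_eq[OF False T]
  have ult: "0 \<le> u j" "u j < ?\<tau>" for j using u(1)[of j] A(1) by auto
  have n: "\<rho> j \<le> norm (the_lift F b (u j))" for j using u(3)[of j] ult(2)[of j] A(2) by auto
  have "u \<longlonglongrightarrow> ?\<tau>"
  proof (rule order_tendstoI)
    fix s assume s: "s < ?\<tau>"
    then have "max 0 s \<in> lift_times F b" unfolding A(1) using A(3) by auto
    then obtain q where q: "q < 1" "\<And>x. x \<in> {0..max 0 s} \<Longrightarrow> norm (the_lift F b x) \<le> q"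
      using lift_bounded_away by blast
    have "\<forall>\<^sub>F j in sequentially. q < \<rho> j" using order_tendstoD(1)[OF \<rho> q(1)] .
    then show "\<forall>\<^sub>F j in sequentially. s < u j"
    proof eventually_elim
      case (elim j)
      then show ?case using n[of j] q(2)[of "u j"] ult(1)[of j] by (cases "s < u j") auto
    qed
  next
    fix s assume "?\<tau> < s"
    then show "\<forall>\<^sub>F j in sequentially. u j < s" using less_trans[OF ult(2)] by simp
  qed
  then have "filterlim u (at_left ?\<tau>) sequentially"
    using ult less_imp_neq[OF ult(2)] by (auto simp: filterlim_at)
  from filterlim_compose[OF lim[OF False] this]
  have "(\<lambda>j. the_lift F b (u j)) \<longlonglongrightarrow> L" .
  moreover have "stopped_lift F b T = L"
    unfolding stopped_lift_def exit_point_def using False lim[OF False] by (simp add: tendsto_Lim)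
  ultimately show ?thesis by simp
qed

end

section \<open>The map from the disc and its boundary behaviour\<close>

text \<open>The value \<open>q s\<close> nearly solves the limit equation, so the product of its
  distances to the two limit roots tends to 0. By connectedness a continuous \<open>q\<close> cannot
  hop between distinct roots, so it selects one. A double root is treated by a square root of that
  product.\<close>

lemma quadratic_root_converges:
  fixes q \<beta> \<gamma> :: "real \<Rightarrow> complex"
  assumes s0: "s0 < \<tau>" and q: "continuous_on {s0<..<\<tau>} q"
    and eq: "\<And>s. s0 < s \<Longrightarrow> s < \<tau> \<Longrightarrow> (q s)\<^sup>2 + \<beta> s * q s + \<gamma> s = 0"
    and lim: "(\<beta> \<longlongrightarrow> b) (at_left \<tau>)" "(\<gamma> \<longlongrightarrow> c) (at_left \<tau>)"
  shows "\<exists>l. (q \<longlongrightarrow> l) (at_left \<tau>) \<and> l\<^sup>2 + b * l + c = 0"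
proof -
  define D where "D = csqrt (b\<^sup>2 - 4 * c)"
  define p1 where "p1 = (- b + D) / 2"
  define p2 where "p2 = (- b - D) / 2"
  have "D\<^sup>2 = b\<^sup>2 - 4 * c" by (simp add: D_def)
  then have fac: "x\<^sup>2 + b * x + c = (x - p1) * (x - p2)" for x
  proof -
    have "2 * p1 = - b + D" "2 * p2 = - b - D" by (simp_all add: p1_def p2_def)
    then have "2 * (x - p1) = 2 * x + b - D" "2 * (x - p2) = 2 * x + b + D"
      by (simp_all add: right_diff_distrib)
    moreover have "4 * ((x - p1) * (x - p2)) = (2 * (x - p1)) * (2 * (x - p2))" by (simp add: algebra_simps)
    ultimately have "4 * ((x - p1) * (x - p2)) = (2 * x + b - D) * (2 * x + b + D)" by (simp only:)
    also have "\<dots> = (2 * x + b)\<^sup>2 - D\<^sup>2" by (simp add: power2_eq_square algebra_simps)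
    also have "\<dots> = 4 * (x\<^sup>2 + b * x + c)"
      using \<open>D\<^sup>2 = b\<^sup>2 - 4 * c\<close> by (simp add: power2_eq_square algebra_simps)
    finally have "4 * ((x - p1) * (x - p2)) = 4 * (x\<^sup>2 + b * x + c)" .
    then show ?thesis unfolding mult_cancel_left by simp
  qed
  have ev0: "\<forall>\<^sub>F s in at_left \<tau>. s0 < s \<and> s < \<tau>"
    unfolding eventually_at_left[OF s0] using s0 by auto
  \<comment> \<open>A root has modulus at most 1 or at most the sum of the moduli of the
    coefficients; near \<tau> each coefficient exceeds its limit by less than 1 in modulus, and 3
    covers both cases.\<close>
  define K where "K = 3 + norm b + norm c"
  have "((\<lambda>s. norm (\<beta> s)) \<longlongrightarrow> norm b) (at_left \<tau>)" "((\<lambda>s. norm (\<gamma> s)) \<longlongrightarrow> norm c) (at_left \<tau>)"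
    using lim by (auto intro: tendsto_norm)
  then have "\<forall>\<^sub>F s in at_left \<tau>. norm (\<beta> s) < norm b + 1" "\<forall>\<^sub>F s in at_left \<tau>. norm (\<gamma> s) < norm c + 1"
    by (auto intro: order_tendstoD(2))
  with ev0 have bd: "\<forall>\<^sub>F s in at_left \<tau>. norm (q s) \<le> K"
  proof eventually_elim
    case (elim s)
    show ?case
    proof (cases "norm (q s) \<le> 1")
      case True then show ?thesis unfolding K_def using norm_ge_zero[of b] norm_ge_zero[of c] by linarith
    next
      case False
      have "(q s)\<^sup>2 + (\<beta> s * q s + \<gamma> s) = 0" using eq[of s] elim by (simp add: add.assoc)
      then have "(q s)\<^sup>2 = - (\<beta> s * q s + \<gamma> s)" by (rule eq_neg_iff_add_eq_0[THEN iffD2])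
      then have "norm (q s) * norm (q s) = norm (\<beta> s * q s + \<gamma> s)"
        by (metis norm_minus_cancel norm_mult power2_eq_square)
      also have "\<dots> \<le> norm (\<beta> s) * norm (q s) + norm (\<gamma> s) * 1"
        by (metis mult.right_neutral norm_mult norm_triangle_ineq)
      also have "\<dots> \<le> (norm b + 1) * norm (q s) + (norm c + 1) * norm (q s)"
        using elim False by (intro add_mono mult_mono) auto
      also have "\<dots> = (norm b + norm c + 2) * norm (q s)" by (simp add: algebra_simps)
      finally have "norm (q s) \<le> norm b + norm c + 2"
        using False by (cases "q s = 0") (auto simp: mult_le_cancel_right)
      then show ?thesis by (simp add: K_def)
    qed
  qed
  have prod: "((\<lambda>s. (q s - p1) * (q s - p2)) \<longlongrightarrow> 0) (at_left \<tau>)"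
  proof (rule Lim_null_comparison)
    show "((\<lambda>s. norm (b - \<beta> s) * K + norm (c - \<gamma> s)) \<longlongrightarrow> 0) (at_left \<tau>)"
      by (rule tendsto_eq_intros lim refl)+ simp
    show "\<forall>\<^sub>F s in at_left \<tau>. norm ((q s - p1) * (q s - p2)) \<le> norm (b - \<beta> s) * K + norm (c - \<gamma> s)"
      using ev0 bd
    proof eventually_elim
      case (elim s)
      have "(q s - p1) * (q s - p2) = (b - \<beta> s) * q s + (c - \<gamma> s)"
        unfolding fac[symmetric] using eq[of s] elim by (simp add: algebra_simps)
      then have "norm ((q s - p1) * (q s - p2)) \<le> norm (b - \<beta> s) * norm (q s) + norm (c - \<gamma> s)"
        by (metis norm_mult norm_triangle_ineq)
      also have "\<dots> \<le> norm (b - \<beta> s) * K + norm (c - \<gamma> s)"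
        using elim by (intro add_mono mult_left_mono) auto
      finally show ?case .
    qed
  qed
  have roots: "p1\<^sup>2 + b * p1 + c = 0" "p2\<^sup>2 + b * p2 + c = 0" by (simp_all add: fac)
  show ?thesis
  proof (cases "p1 = p2")
    case True
    have "((\<lambda>s. sqrt (norm ((q s - p1) * (q s - p2)))) \<longlongrightarrow> sqrt (norm (0::complex))) (at_left \<tau>)"
      by (intro tendsto_intros prod)
    then have "((\<lambda>s. norm (q s - p1)) \<longlongrightarrow> 0) (at_left \<tau>)"
      by (simp add: True norm_mult real_sqrt_mult)
    then have "((\<lambda>s. q s - p1) \<longlongrightarrow> 0) (at_left \<tau>)" by (simp only: tendsto_norm_zero_iff)
    then have "(q \<longlongrightarrow> p1) (at_left \<tau>)" by (simp only: LIM_zero_iff)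
    with roots show ?thesis by blast
  next
    case False
    \<comment> \<open>With half the root distance as radius the two discs are disjoint, and a point
      outside both has product of distances at least d^2.\<close>
    define d where "d = norm (p1 - p2) / 2"
    have d: "d > 0" using False by (simp add: d_def)
    have conv: "(q \<longlongrightarrow> p) (at_left \<tau>)" if far: "\<forall>\<^sub>F s in at_left \<tau>. d \<le> norm (q s - p')"
      and pr: "((\<lambda>s. (q s - p) * (q s - p')) \<longlongrightarrow> 0) (at_left \<tau>)" for p p'
    proof -
      have "((\<lambda>s. q s - p) \<longlongrightarrow> 0) (at_left \<tau>)"
      proof (rule Lim_null_comparison)
        show "((\<lambda>s. norm ((q s - p) * (q s - p')) / d) \<longlongrightarrow> 0) (at_left \<tau>)"
          by (rule tendsto_eq_intros pr refl)+ (use d in auto)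
        show "\<forall>\<^sub>F s in at_left \<tau>. norm (q s - p) \<le> norm ((q s - p) * (q s - p')) / d"
          using far
        proof eventually_elim
          case (elim s)
          then have "norm (q s - p) * d \<le> norm (q s - p) * norm (q s - p')"
            by (intro mult_left_mono) auto
          then show ?case using d by (simp add: norm_mult pos_le_divide_eq)
        qed
      qed
      then show ?thesis by (simp only: LIM_zero_iff)
    qed
    have "\<forall>\<^sub>F s in at_left \<tau>. norm ((q s - p1) * (q s - p2)) < d * d"
      using order_tendstoD(2)[OF tendsto_norm_zero[OF prod], of "d * d"] d by simp
    with ev0 have "\<forall>\<^sub>F s in at_left \<tau>. (s0 < s \<and> s < \<tau>) \<and> norm ((q s - p1) * (q s - p2)) < d * d"
      by eventually_elim auto
    then obtain s1 where s1: "s1 < \<tau>" "\<And>s. s1 < s \<Longrightarrow> s < \<tau> \<Longrightarrow> s0 < s \<and> norm ((q s - p1) * (q s - p2)) < d * d"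
      unfolding eventually_at_left[OF s0] by blast
    let ?I = "{s1<..<\<tau>}"
    have sub: "q ` ?I \<subseteq> ball p1 d \<union> ball p2 d"
    proof clarsimp
      fix s assume s: "s1 < s" "s < \<tau>" "\<not> dist p2 (q s) < d"
      then have "d \<le> norm (q s - p2)" by (simp add: dist_norm norm_minus_commute)
      show "dist p1 (q s) < d"
      proof (rule ccontr)
        assume "\<not> dist p1 (q s) < d"
        then have "d \<le> norm (q s - p1)" by (simp add: dist_norm norm_minus_commute)
        with \<open>d \<le> norm (q s - p2)\<close> d have "d * d \<le> norm (q s - p1) * norm (q s - p2)" by (intro mult_mono) auto
        with s1(2)[OF s(1,2)] show False by (simp add: norm_mult)
      qed
    qed
    have disj: "ball p1 d \<inter> ball p2 d = {}"
      unfolding d_def by (rule disjoint_ballI) (simp add: dist_norm)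
    have "connected (q ` ?I)"
      by (intro connected_continuous_image continuous_on_subset[OF q] connected_Ioo) (use s1 in auto)
    from connectedD[OF this open_ball open_ball _ sub]
    have "ball p1 d \<inter> q ` ?I = {} \<or> ball p2 d \<inter> q ` ?I = {}" using disj by blast
    then show ?thesis
    proof
      assume "ball p1 d \<inter> q ` ?I = {}"
      then have "\<forall>s>s1. s < \<tau> \<longrightarrow> d \<le> norm (q s - p1)"
        unfolding disjoint_iff by (auto simp: dist_norm norm_minus_commute not_less)
      then have "\<forall>\<^sub>F s in at_left \<tau>. d \<le> norm (q s - p1)" unfolding eventually_at_left[OF s1(1)] using s1(1) by blast
      from conv[OF this, of p2] prod have "(q \<longlongrightarrow> p2) (at_left \<tau>)" by (simp add: mult.commute)
      with roots show ?thesis by blast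
    next
      assume "ball p2 d \<inter> q ` ?I = {}"
      then have "\<forall>s>s1. s < \<tau> \<longrightarrow> d \<le> norm (q s - p2)"
        unfolding disjoint_iff by (auto simp: dist_norm norm_minus_commute not_less)
      then have "\<forall>\<^sub>F s in at_left \<tau>. d \<le> norm (q s - p2)" unfolding eventually_at_left[OF s1(1)] using s1(1) by blast
      from conv[OF this prod] roots show ?thesis by blast
    qed
  qed
qed

text \<open>Two logarithms of \<open>c\<close> differ by a multiple of 2 pi i, so the range of
  \<open>D\<close> is discrete; the gap 1 is a crude lower bound for 2 pi.\<close>

lemma continuous_logarithm_constant:
  fixes D :: "real \<Rightarrow> complex"
  assumes S: "connected S" "continuous_on S D" and exp: "\<And>s. s \<in> S \<Longrightarrow> exp (D s) = c"
  shows "D constant_on S"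
proof (rule continuous_discrete_range_constant[OF S])
  fix x assume x: "x \<in> S"
  show "\<exists>e>0. \<forall>y. y \<in> S \<and> D y \<noteq> D x \<longrightarrow> e \<le> norm (D y - D x)"
  proof (intro exI[of _ 1] conjI allI impI)
    fix y assume y: "y \<in> S \<and> D y \<noteq> D x"
    then have "exp (D y) = exp (D x)" using exp x by simp
    then obtain n :: int where n: "D y = D x + of_int (2 * n) * of_real pi * \<i>" unfolding exp_eq by auto
    with y have "n \<noteq> 0" by auto
    then have n1: "1 \<le> \<bar>real_of_int n\<bar>" by linarith
    have "norm (D y - D x) = 2 * \<bar>real_of_int n\<bar> * pi" by (simp add: n norm_mult)
    moreover have "2 * \<bar>real_of_int n\<bar> * pi \<ge> 2 * 1 * 1"
      using n1 pi_ge_two by (intro mult_mono) auto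
    ultimately show "1 \<le> norm (D y - D x)" by simp
  qed simp
qed

text \<open>Near \<tau> the quotient \<open>exp (w s) / c\<close> is close to 1, where
  \<open>Ln\<close> is continuous, and \<open>w\<close> differs from the \<open>Ln\<close> of that
  quotient by a constant.\<close>

lemma logarithm_converges:
  fixes w :: "real \<Rightarrow> complex"
  assumes s0: "s0 < \<tau>" and w: "continuous_on {s0<..<\<tau>} w"
    and lim: "((\<lambda>s. exp (w s)) \<longlongrightarrow> c) (at_left \<tau>)" and c: "c \<noteq> 0"
  shows "\<exists>l. (w \<longlongrightarrow> l) (at_left \<tau>) \<and> exp l = c"
proof -
  have ev0: "\<forall>\<^sub>F s in at_left \<tau>. s0 < s \<and> s < \<tau>"
    unfolding eventually_at_left[OF s0] using s0 by auto
  have l1: "((\<lambda>s. exp (w s) / c) \<longlongrightarrow> 1) (at_left \<tau>)"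
    by (rule tendsto_eq_intros lim refl)+ (use c in auto)
  then have "\<forall>\<^sub>F s in at_left \<tau>. dist (exp (w s) / c) 1 < 1" by (rule tendstoD) simp
  with ev0 have "\<forall>\<^sub>F s in at_left \<tau>. (s0 < s \<and> s < \<tau>) \<and> dist (exp (w s) / c) 1 < 1"
    by eventually_elim auto
  then obtain s1 where s1: "s1 < \<tau>" "\<And>s. s1 < s \<Longrightarrow> s < \<tau> \<Longrightarrow> s0 < s \<and> dist (exp (w s) / c) 1 < 1"
    unfolding eventually_at_left[OF s0] by blast
  let ?I = "{s1<..<\<tau>}"
  have np: "exp (w s) / c \<notin> \<real>\<^sub>\<le>\<^sub>0" if "s \<in> ?I" for s
  proof -
    have "dist (exp (w s) / c) 1 < 1" using s1(2)[of s] that by simp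
    then have "\<bar>Re (exp (w s) / c - 1)\<bar> < 1"
      unfolding dist_norm using abs_Re_le_cmod[of "exp (w s) / c - 1"] by linarith
    then have "Re (exp (w s) / c) > 0" by simp
    then show ?thesis by (auto simp: complex_nonpos_Reals_iff)
  qed
  define D where "D s = w s - Ln (exp (w s) / c)" for s
  have wI: "continuous_on ?I w" by (rule continuous_on_subset[OF w]) (use s1 in auto)
  have "continuous_on ?I D"
    unfolding D_def by (intro continuous_intros wI) (use np c in auto)
  moreover have "exp (D s) = c" for s
    using c by (simp add: D_def exp_diff)
  ultimately have "D constant_on ?I"
    by (intro continuous_logarithm_constant) auto
  then obtain k where k: "\<And>s. s \<in> ?I \<Longrightarrow> D s = k" by (auto simp: constant_on_def)
  have "((\<lambda>s. k + Ln (exp (w s) / c)) \<longlongrightarrow> k + Ln 1) (at_left \<tau>)"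
    by (intro tendsto_intros l1) auto
  moreover have "\<forall>\<^sub>F s in at_left \<tau>. k + Ln (exp (w s) / c) = w s"
    unfolding eventually_at_left[OF s1(1)] using s1(1) k unfolding D_def
    by (intro exI[of _ s1]) (auto simp: algebra_simps)
  ultimately have wl: "(w \<longlongrightarrow> k) (at_left \<tau>)"
    using tendsto_cong by force
  then have "((\<lambda>s. exp (w s)) \<longlongrightarrow> exp k) (at_left \<tau>)" by (intro tendsto_intros)
  with lim have "exp k = c" using tendsto_unique trivial_limit_at_left_real by blast
  with wl show ?thesis by blast
qed

section \<open>Critical points and boundary values of the disc map\<close>

definition disc_map :: "complex \<Rightarrow> complex" where
  "disc_map \<zeta> = sin (of_real pi * \<zeta> / (1 + \<zeta>\<^sup>2))"

lemma one_plus_square_nonzero: "norm \<zeta> < 1 \<Longrightarrow> 1 + \<zeta>\<^sup>2 \<noteq> (0::complex)"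
proof
  assume "norm \<zeta> < 1" "1 + \<zeta>\<^sup>2 = 0"
  then have "\<zeta>\<^sup>2 = -1" by (simp add: eq_neg_iff_add_eq_0 add.commute)
  then have "(norm \<zeta>)\<^sup>2 = 1" by (metis norm_minus_cancel norm_one norm_power)
  moreover have "(norm \<zeta>)\<^sup>2 < 1" using \<open>norm \<zeta> < 1\<close> by (simp add: abs_square_less_1)
  ultimately show False by simp
qed

text \<open>Compare imaginary parts: either \<zeta> is real, and then (1 - |\<zeta>|)^2 is at most
  0, or x Re \<zeta> = 1, and then the real part of the equation, multiplied by Re \<zeta>, reads
  |\<zeta>|^2 = 1. So the open disc never reaches the rays.\<close>

lemma norm_eq_1_if_real_ray:
  fixes \<zeta> :: complex and x :: real
  assumes eq: "2 * \<zeta> = of_real x * (1 + \<zeta>\<^sup>2)" and x: "1 \<le> \<bar>x\<bar>"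
  shows "norm \<zeta> = 1"
proof -
  define a where "a = Re \<zeta>"
  define c where "c = Im \<zeta>"
  have re: "2 * a = x * (1 + a\<^sup>2 - c\<^sup>2)" and im: "2 * c = x * (2 * a * c)"
    using arg_cong[OF eq, of Re] arg_cong[OF eq, of Im]
    by (auto simp: a_def c_def power2_eq_square algebra_simps)
  have "a\<^sup>2 + c\<^sup>2 = 1"
  proof (cases "c = 0")
    case True
    have "2 * \<bar>a\<bar> = \<bar>x\<bar> * (1 + a\<^sup>2)"
      using arg_cong[OF re, of abs] True by (simp add: abs_mult)
    moreover have "1 * (1 + a\<^sup>2) \<le> \<bar>x\<bar> * (1 + a\<^sup>2)" using x by (intro mult_right_mono) auto
    ultimately have "(1 - \<bar>a\<bar>)\<^sup>2 \<le> 0" by (simp add: power2_eq_square algebra_simps)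
    then have "\<bar>a\<bar> = 1" by simp
    then show ?thesis using True by (metis abs_1 add.right_neutral one_power2 power2_abs zero_power2)
  next
    case False
    with im have xa: "x * a = 1" by simp
    have "a * (2 * a) = (x * a) * (1 + a\<^sup>2 - c\<^sup>2)" using re by simp
    then show ?thesis unfolding xa by (simp add: power2_eq_square)
  qed
  then show ?thesis by (simp add: cmod_def a_def c_def)
qed

lemma disc_map_0 [simp]: "disc_map 0 = 0"
  by (simp add: disc_map_def)

lemma disc_map_holomorphic: "disc_map holomorphic_on ball 0 1"
  unfolding disc_map_def by (intro holomorphic_intros) (use one_plus_square_nonzero in auto)

text \<open>The inner derivative vanishes only where \<zeta>^2 = 1. The cosine vanishes only where 2
  \<zeta> / (1 + \<zeta>^2) is an odd integer, a point on one of the rays.\<close>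

lemma deriv_disc_map_nonzero:
  assumes \<zeta>: "norm \<zeta> < 1"
  shows "deriv disc_map \<zeta> \<noteq> 0"
proof -
  have n: "1 + \<zeta>\<^sup>2 \<noteq> 0" by (rule one_plus_square_nonzero) fact
  have "((\<lambda>\<zeta>. of_real pi * \<zeta> / (1 + \<zeta>\<^sup>2)) has_field_derivative
      (of_real pi * (1 + \<zeta>\<^sup>2) - of_real pi * \<zeta> * (2 * \<zeta>)) / ((1 + \<zeta>\<^sup>2) * (1 + \<zeta>\<^sup>2))) (at \<zeta>)"
    by (rule derivative_eq_intros refl n)+ simp
  from DERIV_chain[OF DERIV_sin this]
  have "(disc_map has_field_derivative cos (of_real pi * \<zeta> / (1 + \<zeta>\<^sup>2)) *
      ((of_real pi * (1 + \<zeta>\<^sup>2) - of_real pi * \<zeta> * (2 * \<zeta>)) / ((1 + \<zeta>\<^sup>2) * (1 + \<zeta>\<^sup>2)))) (at \<zeta>)"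
    by (simp add: comp_def disc_map_def[abs_def])
  then have D: "deriv disc_map \<zeta> = cos (of_real pi * \<zeta> / (1 + \<zeta>\<^sup>2)) *
      ((of_real pi * (1 + \<zeta>\<^sup>2) - of_real pi * \<zeta> * (2 * \<zeta>)) / ((1 + \<zeta>\<^sup>2) * (1 + \<zeta>\<^sup>2)))"
    by (rule DERIV_imp_deriv)
  have "(norm \<zeta>)\<^sup>2 < 1" using \<zeta> by (simp add: power_less_one_iff)
  then have z2: "\<zeta>\<^sup>2 \<noteq> 1" by (metis less_irrefl norm_one norm_power)
  have "of_real pi * (1 + \<zeta>\<^sup>2) - of_real pi * \<zeta> * (2 * \<zeta>) = of_real pi * (1 - \<zeta>\<^sup>2)"
    by (simp add: power2_eq_square algebra_simps)
  also have "\<dots> \<noteq> 0" using z2 by simp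
  finally have 1: "of_real pi * (1 + \<zeta>\<^sup>2) - of_real pi * \<zeta> * (2 * \<zeta>) \<noteq> 0" .
  have "cos (of_real pi * \<zeta> / (1 + \<zeta>\<^sup>2)) \<noteq> 0"
  proof
    assume "cos (of_real pi * \<zeta> / (1 + \<zeta>\<^sup>2)) = 0"
    then obtain k :: int where "of_real pi * \<zeta> / (1 + \<zeta>\<^sup>2) = complex_of_real (k * pi) + of_real pi / 2"
      unfolding cos_eq_0 by auto
    also have "\<dots> = of_real pi * (of_real (2 * real_of_int k + 1) / 2)" by (simp add: field_simps)
    finally have "\<zeta> / (1 + \<zeta>\<^sup>2) = of_real (2 * real_of_int k + 1) / 2"
      by (simp flip: times_divide_eq_right)
    then have "2 * \<zeta> = of_real (2 * real_of_int k + 1) * (1 + \<zeta>\<^sup>2)"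
      using n by (simp add: field_simps)
    moreover have "1 \<le> \<bar>2 * real_of_int k + 1\<bar>"
      by (cases "k \<ge> 0") (auto simp: abs_if)
    ultimately show False using norm_eq_1_if_real_ray[of \<zeta> "2 * real_of_int k + 1"] \<zeta> by simp
  qed
  with 1 n show ?thesis unfolding D by simp
qed

text \<open>The boundary limit is recovered from \<open>b\<close> by undoing the two factors of the
  map: X = exp (i pi z / 2) satisfies X^2 - 2 i b X - 1 = 0 and so converges, its logarithm gives
  the limit of z, and \<zeta> is a root of X^2 - (2 / z) X + 1. As the limit of z is finite, the
  exit point is not \<plusminus>\<i>.\<close>

lemma slit_plane_exit_limit:
  fixes \<zeta> b :: "real \<Rightarrow> complex"
  assumes s0: "s0 < \<tau>" and c: "continuous_on {s0<..<\<tau>} \<zeta>"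
    and n: "\<And>s. s0 < s \<Longrightarrow> s < \<tau> \<Longrightarrow> norm (\<zeta> s) < 1 \<and> disc_map (\<zeta> s) = b s"
    and b: "(b \<longlongrightarrow> b \<tau>) (at_left \<tau>)" and exits: "\<And>\<rho>. \<rho> < 1 \<Longrightarrow> \<forall>\<^sub>F s in at_left \<tau>. \<rho> < norm (\<zeta> s)"
  shows "\<exists>L. (\<zeta> \<longlongrightarrow> L) (at_left \<tau>) \<and> norm L = 1 \<and> Re L \<noteq> 0 \<and> b \<tau> = of_real (sin (pi / 2 * (1 / Re L))) \<and>
    ((\<lambda>s. 2 * \<zeta> s / (1 + (\<zeta> s)\<^sup>2)) \<longlongrightarrow> of_real (1 / Re L)) (at_left \<tau>)"
proof -
  have nt: "at_left \<tau> \<noteq> bot" by simp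
  have ev0: "\<forall>\<^sub>F s in at_left \<tau>. s0 < s \<and> s < \<tau>"
    unfolding eventually_at_left[OF s0] using s0 by auto
  have nz: "s0 < s \<Longrightarrow> s < \<tau> \<Longrightarrow> 1 + (\<zeta> s)\<^sup>2 \<noteq> 0" for s using n one_plus_square_nonzero by blast
  define z where "z s = 2 * \<zeta> s / (1 + (\<zeta> s)\<^sup>2)" for s
  have zc: "continuous_on {s0<..<\<tau>} z" unfolding z_def by (intro continuous_intros c) (use nz in auto)
  define w where "w s = \<i> * (of_real pi / 2 * z s)" for s
  have wc: "continuous_on {s0<..<\<tau>} w" unfolding w_def by (intro continuous_intros zc)
  have bw: "b s = sin (of_real pi / 2 * z s)" if "s0 < s" "s < \<tau>" for s
    using n[OF that] by (simp add: disc_map_def z_def)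
  have q: "(exp (w s))\<^sup>2 + (- 2 * \<i> * b s) * exp (w s) + - 1 = 0" if "s0 < s" "s < \<tau>" for s
  proof -
    have "2 * \<i> * b s = exp (w s) - inverse (exp (w s))"
      by (simp add: bw[OF that] sin_exp_eq w_def exp_minus field_simps)
    then have "2 * \<i> * b s * exp (w s) = (exp (w s) - inverse (exp (w s))) * exp (w s)" by simp
    also have "\<dots> = exp (w s) * exp (w s) - 1" by (simp add: left_diff_distrib)
    finally show ?thesis by (simp add: power2_eq_square)
  qed
  have "\<exists>l. ((\<lambda>s. exp (w s)) \<longlongrightarrow> l) (at_left \<tau>) \<and> l\<^sup>2 + (- 2 * \<i> * b \<tau>) * l + - 1 = 0"
    by (rule quadratic_root_converges[OF s0 _ q]) (auto intro!: continuous_intros wc tendsto_intros b)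
  then obtain l where l: "((\<lambda>s. exp (w s)) \<longlongrightarrow> l) (at_left \<tau>)" "l\<^sup>2 + (- 2 * \<i> * b \<tau>) * l + - 1 = 0" by blast
  then have "l \<noteq> 0" by auto
  with logarithm_converges[OF s0 wc l(1)] obtain k where "(w \<longlongrightarrow> k) (at_left \<tau>)" by blast
  then have "((\<lambda>s. w s * (2 / (of_real pi * \<i>))) \<longlongrightarrow> k * (2 / (of_real pi * \<i>))) (at_left \<tau>)"
    by (intro tendsto_intros)
  moreover define Z where "Z = k * (2 / (of_real pi * \<i>))"
  ultimately have zl: "(z \<longlongrightarrow> Z) (at_left \<tau>)" by (simp add: w_def)
  have "((\<lambda>s. sin (of_real pi / 2 * z s)) \<longlongrightarrow> sin (of_real pi / 2 * Z)) (at_left \<tau>)"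
    by (intro tendsto_intros zl)
  then have "(b \<longlongrightarrow> sin (of_real pi / 2 * Z)) (at_left \<tau>)"
    by (rule Lim_transform_eventually) (use ev0 in eventually_elim, simp add: bw)
  with b have bZ: "b \<tau> = sin (of_real pi / 2 * Z)" using tendsto_unique[OF nt] by blast
  \<comment> \<open>Since 1 + \<zeta>^2 has modulus at most 2, the point z stays away from 0 near
    the exit, so 2 / z has a limit.\<close>
  have zlow: "norm (\<zeta> s) \<le> norm (z s)" if "s0 < s" "s < \<tau>" for s
  proof -
    have "norm (1 + (\<zeta> s)\<^sup>2) \<le> 1 + (norm (\<zeta> s))\<^sup>2" by (metis norm_one norm_power norm_triangle_ineq)
    also have "\<dots> \<le> 2" using n[OF that] by (simp add: power_le_one)
    finally have "norm (\<zeta> s) * norm (1 + (\<zeta> s)\<^sup>2) \<le> norm (\<zeta> s) * 2" by (intro mult_left_mono) auto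
    then show ?thesis using nz[OF that] by (simp add: z_def norm_divide norm_mult field_simps)
  qed
  have "\<forall>\<^sub>F s in at_left \<tau>. 1 / 2 \<le> norm (z s)"
    using exits[of "1/2", simplified] ev0 by eventually_elim (use zlow in fastforce)
  then have "1 / 2 \<le> norm Z" using tendsto_lowerbound[OF tendsto_norm[OF zl] _ nt] by blast
  then have Z0: "Z \<noteq> 0" by auto
  have z0: "z s \<noteq> 0" if "s0 < s" "s < \<tau>" "1/2 < norm (\<zeta> s)" for s
    using zlow[OF that(1,2)] that(3) by auto
  from exits[of "1/2", simplified] ev0 have "\<forall>\<^sub>F s in at_left \<tau>. (s0 < s \<and> s < \<tau>) \<and> 1/2 < norm (\<zeta> s)"
    by eventually_elim auto
  then obtain s1 where s1: "s1 < \<tau>" "\<And>s. s1 < s \<Longrightarrow> s < \<tau> \<Longrightarrow> (s0 < s \<and> s < \<tau>) \<and> 1/2 < norm (\<zeta> s)"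
    unfolding eventually_at_left[OF s0] by blast
  have "\<exists>L. (\<zeta> \<longlongrightarrow> L) (at_left \<tau>) \<and> L\<^sup>2 + (- 2 / Z) * L + 1 = 0"
  proof (rule quadratic_root_converges[OF s1(1), where \<beta>="\<lambda>s. - 2 / z s" and \<gamma>="\<lambda>_. 1"])
    show "continuous_on {s1<..<\<tau>} \<zeta>" by (rule continuous_on_subset[OF c]) (use s1 in auto)
    fix s assume s: "s1 < s" "s < \<tau>"
    have "z s * (1 + (\<zeta> s)\<^sup>2) = 2 * \<zeta> s" using nz[of s] s1(2)[OF s] by (simp add: z_def)
    then show "(\<zeta> s)\<^sup>2 + - 2 / z s * \<zeta> s + 1 = 0"
      using z0[of s] s1(2)[OF s] by (simp add: field_simps)
  qed (intro tendsto_intros zl Z0)+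
  then obtain L where L: "(\<zeta> \<longlongrightarrow> L) (at_left \<tau>)" "L\<^sup>2 + (- 2 / Z) * L + 1 = 0" by blast
  have "norm L \<le> 1"
  proof (rule tendsto_upperbound[OF tendsto_norm[OF L(1)] _ nt])
    show "\<forall>\<^sub>F s in at_left \<tau>. norm (\<zeta> s) \<le> 1" using ev0 by eventually_elim (use n in \<open>auto intro: less_imp_le\<close>)
  qed
  moreover have "\<rho> \<le> norm L" if "\<rho> < 1" for \<rho>
    using exits[OF that] by (intro tendsto_lowerbound[OF tendsto_norm[OF L(1)] _ nt]) (auto elim: eventually_mono)
  then have "1 \<le> norm L" by (rule dense_le)
  ultimately have nL: "norm L = 1" by simp
  have ZL: "Z * (1 + L\<^sup>2) = 2 * L" using L(2) Z0 by (simp add: field_simps)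
  \<comment> \<open>On the unit circle \<open>L * cnj L = 1\<close>, which turns the equation for
    \<open>Z\<close> into \<open>Z * of_real (Re L) = 1\<close>.\<close>
  have "1 + L\<^sup>2 = L * of_real (2 * Re L)"
  proof -
    have "L * cnj L = 1" using nL by (simp add: complex_norm_square[symmetric])
    then have "1 + L\<^sup>2 = L * (cnj L + L)" by (simp add: power2_eq_square algebra_simps)
    then show ?thesis by (simp add: complex_add_cnj add.commute)
  qed
  with ZL have "L * (Z * of_real (2 * Re L)) = L * 2" by (simp add: mult_ac)
  moreover have "L \<noteq> 0" using nL by auto
  ultimately have "Z * of_real (2 * Re L) = 2" by (simp only: mult_cancel_left) auto
  then have ZR: "Z * of_real (Re L) = 1" by simp
  then have R0: "Re L \<noteq> 0" by auto
  with ZR have Z: "Z = of_real (1 / Re L)" by (simp add: field_simps)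
  have "b \<tau> = of_real (sin (pi / 2 * (1 / Re L)))"
    unfolding bZ Z by (simp add: sin_of_real[symmetric])
  with L(1) nL R0 zl Z show ?thesis unfolding z_def by blast
qed

lemma path_lifting_disc_map:
  assumes "continuous_on {0..} b" "b 0 = 0"
  shows "path_lifting disc_map b"
  using assms by unfold_locales (auto simp: disc_map_holomorphic deriv_disc_map_nonzero)

lemma exit_point_disc_map:
  assumes b: "continuous_on {0..} b" "b 0 = 0" and T: "T \<notin> lift_times disc_map b" "0 \<le> T"
  defines "\<tau> \<equiv> Sup (lift_times disc_map b)" and "L \<equiv> exit_point disc_map b"
  shows "(the_lift disc_map b \<longlongrightarrow> L) (at_left \<tau>)" "norm L = 1" "Re L \<noteq> 0"
    "b \<tau> = of_real (sin (pi / 2 * (1 / Re L)))"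
    "((\<lambda>s. 2 * the_lift disc_map b s / (1 + (the_lift disc_map b s)\<^sup>2)) \<longlongrightarrow> of_real (1 / Re L)) (at_left \<tau>)"
proof -
  interpret path_lifting disc_map b using path_lifting_disc_map b by blast
  note A = lift_times_eq[OF T, folded \<tau>_def]
  have l: "is_lift disc_map b s (the_lift disc_map b)" if "0 \<le> s" "s < \<tau>" for s
    using is_lift_the_lift[of s] A(1)[of s] that by simp
  have "continuous_on {0<..<\<tau>} (the_lift disc_map b)"
    unfolding continuous_on_eq_continuous_at[OF open_greaterThanLessThan]
  proof
    fix s assume s: "s \<in> {0<..<\<tau>}"
    then obtain s' where s': "s < s'" "s' < \<tau>" using dense by auto
    then have "continuous_on {0..s'} (the_lift disc_map b)" using l[of s'] s by (simp add: is_lift_def)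
    then show "isCont (the_lift disc_map b) s"
      by (rule continuous_on_interior) (use s s' in \<open>simp add: interior_atLeastAtMost_real\<close>)
  qed
  moreover have "isCont b \<tau>"
    by (rule continuous_on_interior[OF b(1)]) (use A(3) in \<open>simp add: interior_real_atLeast\<close>)
  then have "(b \<longlongrightarrow> b \<tau>) (at_left \<tau>)" by (simp add: isCont_def filterlim_at_split)
  ultimately have "\<exists>L. (the_lift disc_map b \<longlongrightarrow> L) (at_left \<tau>) \<and> norm L = 1 \<and> Re L \<noteq> 0 \<and>
      b \<tau> = of_real (sin (pi / 2 * (1 / Re L))) \<and>
    ((\<lambda>s. 2 * the_lift disc_map b s / (1 + (the_lift disc_map b s)\<^sup>2)) \<longlongrightarrow> of_real (1 / Re L)) (at_left \<tau>)"
  proof (intro slit_plane_exit_limit[OF A(3)])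
    fix s assume "0 < s" "s < \<tau>"
    then show "norm (the_lift disc_map b s) < 1 \<and> disc_map (the_lift disc_map b s) = b s"
      using l[of s] by (simp add: is_lift_def)
  qed (use lift_exits[OF T] in \<open>simp_all add: \<tau>_def\<close>)
  then obtain L' where L': "(the_lift disc_map b \<longlongrightarrow> L') (at_left \<tau>)" "norm L' = 1" "Re L' \<noteq> 0"
      "b \<tau> = of_real (sin (pi / 2 * (1 / Re L')))"
    "((\<lambda>s. 2 * the_lift disc_map b s / (1 + (the_lift disc_map b s)\<^sup>2)) \<longlongrightarrow> of_real (1 / Re L')) (at_left \<tau>)" by blast
  then have "L' = L" unfolding L_def exit_point_def \<tau>_def[symmetric] by (simp add: tendsto_Lim)
  with L' show "(the_lift disc_map b \<longlongrightarrow> L) (at_left \<tau>)" "norm L = 1" "Re L \<noteq> 0"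
    "b \<tau> = of_real (sin (pi / 2 * (1 / Re L)))"
    "((\<lambda>s. 2 * the_lift disc_map b s / (1 + (the_lift disc_map b s)\<^sup>2)) \<longlongrightarrow> of_real (1 / Re L)) (at_left \<tau>)"
    by auto
qed

section \<open>Homotopy classes\<close>

definition slit_plane :: "complex set" where
  "slit_plane = {z. Im z \<noteq> 0 \<or> \<bar>Re z\<bar> < 1}"

definition to_slit_plane :: "complex \<Rightarrow> complex" where
  "to_slit_plane \<zeta> = 2 * \<zeta> / (1 + \<zeta>\<^sup>2)"

definition sin_half_pi :: "complex \<Rightarrow> complex" where
  "sin_half_pi z = sin (of_real (pi / 2) * z)"

lemma disc_map_eq: "disc_map \<zeta> = sin_half_pi (to_slit_plane \<zeta>)"
  by (simp add: disc_map_def sin_half_pi_def to_slit_plane_def)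

lemma to_slit_plane_in:
  assumes "norm \<zeta> < 1"
  shows "to_slit_plane \<zeta> \<in> slit_plane"
proof (rule ccontr)
  assume "to_slit_plane \<zeta> \<notin> slit_plane"
  then have *: "Im (to_slit_plane \<zeta>) = 0" "1 \<le> \<bar>Re (to_slit_plane \<zeta>)\<bar>" by (auto simp: slit_plane_def)
  then have "to_slit_plane \<zeta> = of_real (Re (to_slit_plane \<zeta>))" by (simp add: complex_eq_iff)
  then have "2 * \<zeta> = of_real (Re (to_slit_plane \<zeta>)) * (1 + \<zeta>\<^sup>2)"
  proof -
    have "2 * \<zeta> = to_slit_plane \<zeta> * (1 + \<zeta>\<^sup>2)"
      using one_plus_square_nonzero[OF assms] by (simp add: to_slit_plane_def)
    then show ?thesis using \<open>to_slit_plane \<zeta> = of_real _\<close> by simp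
  qed
  from norm_eq_1_if_real_ray[OF this *(2)] assms show False by simp
qed

lemma continuous_to_slit_plane: "continuous_on (ball 0 1) to_slit_plane"
  unfolding to_slit_plane_def by (intro continuous_intros) (use one_plus_square_nonzero in auto)

lemma cos_half_pi_zeroD:
  assumes "cos (of_real (pi / 2) * z) = 0"
  shows "Im z = 0" "1 \<le> \<bar>Re z\<bar>"
proof -
  obtain n :: int where "of_real (pi / 2) * z = complex_of_real (n * pi) + of_real pi / 2"
    using assms unfolding cos_eq_0 by auto
  also have "\<dots> = of_real (pi / 2) * of_real (2 * real_of_int n + 1)" by (simp add: field_simps)
  finally have "z = of_real (2 * real_of_int n + 1)"
    by (subst (asm) mult_cancel_left) simp
  moreover have "1 \<le> \<bar>2 * real_of_int n + 1\<bar>" by (cases "n \<ge> 0") (auto simp: abs_if)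
  ultimately show "Im z = 0" "1 \<le> \<bar>Re z\<bar>" by auto
qed

lemma cos_half_pi_nonzero: "z \<in> slit_plane \<Longrightarrow> cos (of_real (pi / 2) * z) \<noteq> 0"
  using cos_half_pi_zeroD[of z] by (auto simp: slit_plane_def)

lemma sin_half_pi_avoids:
  assumes "z \<in> slit_plane"
  shows "sin_half_pi z \<in> - {-1, 1}"
proof -
  have "(sin_half_pi z)\<^sup>2 + (cos (of_real (pi / 2) * z))\<^sup>2 = 1"
    unfolding sin_half_pi_def by (rule sin_cos_squared_add)
  with cos_half_pi_nonzero[OF assms] show ?thesis by auto
qed

text \<open>All preimages of x under sine are real, equal to \<plusminus>arcsin x up to multiples of
  pi, and only the principal one has modulus below pi / 2. Hence the lift of a crossing ends where
  the lifted return segment starts.\<close>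

lemma sin_half_pi_real_preimage:
  assumes z: "z \<in> slit_plane" and x: "\<bar>x\<bar> < 1" and eq: "sin_half_pi z = of_real x"
  shows "z = of_real (2 / pi * arcsin x)"
proof -
  let ?a = "arcsin x"
  have a: "\<bar>?a\<bar> < pi / 2" using arcsin_lt_bounded[of x] x by (auto simp: abs_less_iff)
  have "sin (of_real (pi / 2) * z) = sin (complex_of_real ?a)"
    using eq x by (simp add: sin_half_pi_def sin_of_real)
  then obtain n :: real where n: "n \<in> \<int>" "of_real (pi / 2) * z = of_real ?a + of_real (2 * n * pi) \<or>
      of_real (pi / 2) * z = - of_real ?a + complex_of_real ((2 * n + 1) * pi)"
    unfolding complex_sin_eq by blast
  then obtain y where y: "of_real (pi / 2) * z = complex_of_real y" "y = ?a + 2 * n * pi \<or> y = - ?a + (2 * n + 1) * pi"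
  proof -
    from n(2) have "of_real (pi / 2) * z = complex_of_real (?a + 2 * n * pi) \<or>
        of_real (pi / 2) * z = complex_of_real (- ?a + (2 * n + 1) * pi)"
      by (simp only: of_real_add of_real_minus)
    with that show thesis by blast
  qed
  have zy: "z = of_real (y * (2 / pi))"
  proof -
    have "of_real (2 / pi) * (of_real (pi / 2) * z) = of_real (2 / pi) * complex_of_real y" using y by simp
    moreover have "of_real (2 / pi) * (of_real (pi / 2) * z) = z" by (simp add: field_simps)
    ultimately show ?thesis by (simp add: mult.commute)
  qed
  then have "\<bar>y * (2 / pi)\<bar> < 1" using z by (auto simp: slit_plane_def)
  then have yb: "\<bar>y\<bar> < pi / 2" by (simp add: abs_mult field_simps)
  obtain m :: int where m: "n = of_int m" using n(1) by (auto elim: Ints_cases)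
  have "y = ?a"
  proof -
    consider "y = ?a + 2 * of_int m * pi" | "y = - ?a + (2 * of_int m + 1) * pi" using y(2) m by auto
    then show ?thesis
    proof cases
      case 1
      have "m = 0"
      proof (rule ccontr)
        assume "m \<noteq> 0"
        then have "1 \<le> \<bar>real_of_int m\<bar>" by linarith
        then have "1 * pi \<le> \<bar>real_of_int m\<bar> * pi" by (intro mult_right_mono) auto
        also have "\<dots> = \<bar>real_of_int m * pi\<bar>" by (simp add: abs_mult)
        finally show False using 1 a yb by linarith
      qed
      with 1 show ?thesis by simp
    next
      case 2
      have "1 \<le> \<bar>2 * real_of_int m + 1\<bar>" by (cases "m \<ge> 0") (auto simp: abs_if)
      then have "1 * pi \<le> \<bar>2 * real_of_int m + 1\<bar> * pi" by (intro mult_right_mono) auto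
      also have "\<dots> = \<bar>(2 * real_of_int m + 1) * pi\<bar>" by (simp add: abs_mult)
      finally show ?thesis using 2 a yb by linarith
    qed
  qed
  with zy show ?thesis by (simp add: mult.commute)
qed

lemma slit_plane_simply_connected: "simply_connected slit_plane"
proof (rule starlike_imp_simply_connected)
  show "starlike slit_plane" unfolding starlike_def
  proof (intro bexI[of _ 0] ballI subsetI)
    fix x y assume x: "x \<in> slit_plane" and "y \<in> closed_segment 0 x"
    then obtain u where u: "0 \<le> u" "u \<le> 1" "y = u *\<^sub>R x" by (auto simp: in_segment)
    show "y \<in> slit_plane"
    proof (cases "u = 0 \<or> Im x = 0")
      case False with u show ?thesis by (simp add: slit_plane_def)
    next
      case True
      have "\<bar>u * Re x\<bar> < 1"
      proof (cases "u = 0")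
        case False
        then have "\<bar>Re x\<bar> < 1" using True x by (simp add: slit_plane_def)
        moreover have "u * \<bar>Re x\<bar> \<le> 1 * \<bar>Re x\<bar>" using u by (intro mult_right_mono) auto
        ultimately show ?thesis using u by (simp add: abs_mult)
      qed simp
      then show ?thesis using u by (simp add: slit_plane_def)
    qed
  qed (simp add: slit_plane_def)
qed

lemma slit_real: "w \<in> slit \<Longrightarrow> \<exists>x. w = of_real x \<and> \<bar>x\<bar> < 1"
  by (auto simp: slit_def abs_less_iff)

lemma is_lift_scale:
  assumes "is_lift F b t \<zeta>" "0 \<le> t"
  shows "continuous_on {0..1} (\<lambda>s. \<zeta> (t * s))"
proof -
  have "(\<lambda>s. t * s) ` {0..1} \<subseteq> {0..t}" using assms(2) by (auto simp: mult_left_le)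
  moreover have "continuous_on {0..t} \<zeta>" using assms(1) by (simp add: is_lift_def)
  moreover have "continuous_on {0..1} (\<lambda>s. t * s)" by (intro continuous_intros)
  ultimately show ?thesis using continuous_on_compose2 by blast
qed

lemma null_homotopic_before_exit:
  assumes b: "continuous_on {0..} b" "b 0 = 0" and t: "t \<in> lift_times disc_map b" "b t \<in> slit"
  shows "null_homotopic_loop (- {-1, 1}) (closed_up_path b t)"
proof -
  interpret path_lifting disc_map b using path_lifting_disc_map b by blast
  let ?\<zeta> = "the_lift disc_map b"
  have l: "is_lift disc_map b t ?\<zeta>" and t0: "0 \<le> t" using is_lift_the_lift[OF t(1)] t(1) by (auto simp: lift_times_def)
  obtain x where x: "b t = of_real x" "\<bar>x\<bar> < 1" using slit_real[OF t(2)] by blast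
  define p where "p s = to_slit_plane (?\<zeta> (t * s))" for s
  \<comment> \<open>The return segment to 0 lifts through arcsine into the real interval (-1, 1),
    inside the slit plane.\<close>
  define q where "q s = complex_of_real (2 / pi * arcsin ((1 - s) * x))" for s
  have ts: "t * s \<in> {0..t}" if "s \<in> {0..1}" for s using that t0 by (auto simp: mult_left_le)
  have \<zeta>: "norm (?\<zeta> (t * s)) < 1" "disc_map (?\<zeta> (t * s)) = b (t * s)" if "s \<in> {0..1}" for s
    using l ts[OF that] by (auto simp: is_lift_def)
  have p: "path p" unfolding path_def p_def
  proof (rule continuous_on_compose2[OF continuous_to_slit_plane is_lift_scale[OF l t0]])
    show "(\<lambda>s. ?\<zeta> (t * s)) ` {0..1} \<subseteq> ball 0 1" using \<zeta>(1) by force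
  qed
  have pU: "p s \<in> slit_plane" if "s \<in> {0..1}" for s unfolding p_def using \<zeta>[OF that] to_slit_plane_in by blast
  have ph: "sin_half_pi (p s) = b (t * s)" if "s \<in> {0..1}" for s
    using \<zeta>[OF that] by (simp add: p_def disc_map_eq)
  have sx: "\<bar>(1 - s) * x\<bar> < 1" if "s \<in> {0..1}" for s
  proof -
    have "\<bar>(1 - s) * x\<bar> \<le> 1 * \<bar>x\<bar>" unfolding abs_mult using that by (intro mult_right_mono) auto
    with x show ?thesis by simp
  qed
  have q: "path q" unfolding path_def q_def
    by (intro continuous_intros) (use sx in \<open>auto simp: abs_less_iff intro: less_imp_le\<close>)
  have qU: "q s \<in> slit_plane" if "s \<in> {0..1}" for s
  proof -
    have "\<bar>arcsin ((1 - s) * x)\<bar> < pi / 2" using arcsin_lt_bounded[of "(1 - s) * x"] sx[OF that] by (auto simp: abs_less_iff)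
    then have "\<bar>2 / pi * arcsin ((1 - s) * x)\<bar> < 1" by (simp add: abs_mult field_simps)
    then show ?thesis unfolding slit_plane_def q_def by simp
  qed
  have qh: "sin_half_pi (q s) = linepath (b t) 0 s" if "s \<in> {0..1}" for s
  proof -
    have "complex_of_real (pi / 2) * q s = of_real (arcsin ((1 - s) * x))" by (simp add: q_def)
    then have "sin_half_pi (q s) = of_real (sin (arcsin ((1 - s) * x)))"
      unfolding sin_half_pi_def by (simp add: sin_of_real)
    also have "\<dots> = of_real ((1 - s) * x)" using sx[OF that] by (subst sin_arcsin) auto
    finally show ?thesis by (simp add: linepath_def x scaleR_conv_of_real)
  qed
  have p0: "pathstart p = 0" using l t0 by (simp add: pathstart_def p_def to_slit_plane_def is_lift_def)
  have q1: "pathfinish q = 0" by (simp add: pathfinish_def q_def)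
  have pq: "pathfinish p = pathstart q"
    using sin_half_pi_real_preimage[OF pU[of 1] x(2)] ph[of 1] x by (simp add: pathfinish_def pathstart_def q_def)
  have "path_image p \<subseteq> slit_plane" "path_image q \<subseteq> slit_plane" using pU qU by (auto simp: path_image_def)
  then have "path_image (p +++ q) \<subseteq> slit_plane" by (rule subset_path_image_join)
  moreover have "path (p +++ q)" using p q pq by simp
  moreover have "pathfinish (p +++ q) = pathstart (p +++ q)" using p0 q1 by simp
  ultimately have loop: "path (p +++ q)" "path_image (p +++ q) \<subseteq> slit_plane" "pathfinish (p +++ q) = pathstart (p +++ q)"
    by blast+
  have "homotopic_loops slit_plane (p +++ q) (linepath 0 0)"
    using slit_plane_simply_connected loop unfolding simply_connected_eq_contractible_loop_any
    by (auto simp: slit_plane_def)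
  \<comment> \<open>The contraction in the slit plane is pushed down by the sine, which misses
    \<plusminus>1 there.\<close>
  then have "homotopic_loops (- {-1, 1}) (sin_half_pi \<circ> (p +++ q)) (sin_half_pi \<circ> linepath 0 0)"
    by (rule homotopic_loops_continuous_image)
       (use sin_half_pi_avoids in \<open>auto simp: sin_half_pi_def[abs_def] intro!: continuous_intros\<close>)
  moreover have "sin_half_pi \<circ> linepath 0 0 = (\<lambda>_. 0)" by (auto simp: linepath_refl sin_half_pi_def)
  ultimately have H: "homotopic_loops (- {-1, 1}) (sin_half_pi \<circ> (p +++ q)) (\<lambda>_. 0)" by simp
  have "homotopic_loops (- {-1, 1}) (sin_half_pi \<circ> (p +++ q)) (closed_up_path b t)"
  proof (rule homotopic_loops_eq)
    show "path (sin_half_pi \<circ> (p +++ q))" "path_image (sin_half_pi \<circ> (p +++ q)) \<subseteq> - {-1, 1}"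
      "pathfinish (sin_half_pi \<circ> (p +++ q)) = pathstart (sin_half_pi \<circ> (p +++ q))"
      using homotopic_loops_imp_path[OF H] homotopic_loops_imp_subset[OF H] homotopic_loops_imp_loop[OF H] by auto
    fix s :: real assume s: "s \<in> {0..1}"
    show "(sin_half_pi \<circ> (p +++ q)) s = closed_up_path b t s"
      using s ph[of "2 * s"] qh[of "2 * s - 1"] by (auto simp: closed_up_path_def joinpaths_def)
  qed
  with H show ?thesis unfolding null_homotopic_loop_def
    by (meson homotopic_loops_sym homotopic_loops_trans)
qed

section \<open>A continuous logarithm of the cosine along the lift\<close>

definition log_cos :: "real \<Rightarrow> complex \<Rightarrow> complex" where
  "log_cos \<sigma> z = - (of_real (\<sigma> * (pi / 2)) * \<i> * z) + Ln ((1 + exp (of_real (\<sigma> * pi) * \<i> * z)) / 2)"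

text \<open>The logarithm of \<open>cos (\<pi> z / 2)\<close> on the closed half plane \<open>\<sigma> * Im z \<ge> 0\<close> minus the odd integers:
  there \<open>1 + exp (\<sigma> \<pi> \<i> z)\<close> has positive real part, so the principal branch applies.\<close>

lemma log_cos_half_plane:
  assumes \<sigma>: "\<sigma> = 1 \<or> \<sigma> = -1" and z: "0 \<le> \<sigma> * Im z" and nz: "cos (of_real (pi / 2) * z) \<noteq> 0"
  shows "0 < Re ((1 + exp (of_real (\<sigma> * pi) * \<i> * z)) / 2)" and "exp (log_cos \<sigma> z) = cos (of_real (pi / 2) * z)"
proof -
  define e where "e = exp (of_real (\<sigma> * pi) * \<i> * z)"
  define h where "h = exp (- (of_real (\<sigma> * (pi / 2)) * \<i> * z))"
  have he: "h * e = exp (of_real (\<sigma> * (pi / 2)) * \<i> * z)"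
    unfolding h_def e_def exp_add[symmetric] by (simp add: algebra_simps)
  have c: "h * ((1 + e) / 2) = cos (of_real (pi / 2) * z)"
  proof -
    have "h * (1 + e) = exp (- (of_real (\<sigma> * (pi / 2)) * \<i> * z)) + exp (of_real (\<sigma> * (pi / 2)) * \<i> * z)"
      using he by (simp add: h_def algebra_simps)
    also have "\<dots> = exp (\<i> * (of_real (pi / 2) * z)) + exp (- (\<i> * (of_real (pi / 2) * z)))"
      using \<sigma> by (auto simp: mult_ac add.commute)
    also have "\<dots> = 2 * cos (of_real (pi / 2) * z)" by (simp add: cos_exp_eq)
    finally show ?thesis by simp
  qed
  have "norm e \<le> 1" using z by (simp add: e_def norm_exp_eq_Re mult_ac)
  then have "Re e \<ge> -1" using abs_Re_le_cmod[of e] by linarith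
  moreover have "Re e \<noteq> -1"
  proof
    assume r: "Re e = -1"
    have "(Re e)\<^sup>2 + (Im e)\<^sup>2 \<le> 1" using \<open>norm e \<le> 1\<close> by (simp add: cmod_def)
    then have "Im e = 0" using r by simp
    with r have "e = -1" by (simp add: complex_eq_iff)
    with c nz show False by simp
  qed
  ultimately have pos: "0 < Re ((1 + e) / 2)" by simp
  then show "0 < Re ((1 + exp (of_real (\<sigma> * pi) * \<i> * z)) / 2)" by (simp add: e_def)
  from pos have "(1 + e) / 2 \<noteq> 0" by (metis less_irrefl zero_complex.sel(1))
  show "exp (log_cos \<sigma> z) = cos (of_real (pi / 2) * z)"
    unfolding log_cos_def exp_add e_def[symmetric] h_def[symmetric] exp_Ln[OF \<open>(1 + e) / 2 \<noteq> 0\<close>] by (rule c)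
qed

lemma continuous_on_log_cos:
  assumes \<sigma>: "\<sigma> = 1 \<or> \<sigma> = -1" and f: "continuous_on S f"
    and z: "\<And>s. s \<in> S \<Longrightarrow> 0 \<le> \<sigma> * Im (f s) \<and> cos (of_real (pi / 2) * f s) \<noteq> 0"
  shows "continuous_on S (\<lambda>s. log_cos \<sigma> (f s))"
  unfolding log_cos_def
proof (intro continuous_intros f ballI)
  fix s assume "s \<in> S"
  with log_cos_half_plane(1)[OF \<sigma>, of "f s"] z
  show "(1 + exp (of_real (\<sigma> * pi) * \<i> * f s)) / 2 \<notin> \<real>\<^sub>\<le>\<^sub>0"
    by (auto simp: complex_nonpos_Reals_iff)
qed simp

text \<open>Both sides have the same exponential, and two contributions below pi / 2 keep the
  imaginary part of the left side in (-pi, pi). So the branches of the two half planes glue across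
  (-1, 1).\<close>

lemma log_cos_inner:
  assumes \<sigma>: "\<sigma> = 1 \<or> \<sigma> = -1" and z: "Im z = 0" "\<bar>Re z\<bar> < 1"
  shows "log_cos \<sigma> z = of_real (ln (cos (pi / 2 * Re z)))"
proof -
  let ?x = "Re z"
  have zx: "z = of_real ?x" using z by (simp add: complex_eq_iff)
  have "\<bar>pi / 2 * ?x\<bar> < pi / 2" using z(2) by (simp add: abs_mult)
  then have c: "0 < cos (pi / 2 * ?x)" by (intro cos_gt_zero_pi) (auto simp: abs_less_iff)
  have nz: "cos (of_real (pi / 2) * z) \<noteq> 0"
    using cos_half_pi_zeroD(2)[of z] z by auto
  have e1: "exp (log_cos \<sigma> z) = exp (complex_of_real (ln (cos (pi / 2 * ?x))))"
  proof -
    have "exp (log_cos \<sigma> z) = cos (of_real (pi / 2) * z)"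
      using log_cos_half_plane(2)[OF \<sigma> _ nz] z by simp
    also have "\<dots> = complex_of_real (cos (pi / 2 * ?x))" by (subst zx) (simp flip: cos_of_real)
    also have "\<dots> = exp (complex_of_real (ln (cos (pi / 2 * ?x))))"
      using c by (simp add: exp_of_real)
    finally show ?thesis .
  qed
  have "0 < Re ((1 + exp (of_real (\<sigma> * pi) * \<i> * z)) / 2)"
    using log_cos_half_plane(1)[OF \<sigma> _ nz] z by simp
  then have "\<bar>Im (Ln ((1 + exp (of_real (\<sigma> * pi) * \<i> * z)) / 2))\<bar> < pi / 2"
    by (rule Re_Ln_pos_lt_imp)
  moreover have "\<bar>\<sigma> * (pi / 2) * ?x\<bar> < pi / 2"
    using \<open>\<bar>pi / 2 * ?x\<bar> < pi / 2\<close> \<sigma> by auto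
  ultimately have "\<bar>Im (log_cos \<sigma> z)\<bar> < pi" unfolding log_cos_def by simp
  then show ?thesis by (intro exp_complex_eqI[OF _ e1]) simp
qed

text \<open>The linear term contributes at least pi / 2 in modulus and the principal logarithm
  strictly less, so they cannot cancel. This is the nonzero winding, measured at the exit
  point.\<close>

lemma Im_log_cos_outer:
  assumes \<sigma>: "\<sigma> = 1 \<or> \<sigma> = -1" and x: "1 \<le> \<bar>x\<bar>" and nz: "cos (of_real (pi / 2) * complex_of_real x) \<noteq> 0"
  shows "Im (log_cos \<sigma> (of_real x)) \<noteq> 0"
proof -
  have "0 < Re ((1 + exp (of_real (\<sigma> * pi) * \<i> * of_real x)) / 2)"
    using log_cos_half_plane(1)[OF \<sigma> _ nz] by simp
  then have "\<bar>Im (Ln ((1 + exp (of_real (\<sigma> * pi) * \<i> * of_real x)) / 2))\<bar> < pi / 2"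
    by (rule Re_Ln_pos_lt_imp)
  moreover have "pi / 2 \<le> \<bar>\<sigma> * (pi / 2) * x\<bar>"
    using x \<sigma> by (auto simp: abs_mult)
  moreover have "Im (log_cos \<sigma> (of_real x)) = - (\<sigma> * (pi / 2) * x) + Im (Ln ((1 + exp (of_real (\<sigma> * pi) * \<i> * of_real x)) / 2))"
    unfolding log_cos_def by simp
  ultimately show ?thesis by linarith
qed

text \<open>Any continuous logarithm differs by a constant from the one supplied by the winding
  number, and the latter closes up because a null-homotopic loop has winding number 0.\<close>

lemma closed_log_of_null_homotopic_loop:
  fixes a :: complex
  assumes H: "homotopic_loops (- {0}) \<gamma> (\<lambda>_. a)" and L: "path \<Lambda>"
    and exp: "\<And>s. s \<in> {0..1} \<Longrightarrow> \<gamma> s = exp (\<Lambda> s)"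
  shows "pathfinish \<Lambda> = pathstart \<Lambda>"
proof -
  have \<gamma>: "path \<gamma>" "0 \<notin> path_image \<gamma>"
    using homotopic_loops_imp_path[OF H] homotopic_loops_imp_subset[OF H] by auto
  have w: "winding_number \<gamma> 0 = 0"
    using winding_number_homotopic_loops_null_eq[OF \<gamma>] H by blast
  obtain q where q: "path q" "pathfinish q - pathstart q = 2 * of_real pi * \<i> * winding_number \<gamma> 0"
      "\<And>t. t \<in> {0..1} \<Longrightarrow> \<gamma> t = 0 + exp (q t)"
    using winding_number_as_continuous_log[OF \<gamma>] by metis
  define D where "D s = \<Lambda> s - q s" for s
  have "continuous_on {0..1} D" unfolding D_def
    using L q(1) by (intro continuous_intros) (auto simp: path_def)
  moreover have "exp (D s) = 1" if "s \<in> {0..1}" for s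
    using exp[OF that] q(3)[OF that] by (simp add: D_def exp_diff)
  ultimately have "D constant_on {0..1}"
    by (intro continuous_logarithm_constant) auto
  then obtain k where k: "\<And>s. s \<in> {0..1} \<Longrightarrow> D s = k" by (auto simp: constant_on_def)
  have "D 1 = D 0" using k[of 0] k[of 1] by simp
  with q(2) w show ?thesis by (simp add: D_def pathfinish_def pathstart_def algebra_simps)
qed

text \<open>A continuous logarithm of cos (pi z / 2) is carried along the lifted path: the two
  half-plane branches glued across (-1, 1), then one fixed branch up to the ray. Its final imaginary
  part is nonzero, while the return along the real segment adds only real amounts. Assumption
  \<open>nzx\<close> says that \<open>b \<tau>\<close> is not \<plusminus>1.\<close>

lemma winding_at_exit:
  assumes bc: "continuous_on {0..} b" "b 0 = 0" and T: "T \<notin> lift_times disc_map b" "0 \<le> T"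
  defines "\<tau> \<equiv> Sup (lift_times disc_map b)" and "x \<equiv> 1 / Re (exit_point disc_map b)"
  assumes nzx: "cos (pi / 2 * x) \<noteq> 0"
  shows "\<tau> \<in> winding_times b"
proof -
  interpret path_lifting disc_map b using path_lifting_disc_map bc by blast
  note A = lift_times_eq[OF T, folded \<tau>_def]
  note E = exit_point_disc_map[OF bc T, folded \<tau>_def x_def]
  let ?\<zeta> = "the_lift disc_map b"
  define z where "z s = (if s < \<tau> then to_slit_plane (?\<zeta> s) else of_real x)" for s
  have l: "is_lift disc_map b s ?\<zeta>" if "0 \<le> s" "s < \<tau>" for s
    using is_lift_the_lift[of s] A(1)[of s] that by simp
  have \<zeta>: "norm (?\<zeta> s) < 1" "disc_map (?\<zeta> s) = b s" if "0 \<le> s" "s < \<tau>" for s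
    using l[OF that] that by (auto simp: is_lift_def)
  have "\<bar>Re (exit_point disc_map b)\<bar> \<le> 1" using abs_Re_le_cmod[of "exit_point disc_map b"] E(2) by simp
  then have x1: "1 \<le> \<bar>x\<bar>" using E(3) by (simp add: x_def)
  have nzc: "cos (of_real (pi / 2) * complex_of_real x) \<noteq> 0"
  proof -
    have "cos (of_real (pi / 2) * complex_of_real x) = of_real (cos (pi / 2 * x))"
      by (simp flip: cos_of_real)
    with nzx show ?thesis by simp
  qed
  have zU: "z s \<in> slit_plane" if "0 \<le> s" "s < \<tau>" for s
    using to_slit_plane_in[OF \<zeta>(1)[OF that]] that by (simp add: z_def)
  have zcos: "cos (of_real (pi / 2) * z s) \<noteq> 0" if "0 \<le> s" "s \<le> \<tau>" for s
    using cos_half_pi_nonzero[OF zU[of s]] nzc that by (cases "s < \<tau>") (auto simp: z_def)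
  have zb: "1 - (b s)\<^sup>2 = (cos (of_real (pi / 2) * z s))\<^sup>2" if "0 \<le> s" "s \<le> \<tau>" for s
  proof -
    have "b s = sin_half_pi (z s)"
    proof (cases "s < \<tau>")
      case True
      then show ?thesis using \<zeta>(2)[of s] that by (simp add: z_def disc_map_eq)
    next
      case False
      with that have "s = \<tau>" by simp
      then show ?thesis using E(4) by (simp add: z_def sin_half_pi_def flip: sin_of_real)
    qed
    then show ?thesis by (simp add: sin_half_pi_def cos_squared_eq)
  qed
  have zc0: "continuous_on {0..s} z" if "0 \<le> s" "s < \<tau>" for s
  proof -
    have "continuous_on {0..s} (\<lambda>u. to_slit_plane (?\<zeta> u))"
    proof (rule continuous_on_compose2[OF continuous_to_slit_plane])
      show "continuous_on {0..s} ?\<zeta>" using l[OF that] by (simp add: is_lift_def)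
      show "?\<zeta> ` {0..s} \<subseteq> ball 0 1" using \<zeta>(1) that by force
    qed
    then show ?thesis by (rule continuous_on_eq) (use that in \<open>simp add: z_def\<close>)
  qed
  have "(z \<longlongrightarrow> z \<tau>) (at_left \<tau>)"
  proof -
    have "\<forall>\<^sub>F s in at_left \<tau>. s < \<tau>" by (simp add: eventually_at_filter)
    then have "\<forall>\<^sub>F s in at_left \<tau>. 2 * ?\<zeta> s / (1 + (?\<zeta> s)\<^sup>2) = z s"
      by eventually_elim (simp add: z_def to_slit_plane_def)
    from Lim_transform_eventually[OF E(5) this] have "(z \<longlongrightarrow> of_real x) (at_left \<tau>)" .
    moreover have "z \<tau> = of_real x" by (simp add: z_def)
    ultimately show ?thesis by simp
  qed
  have zcont: "continuous_on {0..\<tau>} z"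
    unfolding continuous_on_def
  proof
    fix s assume s: "s \<in> {0..\<tau>}"
    show "(z \<longlongrightarrow> z s) (at s within {0..\<tau>})"
    proof (cases "s < \<tau>")
      case False
      with s have "s = \<tau>" by simp
      moreover have "at \<tau> within {0..\<tau>} \<le> at_left \<tau>"
        using A(3) by (simp add: at_within_Icc_at_left)
      ultimately show ?thesis using \<open>(z \<longlongrightarrow> z \<tau>) (at_left \<tau>)\<close> by (auto intro: tendsto_mono)
    next
      case True
      then obtain s' where s': "s < s'" "s' < \<tau>" using dense by blast
      have "(z \<longlongrightarrow> z s) (at s within {0..s'})"
        using zc0[of s'] s s' by (auto simp: continuous_on_def)
      moreover have "at s within {0..\<tau>} = at s within {0..s'}"
        by (rule at_within_nhd[of s "{..<s'}"]) (use s' in auto)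
      ultimately show ?thesis by simp
    qed
  qed
  \<comment> \<open>Closer to x than |x| - 1 the real part has modulus above 1, so a point of the
    slit plane there is not real and the lift stays on one side of the ray. The second disjunct
    falls away because the cosine vanishes at \<plusminus>pi / 2.\<close>
  have "\<forall>\<^sub>F s in at_left \<tau>. dist (z s) (z \<tau>) < \<bar>x\<bar> - 1 \<or> \<bar>x\<bar> = 1"
    using tendstoD[OF \<open>(z \<longlongrightarrow> z \<tau>) (at_left \<tau>)\<close>, of "\<bar>x\<bar> - 1"] x1 by (cases "\<bar>x\<bar> = 1") auto
  moreover have "\<bar>x\<bar> \<noteq> 1" using nzx by (auto simp: abs_if split: if_splits)
  ultimately have "\<forall>\<^sub>F s in at_left \<tau>. dist (z s) (z \<tau>) < \<bar>x\<bar> - 1" by simp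
  then obtain s0 where s0: "s0 < \<tau>" "\<And>s. s0 < s \<Longrightarrow> s < \<tau> \<Longrightarrow> dist (z s) (z \<tau>) < \<bar>x\<bar> - 1"
    unfolding eventually_at_left[OF A(3)] by blast
  define s1 where "s1 = (max 0 s0 + \<tau>) / 2"
  have s1: "0 < s1" "s0 < s1" "s1 < \<tau>" using s0(1) A(3) by (auto simp: s1_def field_simps max_def)
  have Imnz: "Im (z s) \<noteq> 0" if "s \<in> {s1..<\<tau>}" for s
  proof
    assume "Im (z s) = 0"
    then have "\<bar>Re (z s)\<bar> < 1" using zU[of s] that s1 by (auto simp: slit_plane_def)
    moreover have "dist (z s) (z \<tau>) < \<bar>x\<bar> - 1" using s0(2)[of s] that s1 by auto
    then have "\<bar>Re (z s - z \<tau>)\<bar> < \<bar>x\<bar> - 1" using abs_Re_le_cmod[of "z s - z \<tau>"] by (simp add: dist_norm)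
    then have "\<bar>Re (z s) - x\<bar> < \<bar>x\<bar> - 1" by (simp add: z_def)
    ultimately show False by linarith
  qed
  have conn: "connected ((\<lambda>s. Im (z s)) ` {s1..<\<tau>})"
    by (intro connected_continuous_image continuous_intros continuous_on_subset[OF zcont]) (use s1 in auto)
  define \<sigma> :: real where "\<sigma> = (if 0 < Im (z s1) then 1 else -1)"
  have \<sigma>: "\<sigma> = 1 \<or> \<sigma> = -1" by (simp add: \<sigma>_def)
  have side: "0 \<le> \<sigma> * Im (z s)" if s: "s \<in> {s1..\<tau>}" for s
  proof (cases "s < \<tau>")
    case False
    then show ?thesis by (simp add: z_def)
  next
    case True
    have in0: "Im (z s) \<in> (\<lambda>s. Im (z s)) ` {s1..<\<tau>}" "Im (z s1) \<in> (\<lambda>s. Im (z s)) ` {s1..<\<tau>}"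
      using s True s1 by auto
    have no0: "0 \<notin> (\<lambda>s. Im (z s)) ` {s1..<\<tau>}" using Imnz by force
    show ?thesis
    proof (rule ccontr)
      assume "\<not> 0 \<le> \<sigma> * Im (z s)"
      then have "Im (z s) < 0 \<and> 0 < Im (z s1) \<or> 0 < Im (z s) \<and> Im (z s1) \<le> 0"
        by (auto simp: \<sigma>_def split: if_splits)
      then have "0 \<in> (\<lambda>s. Im (z s)) ` {s1..<\<tau>}"
        using connectedD_interval[OF conn in0(1) in0(2), of 0] connectedD_interval[OF conn in0(2) in0(1), of 0] by force
      with no0 show False by simp
    qed
  qed
  \<comment> \<open>The branch follows the half plane as long as the path may cross (-1, 1); after
    \<open>s1\<close> a single side \<sigma> is kept, up to the end on the ray, where the gluing
    across (-1, 1) no longer applies.\<close>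
  define l0 where "l0 s = (if Im (z s) \<le> 0 then log_cos (-1) (z s) else log_cos 1 (z s))" for s
  have l0c: "continuous_on {0..s1} l0"
    unfolding l0_def
  proof (rule continuous_on_cases_le)
    have zc: "continuous_on {0..s1} z" by (rule continuous_on_subset[OF zcont]) (use s1 in auto)
    then show "continuous_on {0..s1} (\<lambda>s. Im (z s))" by (intro continuous_intros)
    show "continuous_on {s \<in> {0..s1}. Im (z s) \<le> 0} (\<lambda>s. log_cos (-1) (z s))"
      by (rule continuous_on_log_cos) (use s1 zcos in \<open>auto intro: continuous_on_subset[OF zc]\<close>)
    show "continuous_on {s \<in> {0..s1}. 0 \<le> Im (z s)} (\<lambda>s. log_cos 1 (z s))"
      by (rule continuous_on_log_cos) (use s1 zcos in \<open>auto intro: continuous_on_subset[OF zc]\<close>)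
    show "log_cos (-1) (z s) = log_cos 1 (z s)" if "s \<in> {0..s1}" "Im (z s) = 0" for s
    proof -
      have "\<bar>Re (z s)\<bar> < 1" using zU[of s] that s1 by (auto simp: slit_plane_def)
      then show ?thesis using log_cos_inner[of "-1" "z s"] log_cos_inner[of 1 "z s"] that by simp
    qed
  qed
  define \<mu> where "\<mu> s = (if s \<le> s1 then l0 s else log_cos \<sigma> (z s))" for s
  have \<mu>c: "continuous_on {0..\<tau>} \<mu>"
    unfolding \<mu>_def
  proof (rule continuous_on_cases_le)
    show "continuous_on {s \<in> {0..\<tau>}. s \<le> s1} l0" by (rule continuous_on_subset[OF l0c]) auto
    show "continuous_on {s \<in> {0..\<tau>}. s1 \<le> s} (\<lambda>s. log_cos \<sigma> (z s))"
      by (rule continuous_on_log_cos[OF \<sigma>]) (use side zcos in \<open>auto intro: continuous_on_subset[OF zcont]\<close>)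
    show "l0 s = log_cos \<sigma> (z s)" if "s = s1" for s
      using that by (auto simp: l0_def \<sigma>_def)
  qed (intro continuous_intros)
  have \<mu>exp: "exp (2 * \<mu> s) = 1 - (b s)\<^sup>2" if s: "0 \<le> s" "s \<le> \<tau>" for s
  proof -
    have "exp (\<mu> s) = cos (of_real (pi / 2) * z s)"
      unfolding \<mu>_def l0_def using log_cos_half_plane(2)[OF _ _ zcos[OF s]] side[of s] \<sigma> s by auto
    then show ?thesis by (simp add: zb[OF s] exp_double)
  qed
  have \<mu>0: "\<mu> 0 = 0"
  proof -
    have "z 0 = 0" using A(3) l[of 0] by (simp add: z_def to_slit_plane_def is_lift_def)
    then show ?thesis using s1 log_cos_inner[of "-1" 0] by (simp add: \<mu>_def l0_def)
  qed
  have \<mu>\<tau>: "\<mu> \<tau> = log_cos \<sigma> (of_real x)" using s1 by (simp add: \<mu>_def z_def)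
  define y where "y = sin (pi / 2 * x)"
  have bty: "b \<tau> = of_real y" using E(4) by (simp add: y_def)
  have "y\<^sup>2 = 1 - (cos (pi / 2 * x))\<^sup>2" by (simp add: y_def sin_squared_eq)
  moreover have "0 < (cos (pi / 2 * x))\<^sup>2" using nzx by simp
  ultimately have "y\<^sup>2 < 1" by linarith
  then have y1: "\<bar>y\<bar> < 1" by (simp add: abs_square_less_1)
  have "b \<tau> \<in> slit" unfolding bty slit_def using y1 by (auto simp: abs_less_iff)
  moreover have "\<not> null_homotopic_loop (- {-1, 1}) (closed_up_path b \<tau>)"
  proof
    assume "null_homotopic_loop (- {-1, 1}) (closed_up_path b \<tau>)"
    then obtain a where H: "homotopic_loops (- {-1, 1}) (closed_up_path b \<tau>) (\<lambda>_. a)"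
      by (auto simp: null_homotopic_loop_def)
    have ys: "((1 - s) * y)\<^sup>2 < 1" if "s \<in> {0..1}" for s
    proof -
      have "\<bar>(1 - s) * y\<bar> \<le> 1 * \<bar>y\<bar>" unfolding abs_mult using that by (intro mult_right_mono) auto
      then have "\<bar>(1 - s) * y\<bar> < 1" using y1 by simp
      then show ?thesis by (simp add: abs_square_less_1)
    qed
    have "homotopic_loops (- {0}) ((\<lambda>w. 1 - w\<^sup>2) \<circ> closed_up_path b \<tau>) ((\<lambda>w. 1 - w\<^sup>2) \<circ> (\<lambda>_. a))"
      by (rule homotopic_loops_continuous_image[OF H])
         (auto intro!: continuous_intros simp: power2_eq_1_iff)
    then have H': "homotopic_loops (- {0}) ((\<lambda>w. 1 - w\<^sup>2) \<circ> closed_up_path b \<tau>) (\<lambda>_. 1 - a\<^sup>2)" by (simp add: comp_def)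
    \<comment> \<open>The factor 2 reflects that 1 - b^2 is the square of the cosine. Along the
      return segment 1 - w^2 stays positive, so there \<open>\<Lambda>2\<close> uses the real
      logarithm, shifted to start at the value \<open>2 * \<mu> \<tau>\<close> already
      reached.\<close>
    define \<Lambda>1 where "\<Lambda>1 s = 2 * \<mu> (\<tau> * s)" for s
    define \<Lambda>2 where "\<Lambda>2 s = 2 * \<mu> \<tau> + of_real (ln (1 - ((1 - s) * y)\<^sup>2) - ln (1 - y\<^sup>2))" for s
    have "path \<Lambda>1" unfolding path_def \<Lambda>1_def
    proof (intro continuous_intros continuous_on_compose2[OF \<mu>c])
      show "(\<lambda>s. \<tau> * s) ` {0..1} \<subseteq> {0..\<tau>}" using A(3) by (auto simp: mult_left_le)
    qed
    moreover have "path \<Lambda>2" unfolding path_def \<Lambda>2_def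
      by (intro continuous_intros) (use ys in force)
    moreover have "pathfinish \<Lambda>1 = pathstart \<Lambda>2" by (simp add: pathfinish_def pathstart_def \<Lambda>1_def \<Lambda>2_def)
    ultimately have "path (\<Lambda>1 +++ \<Lambda>2)" by simp
    moreover have "((\<lambda>w. 1 - w\<^sup>2) \<circ> closed_up_path b \<tau>) s = exp ((\<Lambda>1 +++ \<Lambda>2) s)" if s: "s \<in> {0..1}" for s
    proof (cases "s \<le> 1 / 2")
      case True
      have "0 \<le> \<tau> * (2 * s)" "\<tau> * (2 * s) \<le> \<tau>" using A(3) s True by (auto simp: mult_left_le)
      from \<mu>exp[OF this] show ?thesis using True by (simp add: closed_up_path_def joinpaths_def \<Lambda>1_def)
    next
      case False
      define t where "t = 2 * s - 1"
      have t: "t \<in> {0..1}" using s False by (auto simp: t_def)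
      have "exp (\<Lambda>2 t) = exp (2 * \<mu> \<tau>) * exp (complex_of_real (ln (1 - ((1 - t) * y)\<^sup>2) - ln (1 - y\<^sup>2)))"
        by (simp add: \<Lambda>2_def exp_add)
      also have "exp (complex_of_real (ln (1 - ((1 - t) * y)\<^sup>2) - ln (1 - y\<^sup>2))) = of_real ((1 - ((1 - t) * y)\<^sup>2) / (1 - y\<^sup>2))"
        unfolding exp_of_real exp_diff using ys[OF t] \<open>y\<^sup>2 < 1\<close> by simp
      also have "exp (2 * \<mu> \<tau>) = of_real (1 - y\<^sup>2)" using \<mu>exp[of \<tau>] A(3) by (simp add: bty)
      also have "complex_of_real (1 - y\<^sup>2) * of_real ((1 - ((1 - t) * y)\<^sup>2) / (1 - y\<^sup>2)) = of_real (1 - ((1 - t) * y)\<^sup>2)"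
        unfolding of_real_mult[symmetric] using \<open>y\<^sup>2 < 1\<close> by simp
      finally have "exp (\<Lambda>2 t) = of_real (1 - ((1 - t) * y)\<^sup>2)" .
      moreover have "closed_up_path b \<tau> s = of_real ((1 - t) * y)"
        using False by (simp add: closed_up_path_def joinpaths_def t_def linepath_def bty scaleR_conv_of_real)
      ultimately show ?thesis using False by (simp add: joinpaths_def t_def)
    qed
    ultimately have "pathfinish (\<Lambda>1 +++ \<Lambda>2) = pathstart (\<Lambda>1 +++ \<Lambda>2)"
      using closed_log_of_null_homotopic_loop[OF H'] by blast
    then have "\<Lambda>2 1 = \<Lambda>1 0" by (simp add: pathfinish_def pathstart_def joinpaths_def)
    then have "2 * \<mu> \<tau> = of_real (ln (1 - y\<^sup>2))" by (simp add: \<Lambda>1_def \<Lambda>2_def \<mu>0)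
    then have "Im (2 * \<mu> \<tau>) = 0" by (simp only: Im_complex_of_real)
    with Im_log_cos_outer[OF \<sigma> x1 nzc] show False by (simp add: \<mu>\<tau>)
  qed
  ultimately show ?thesis using A(3) by (auto simp: winding_times_def)
qed

section \<open>The law on the slit\<close>

text \<open>Density of 1 / cos \<Theta> for \<Theta> uniform on the circle, the point at which the
  lift to the slit plane hits a ray. The value 0 on [-1, 1] later removes the term n = 0.\<close>

definition exit_density :: "real \<Rightarrow> real" where
  "exit_density x = (if 1 < \<bar>x\<bar> then 1 / (pi * (\<bar>x\<bar> * sqrt (x\<^sup>2 - 1))) else 0)"

lemma one_less_abs_square: "1 < \<bar>x\<bar> \<Longrightarrow> 1 < (x::real)\<^sup>2"
  by (metis one_less_power power2_abs zero_less_numeral)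

lemma exit_density_nonneg [simp]: "0 \<le> exit_density x"
proof (cases "1 < \<bar>x\<bar>")
  case True
  from one_less_abs_square[OF this] have "0 \<le> sqrt (x\<^sup>2 - 1)" by simp
  then show ?thesis unfolding exit_density_def by simp
qed (simp add: exit_density_def)

lemma borel_measurable_exit_density [measurable]: "exit_density \<in> borel_measurable borel"
  unfolding exit_density_def by measurable

lemma exit_density_minus [simp]: "exit_density (- x) = exit_density x"
  by (simp add: exit_density_def)

text \<open>The antiderivative is the tail of the arcsine law read at 1 / x; it serves both rays
  because the modulus of x absorbs the sign.\<close>

lemma DERIV_arccos_inverse:
  assumes x: "1 < \<bar>x\<bar>"
  shows "((\<lambda>x. arccos (1 / x) / pi) has_real_derivative exit_density x) (at x)"
proof -
  have x0: "x \<noteq> 0" and ix: "- 1 < 1 / x" "1 / x < 1" using x by (auto simp: field_simps abs_if split: if_splits)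
  have "(arccos has_real_derivative inverse (- sqrt (1 - (1 / x)\<^sup>2))) (at (1 / x))"
    by (rule DERIV_arccos) fact+
  moreover have "((\<lambda>x. 1 / x) has_real_derivative - 1 / x\<^sup>2) (at x)"
    by (rule derivative_eq_intros refl x0)+ (simp add: power2_eq_square)
  ultimately have "((\<lambda>x. arccos (1 / x)) has_real_derivative inverse (- sqrt (1 - (1 / x)\<^sup>2)) * (- 1 / x\<^sup>2)) (at x)"
    using DERIV_chain2 by blast
  then have D: "((\<lambda>x. arccos (1 / x) / pi) has_real_derivative inverse (- sqrt (1 - (1 / x)\<^sup>2)) * (- 1 / x\<^sup>2) / pi) (at x)"
    by (rule DERIV_cdivide)
  have "sqrt (1 - (1 / x)\<^sup>2) = sqrt ((x\<^sup>2 - 1) / x\<^sup>2)" using x0 by (simp add: field_simps power2_eq_square)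
  also have "\<dots> = sqrt (x\<^sup>2 - 1) / \<bar>x\<bar>" by (simp add: real_sqrt_divide)
  finally have s: "sqrt (1 - (1 / x)\<^sup>2) = sqrt (x\<^sup>2 - 1) / \<bar>x\<bar>" .
  have alg: "inverse (- (S / a)) * (- 1 / (a * a)) / pi = 1 / (pi * (a * S))" if "0 < a" "0 < S" for a S :: real
    using that by (simp add: field_simps)
  have "0 < \<bar>x\<bar>" "0 < sqrt (x\<^sup>2 - 1)" using x one_less_abs_square[OF x] by auto
  from alg[OF this] have "inverse (- sqrt (1 - (1 / x)\<^sup>2)) * (- 1 / x\<^sup>2) / pi = exit_density x"
    unfolding s exit_density_def using x by (simp add: power2_eq_square)
  with D show ?thesis by simp
qed

lemma isCont_exit_density: "1 < \<bar>x\<bar> \<Longrightarrow> isCont exit_density x"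
proof -
  assume x: "1 < \<bar>x\<bar>"
  have "\<forall>\<^sub>F y in nhds x. y \<in> {y. 1 < \<bar>y\<bar>}"
    by (rule eventually_nhds_in_open) (use x in \<open>auto intro!: open_Collect_less continuous_intros\<close>)
  then have ev: "\<forall>\<^sub>F y in nhds x. exit_density y = 1 / (pi * (\<bar>y\<bar> * sqrt (y\<^sup>2 - 1)))"
    by eventually_elim (simp add: exit_density_def)
  have "isCont (\<lambda>y. 1 / (pi * (\<bar>y\<bar> * sqrt (y\<^sup>2 - 1)))) x"
    using x one_less_abs_square[OF x] by (intro continuous_intros) auto
  then show ?thesis using isCont_cong[OF ev] by simp
qed

text \<open>The density is unbounded at \<plusminus>1 and the rays are infinite, hence the extended
  real end points and the one-sided limits of the antiderivative.\<close>

lemma emeasure_exit_density_aux: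
  fixes a b :: ereal
  assumes ab: "a < b" and out: "\<And>x. a < ereal x \<Longrightarrow> ereal x < b \<Longrightarrow> 1 < \<bar>x\<bar>"
    and A: "(((\<lambda>x. arccos (1 / x) / pi) \<circ> real_of_ereal) \<longlongrightarrow> p) (at_right a)"
    and B: "(((\<lambda>x. arccos (1 / x) / pi) \<circ> real_of_ereal) \<longlongrightarrow> q) (at_left b)"
  shows "emeasure (density lborel (\<lambda>x. ennreal (exit_density x))) (einterval a b) = ennreal (q - p)"
proof -
  note FTC = interval_integral_FTC_nonneg[OF ab, of "\<lambda>x. arccos (1 / x) / pi" exit_density p q]
  have 1: "set_integrable lborel (einterval a b) exit_density"
    by (rule FTC(1)) (use DERIV_arccos_inverse isCont_exit_density out A B in auto)
  have 2: "(LBINT x=a..b. exit_density x) = q - p"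
    by (rule FTC(2)) (use DERIV_arccos_inverse isCont_exit_density out A B in auto)
  have "emeasure (density lborel (\<lambda>x. ennreal (exit_density x))) (einterval a b) =
      (\<integral>\<^sup>+x. ennreal (exit_density x) * indicator (einterval a b) x \<partial>lborel)"
    by (subst emeasure_density) auto
  also have "\<dots> = (\<integral>\<^sup>+x. ennreal (indicator (einterval a b) x *\<^sub>R exit_density x) \<partial>lborel)"
    by (intro nn_integral_cong) (auto simp: indicator_def)
  also have "\<dots> = ennreal (LINT x:einterval a b|lborel. exit_density x)"
    unfolding set_lebesgue_integral_def
    by (rule nn_integral_eq_integral) (use 1 in \<open>auto simp: set_integrable_def\<close>)
  also have "(LINT x:einterval a b|lborel. exit_density x) = q - p"
    using 2 less_imp_le[OF ab] by (simp add: interval_lebesgue_integral_def)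
  finally show ?thesis .
qed

lemma arccos_inverse_tendsto:
  assumes "1 \<le> \<bar>c\<bar>"
  shows "continuous (at c within {x. 1 \<le> \<bar>x\<bar>}) (\<lambda>x. arccos (1 / x) / pi)"
proof -
  have "continuous_on {x::real. 1 \<le> \<bar>x\<bar>} (\<lambda>x. arccos (1 / x) / pi)"
    by (intro continuous_intros) (auto simp: field_simps abs_if split: if_splits)
  with assms show ?thesis by (simp add: continuous_on_eq_continuous_within)
qed

lemma arccos_inverse_at_left:
  assumes c: "1 < c \<or> c \<le> -1"
  shows "((\<lambda>x. arccos (1 / x) / pi) \<longlongrightarrow> arccos (1 / c) / pi) (at_left c)"
proof -
  have "((\<lambda>x. arccos (1 / x) / pi) \<longlongrightarrow> arccos (1 / c) / pi) (at c within {x. 1 \<le> \<bar>x\<bar>})"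
  proof -
    have "1 \<le> \<bar>c\<bar>" using c by auto
    from arccos_inverse_tendsto[OF this] show ?thesis by (simp add: continuous_within)
  qed
  moreover have "at_left c \<le> at c within {x. 1 \<le> \<bar>x\<bar>}"
  proof (cases "1 < c")
    case True
    have "c \<in> interior {x. 1 \<le> \<bar>x\<bar>}"
      by (rule interiorI[of "{1<..}"]) (use True in auto)
    then have "at c within {x. 1 \<le> \<bar>x\<bar>} = at c" by (rule at_within_interior)
    then show ?thesis by (simp add: at_le)
  next
    case False
    then show ?thesis using c by (intro at_le) auto
  qed
  ultimately show ?thesis by (rule tendsto_mono[rotated])
qed

lemma exit_density_left:
  assumes c: "c \<le> -1"
  shows "emeasure (density lborel (\<lambda>x. ennreal (exit_density x))) {..<c} = ennreal (arccos (1 / c) / pi - 1 / 2)"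
proof -
  have "emeasure (density lborel (\<lambda>x. ennreal (exit_density x))) (einterval (-\<infinity>) (ereal c)) = ennreal (arccos (1 / c) / pi - 1 / 2)"
  proof (rule emeasure_exit_density_aux)
    show "1 < \<bar>x\<bar>" if "- \<infinity> < ereal x" "ereal x < ereal c" for x using that c by simp
    have "((\<lambda>x::real. 1 / x) \<longlongrightarrow> 0) at_bot"
      by real_asymp
    then have "((\<lambda>x::real. arccos (1 / x)) \<longlongrightarrow> arccos 0) at_bot"
      using isCont_tendsto_compose[OF isCont_arccos[of 0]] by simp
    then show "(((\<lambda>x. arccos (1 / x) / pi) \<circ> real_of_ereal) \<longlongrightarrow> 1 / 2) (at_right (- \<infinity>))"
      by (auto simp: ereal_tendsto_simps intro!: tendsto_eq_intros)
    show "(((\<lambda>x. arccos (1 / x) / pi) \<circ> real_of_ereal) \<longlongrightarrow> arccos (1 / c) / pi) (at_left (ereal c))"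
      unfolding ereal_tendsto_simps using arccos_inverse_at_left c by blast
  qed simp
  moreover have "einterval (-\<infinity>) (ereal c) = {..<c}" by (auto simp: einterval_def)
  ultimately show ?thesis by simp
qed

lemma arccos_inverse_at_right_1: "((\<lambda>x. arccos (1 / x) / pi) \<longlongrightarrow> 0) (at_right 1)"
proof -
  have "((\<lambda>x. arccos (1 / x) / pi) \<longlongrightarrow> arccos (1 / 1) / pi) (at 1 within {x. 1 \<le> \<bar>x\<bar>})"
    using arccos_inverse_tendsto[of 1] by (simp add: continuous_within)
  moreover have "at_right (1::real) \<le> at 1 within {x. 1 \<le> \<bar>x\<bar>}" by (intro at_le) auto
  ultimately have "((\<lambda>x. arccos (1 / x) / pi) \<longlongrightarrow> arccos (1 / 1) / pi) (at_right 1)" by (rule tendsto_mono[rotated])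
  then show ?thesis by simp
qed

lemma exit_density_right:
  assumes c: "1 < c"
  shows "emeasure (density lborel (\<lambda>x. ennreal (exit_density x))) {1<..<c} = ennreal (arccos (1 / c) / pi)"
proof -
  have "emeasure (density lborel (\<lambda>x. ennreal (exit_density x))) (einterval (ereal 1) (ereal c)) = ennreal (arccos (1 / c) / pi - 0)"
    by (rule emeasure_exit_density_aux)
       (use c arccos_inverse_at_left[of c] arccos_inverse_at_right_1 in \<open>auto simp: ereal_tendsto_simps\<close>)
  then show ?thesis by simp
qed

lemma exit_density_right_all:
  shows "emeasure (density lborel (\<lambda>x. ennreal (exit_density x))) {1<..} = ennreal (1 / 2)"
proof -
  have "((\<lambda>x::real. 1 / x) \<longlongrightarrow> 0) at_top"
    by real_asymp
  then have "((\<lambda>x::real. arccos (1 / x)) \<longlongrightarrow> arccos 0) at_top"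
    using isCont_tendsto_compose[OF isCont_arccos[of 0]] by simp
  then have "(((\<lambda>x. arccos (1 / x) / pi) \<circ> real_of_ereal) \<longlongrightarrow> 1 / 2) (at_left \<infinity>)"
    by (auto simp: ereal_tendsto_simps intro!: tendsto_eq_intros)
  then have "emeasure (density lborel (\<lambda>x. ennreal (exit_density x))) (einterval (ereal 1) \<infinity>) = ennreal (1 / 2 - 0)"
    by (intro emeasure_exit_density_aux)
       (use arccos_inverse_at_right_1 in \<open>auto simp: ereal_tendsto_simps\<close>)
  moreover have "einterval (ereal 1) \<infinity> = {1<..}" by (auto simp: einterval_def)
  ultimately show ?thesis by simp
qed

lemma AE_exit_density: "AE x in density lborel (\<lambda>x. ennreal (exit_density x)). 1 < \<bar>x\<bar> \<and> x \<noteq> c"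
proof -
  have "AE x in lborel. 0 < ennreal (exit_density x) \<longrightarrow> 1 < \<bar>x\<bar> \<and> x \<noteq> c"
    using AE_lborel_singleton[of c] by eventually_elim (auto simp: exit_density_def)
  then show ?thesis by (subst AE_density) auto
qed

lemma emeasure_exit_density:
  defines "K \<equiv> density lborel (\<lambda>x. ennreal (exit_density x))"
  shows "c \<le> -1 \<Longrightarrow> emeasure K {..c} = ennreal (arccos (1 / c) / pi - 1 / 2)"
    and "-1 \<le> c \<Longrightarrow> c \<le> 1 \<Longrightarrow> emeasure K {..c} = ennreal (1 / 2)"
    and "1 < c \<Longrightarrow> emeasure K {..c} = ennreal (1 / 2 + arccos (1 / c) / pi)"
    and "emeasure K UNIV = 1"
proof -
  have [measurable_cong, simp]: "sets K = sets borel" by (simp add: K_def)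
  have L: "emeasure K {..<-1} = ennreal (1 / 2)" using exit_density_left[of "-1"] by (simp add: K_def)
  \<comment> \<open>No mass lies in [-1, 1] or at a single point, so sets may be altered there; this
    reduces every half-line to the intervals computed above.\<close>
  have eq: "emeasure K A = emeasure K A'" if "A \<in> sets borel" "A' \<in> sets borel"
      "\<And>x. 1 < \<bar>x\<bar> \<Longrightarrow> x \<noteq> c \<Longrightarrow> x \<in> A \<longleftrightarrow> x \<in> A'" for A A' c
  proof (rule emeasure_eq_AE)
    have "AE x in K. 1 < \<bar>x\<bar> \<and> x \<noteq> c" unfolding K_def by (rule AE_exit_density)
    then show "AE x in K. (x \<in> A) = (x \<in> A')" by eventually_elim (use that(3) in auto)
  qed (use that in auto)
  show "emeasure K {..c} = ennreal (arccos (1 / c) / pi - 1 / 2)" if "c \<le> -1"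
  proof -
    have "emeasure K {..c} = emeasure K {..<c}" by (rule eq[of _ _ c]) auto
    then show ?thesis using exit_density_left[OF that] by (simp add: K_def)
  qed
  show "emeasure K {..c} = ennreal (1 / 2)" if "-1 \<le> c" "c \<le> 1"
  proof -
    have "emeasure K {..c} = emeasure K {..<-1}" by (rule eq[of _ _ c]) (use that in auto)
    then show ?thesis by (simp only: L)
  qed
  show "emeasure K {..c} = ennreal (1 / 2 + arccos (1 / c) / pi)" if "1 < c"
  proof -
    have "emeasure K {..c} = emeasure K ({..<-1} \<union> {1<..<c})"
      by (rule eq[of _ _ c]) (use that in auto)
    also have "\<dots> = emeasure K {..<-1} + emeasure K {1<..<c}"
      by (rule plus_emeasure[symmetric]) auto
    also have "\<dots> = ennreal (1 / 2) + ennreal (arccos (1 / c) / pi)"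
      unfolding L using exit_density_right[OF that] unfolding K_def by simp
    also have "\<dots> = ennreal (1 / 2 + arccos (1 / c) / pi)"
      by (rule ennreal_plus[symmetric]) (use that in \<open>auto intro!: divide_nonneg_nonneg arccos_lbound simp: field_simps\<close>)
    finally show ?thesis .
  qed
  have "emeasure K UNIV = emeasure K ({..<-1} \<union> {1<..})"
    by (rule eq[of _ _ 0]) auto
  also have "\<dots> = emeasure K {..<-1} + emeasure K {1<..}"
    by (rule plus_emeasure[symmetric]) auto
  also have "\<dots> = ennreal (1 / 2) + ennreal (1 / 2)"
    unfolding L using exit_density_right_all unfolding K_def by simp
  also have "\<dots> = 1" by (subst ennreal_plus[symmetric]) auto
  finally show "emeasure K UNIV = 1" .
qed

text \<open>The distribution functions are compared. Inversion is decreasing on each half-line, so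
  the event \<open>1 / V \<omega> \<le> c\<close> splits by the sign of \<open>V\<close> and becomes
  a combination of tail events.\<close>

lemma (in prob_space) distr_inverse_arcsine:
  fixes V :: "'a \<Rightarrow> real"
  assumes V[measurable]: "random_variable borel V" and V1: "AE \<omega> in M. \<bar>V \<omega>\<bar> \<le> 1"
    and tail: "\<And>v. -1 < v \<Longrightarrow> v < 1 \<Longrightarrow> prob {\<omega> \<in> space M. v < V \<omega>} = arccos v / pi"
  shows "distr M borel (\<lambda>\<omega>. 1 / V \<omega>) = density lborel (\<lambda>x. ennreal (exit_density x))"
proof -
  define K where "K = density lborel (\<lambda>x. ennreal (exit_density x))"
  have tail: "prob {\<omega> \<in> space M. v < V \<omega>} = arccos v / pi" if "-1 < v" "v \<le> 1" for v
  proof (cases "v = 1")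
    case True
    have "AE \<omega> in M. \<not> v < V \<omega>" using V1 by eventually_elim (auto simp: True)
    then have "prob {\<omega> \<in> space M. v < V \<omega>} = 0" by (subst prob_eq_0) auto
    then show ?thesis by (simp add: True)
  qed (use tail that in auto)
  \<comment> \<open>Squeezing between \<open>x < V \<omega>\<close> and
    \<open>v < V \<omega>\<close> as x rises to v rules out atoms, by continuity of arccos. This
    settles weak against strict inequalities and the default value \<open>1 / 0 = 0\<close>.\<close>
  have point: "prob {\<omega> \<in> space M. V \<omega> = v} = 0" if v: "-1 < v" "v \<le> 1" for v
  proof -
    have "((\<lambda>x. arccos x) \<longlongrightarrow> arccos v) (at v within {-1..1})"
      using continuous_on_arccos' v by (auto simp: continuous_on_def)
    then have "((\<lambda>x. arccos x) \<longlongrightarrow> arccos v) (at v within {-1<..<v})"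
      by (rule tendsto_mono[rotated]) (use v in \<open>auto intro: at_le\<close>)
    moreover have "at v within {-1<..<v} = at_left v"
      using at_within_nhd[of v "{-1<..}" "{..<v}" "{-1<..<v}"] v by (simp add: greaterThanLessThan_def Int_commute Int_left_commute)
    ultimately have "((\<lambda>x. (arccos x - arccos v) / pi) \<longlongrightarrow> (arccos v - arccos v) / pi) (at_left v)"
      by (intro tendsto_intros) auto
    moreover have "\<forall>\<^sub>F x in at_left v. prob {\<omega> \<in> space M. V \<omega> = v} \<le> (arccos x - arccos v) / pi"
      unfolding eventually_at_left[OF v(1)]
    proof (intro exI[of _ "-1"] conjI allI impI v)
      fix x assume x: "-1 < x" "x < v"
      have "prob {\<omega> \<in> space M. V \<omega> = v} \<le> prob ({\<omega> \<in> space M. x < V \<omega>} - {\<omega> \<in> space M. v < V \<omega>})"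
        by (rule finite_measure_mono) (use x in auto)
      also have "\<dots> = prob {\<omega> \<in> space M. x < V \<omega>} - prob {\<omega> \<in> space M. v < V \<omega>}"
        by (rule finite_measure_Diff) (use x in auto)
      also have "\<dots> = (arccos x - arccos v) / pi"
        using tail[of x] tail[of v] x v by (simp add: diff_divide_distrib)
      finally show "prob {\<omega> \<in> space M. V \<omega> = v} \<le> (arccos x - arccos v) / pi" .
    qed
    ultimately have "prob {\<omega> \<in> space M. V \<omega> = v} \<le> (arccos v - arccos v) / pi"
      by (intro tendsto_lowerbound) auto
    then show ?thesis using measure_nonneg[of M "{\<omega> \<in> space M. V \<omega> = v}"] by simp
  qed
  have nV: "AE \<omega> in M. V \<omega> \<noteq> v" if "-1 < v" "v \<le> 1" for v
    using point[OF that] by (subst (asm) prob_eq_0) auto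
  have low: "prob {\<omega> \<in> space M. V \<omega> < v} = 1 - arccos v / pi" if v: "-1 < v" "v \<le> 1" for v
  proof -
    have "prob {\<omega> \<in> space M. V \<omega> < v} = prob (space M - {\<omega> \<in> space M. v < V \<omega>})"
      by (rule finite_measure_eq_AE) (use nV[OF v] in \<open>auto elim!: eventually_mono\<close>)
    also have "\<dots> = 1 - arccos v / pi" using tail[OF v] by (subst prob_compl) auto
    finally show ?thesis .
  qed
  have neg: "prob {\<omega> \<in> space M. V \<omega> < 0} = 1 / 2" using low[of 0] by simp
  have "emeasure K (space K) \<noteq> \<infinity>" using emeasure_exit_density(4) by (simp add: K_def)
  then interpret K: finite_borel_measure K
    by (intro finite_borel_measure.intro finite_measureI finite_borel_measure_axioms.intro) (simp_all add: K_def)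
  have "prob_space (distr M borel (\<lambda>\<omega>. 1 / V \<omega>))" by (rule prob_space_distr) simp
  then interpret D: real_distribution "distr M borel (\<lambda>\<omega>. 1 / V \<omega>)"
    by (simp add: real_distribution_def real_distribution_axioms_def)
  have "cdf (distr M borel (\<lambda>\<omega>. 1 / V \<omega>)) c = cdf K c" for c
  proof -
    have X: "cdf (distr M borel (\<lambda>\<omega>. 1 / V \<omega>)) c = prob {\<omega> \<in> space M. 1 / V \<omega> \<le> c}"
      unfolding cdf_def by (subst measure_distr) (auto intro!: arg_cong[where f=prob])
    have ac: "\<bar>u\<bar> \<le> 1 \<Longrightarrow> 0 \<le> arccos u / pi" for u by (auto intro!: divide_nonneg_nonneg arccos_lbound)
    consider "c < -1" | "-1 \<le> c" "c \<le> 1" | "1 < c" by linarith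
    then show ?thesis
    proof cases
      case 1
      then have ic: "-1 < 1 / c" "1 / c < 0" by (auto simp: field_simps)
      have "prob {\<omega> \<in> space M. 1 / V \<omega> \<le> c} = prob ({\<omega> \<in> space M. V \<omega> < 0} - {\<omega> \<in> space M. V \<omega> < 1 / c})"
      proof (rule arg_cong[where f=prob], intro equalityI subsetI)
        fix \<omega> assume "\<omega> \<in> {\<omega> \<in> space M. 1 / V \<omega> \<le> c}"
        then have *: "\<omega> \<in> space M" "1 / V \<omega> \<le> c" by auto
        then have "1 / V \<omega> < 0" using 1 by linarith
        then have "V \<omega> < 0" by simp
        with *(2) 1 have "1 / c \<le> V \<omega>" by (simp add: field_simps)
        with * \<open>V \<omega> < 0\<close> show "\<omega> \<in> {\<omega> \<in> space M. V \<omega> < 0} - {\<omega> \<in> space M. V \<omega> < 1 / c}" by auto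
      next
        fix \<omega> assume "\<omega> \<in> {\<omega> \<in> space M. V \<omega> < 0} - {\<omega> \<in> space M. V \<omega> < 1 / c}"
        then have "\<omega> \<in> space M" "V \<omega> < 0" "1 / c \<le> V \<omega>" by auto
        with 1 show "\<omega> \<in> {\<omega> \<in> space M. 1 / V \<omega> \<le> c}" by (auto simp: field_simps)
      qed
      also have "\<dots> = prob {\<omega> \<in> space M. V \<omega> < 0} - prob {\<omega> \<in> space M. V \<omega> < 1 / c}"
        by (rule finite_measure_Diff) (auto dest: less_trans[OF _ ic(2)])
      also have "\<dots> = arccos (1 / c) / pi - 1 / 2" using low[of "1 / c"] neg ic by simp
      finally have "cdf (distr M borel (\<lambda>\<omega>. 1 / V \<omega>)) c = arccos (1 / c) / pi - 1 / 2" using X by simp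
      moreover from this have "0 \<le> arccos (1 / c) / pi - 1 / 2" using D.cdf_nonneg[of c] by simp
      moreover have "emeasure K {..c} = ennreal (arccos (1 / c) / pi - 1 / 2)"
        using emeasure_exit_density(1)[of c] 1 by (simp add: K_def)
      ultimately show ?thesis by (simp add: cdf_def measure_def)
    next
      case 2
      have "prob {\<omega> \<in> space M. 1 / V \<omega> \<le> c} = prob {\<omega> \<in> space M. V \<omega> < 0}"
      proof (rule finite_measure_eq_AE)
        show "AE \<omega> in M. (\<omega> \<in> {\<omega> \<in> space M. 1 / V \<omega> \<le> c}) = (\<omega> \<in> {\<omega> \<in> space M. V \<omega> < 0})"
          using V1 nV[of 0, simplified] nV[of 1, simplified]
        proof eventually_elim
          case (elim \<omega>)
          show ?case
          proof (cases "V \<omega> < 0")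
            case True
            then have "1 / V \<omega> \<le> -1" using elim by (simp add: field_simps)
            then show ?thesis using True 2 by auto
          next
            case False
            then have "1 < 1 / V \<omega>" using elim by (simp add: field_simps)
            then show ?thesis using False 2 by auto
          qed
        qed
      qed auto
      then have "cdf (distr M borel (\<lambda>\<omega>. 1 / V \<omega>)) c = 1 / 2" using X neg by simp
      moreover have "cdf K c = 1 / 2"
        unfolding cdf_def measure_def K_def emeasure_exit_density(2)[OF 2] by (rule enn2real_ennreal) simp
      ultimately show ?thesis by simp
    next
      case 3
      then have ic: "0 < 1 / c" "1 / c < 1" by (auto simp: field_simps)
      have "prob {\<omega> \<in> space M. 1 / V \<omega> \<le> c} = prob ({\<omega> \<in> space M. V \<omega> < 0} \<union> {\<omega> \<in> space M. 1 / c < V \<omega>})"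
      proof (rule finite_measure_eq_AE)
        show "AE \<omega> in M. (\<omega> \<in> {\<omega> \<in> space M. 1 / V \<omega> \<le> c}) = (\<omega> \<in> {\<omega> \<in> space M. V \<omega> < 0} \<union> {\<omega> \<in> space M. 1 / c < V \<omega>})"
          using nV[of "1 / c", OF less_trans[OF _ ic(1)] less_imp_le[OF ic(2)], simplified] nV[of 0, simplified]
        proof eventually_elim
          case (elim \<omega>)
          show ?case
          proof (cases "V \<omega> < 0")
            case True
            then have "1 / V \<omega> < 0" by simp
            then have "1 / V \<omega> \<le> c" using 3 by linarith
            then show ?thesis using True by auto
          next
            case False
            with elim have "0 < V \<omega>" by simp
            then have "1 / V \<omega> \<le> c \<longleftrightarrow> 1 / c \<le> V \<omega>" using 3 by (simp add: field_simps)
            then show ?thesis using False elim by auto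
          qed
        qed
      qed auto
      also have "\<dots> = prob {\<omega> \<in> space M. V \<omega> < 0} + prob {\<omega> \<in> space M. 1 / c < V \<omega>}"
        by (rule finite_measure_Union) (auto dest: less_trans[OF ic(1)])
      also have "\<dots> = 1 / 2 + arccos (1 / c) / pi" using tail[of "1 / c"] neg ic by simp
      finally have "cdf (distr M borel (\<lambda>\<omega>. 1 / V \<omega>)) c = 1 / 2 + arccos (1 / c) / pi" using X by simp
      moreover have "0 \<le> 1 / 2 + arccos (1 / c) / pi" using ac[of "1 / c"] ic by simp
      moreover have "emeasure K {..c} = ennreal (1 / 2 + arccos (1 / c) / pi)"
        using emeasure_exit_density(3)[OF 3] by (simp add: K_def)
      ultimately show ?thesis by (simp add: cdf_def measure_def)
    qed
  qed
  then have "cdf (distr M borel (\<lambda>\<omega>. 1 / V \<omega>)) = cdf K" by (rule ext)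
  from cdf_unique'[OF D.finite_borel_measure_M K.finite_borel_measure_axioms this]
  show ?thesis by (simp add: K_def)
qed

section \<open>Folding the exit law onto the slit\<close>

lemma nn_integral_count_space_int:
  fixes f :: "int \<Rightarrow> ennreal"
  shows "(\<integral>\<^sup>+n. f n \<partial>count_space UNIV) = (\<Sum>i. f (int_decode i))"
  using nn_integral_bij_count_space[OF bij_int_decode, of f] nn_integral_count_space_nat[of "\<lambda>i. f (int_decode i)"]
  by simp

lemma nn_integral_count_space_int_swap:
  fixes g :: "int \<Rightarrow> real \<Rightarrow> ennreal"
  assumes [measurable]: "\<And>n. g n \<in> borel_measurable borel"
  shows "(\<integral>\<^sup>+n. (\<integral>\<^sup>+x. g n x \<partial>lborel) \<partial>count_space UNIV) = (\<integral>\<^sup>+x. (\<integral>\<^sup>+n. g n x \<partial>count_space UNIV) \<partial>lborel)"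
  unfolding nn_integral_count_space_int by (rule nn_integral_suminf[symmetric]) simp

text \<open>Each real number lies in exactly one translate of [-1, 1) by an even integer; sum and
  integral of nonnegative functions are exchanged by monotone convergence.\<close>

lemma nn_integral_unfold_period:
  fixes f :: "real \<Rightarrow> ennreal"
  assumes [measurable]: "f \<in> borel_measurable borel"
  shows "(\<integral>\<^sup>+x. f x \<partial>lborel) =
    (\<integral>\<^sup>+n. (\<integral>\<^sup>+u. f (u + 2 * real_of_int n) * indicator {-1..<1} u \<partial>lborel) \<partial>count_space UNIV)"
proof -
  have one: "(\<integral>\<^sup>+n. f x * indicator {-1..<1} (x - 2 * real_of_int n) \<partial>count_space UNIV) = f x" for x
  proof -
    let ?m = "\<lfloor>(x + 1) / 2\<rfloor>"
    have "x - 2 * real_of_int n \<in> {-1..<1} \<longleftrightarrow> n = ?m" for n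
      unfolding eq_commute[of n] floor_eq_iff by auto
    then have "(indicator {-1..<1} (x - 2 * real_of_int n) :: ennreal) = indicator {?m} n" for n
      by (auto simp: indicator_def)
    then show ?thesis by (simp add: nn_integral_cmult)
  qed
  have "(\<integral>\<^sup>+u. f (u + 2 * real_of_int n) * indicator {-1..<1} u \<partial>lborel) =
      (\<integral>\<^sup>+x. f x * indicator {-1..<1} (x - 2 * real_of_int n) \<partial>lborel)" for n :: int
    using nn_integral_real_affine[of "\<lambda>x. f x * indicator {-1..<1} (x - 2 * real_of_int n)" 1 "2 * real_of_int n"]
    by (simp add: add.commute)
  then have "(\<integral>\<^sup>+n. (\<integral>\<^sup>+u. f (u + 2 * real_of_int n) * indicator {-1..<1} u \<partial>lborel) \<partial>count_space UNIV) =
      (\<integral>\<^sup>+n. (\<integral>\<^sup>+x. f x * indicator {-1..<1} (x - 2 * real_of_int n) \<partial>lborel) \<partial>count_space UNIV)"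
    by simp
  also have "\<dots> = (\<integral>\<^sup>+x. (\<integral>\<^sup>+n. f x * indicator {-1..<1} (x - 2 * real_of_int n) \<partial>count_space UNIV) \<partial>lborel)"
    by (rule nn_integral_count_space_int_swap) measurable
  finally show ?thesis by (simp add: one)
qed

text \<open>For |n| at least 2 the modulus of u + 2 n is at least |n| + 1, which bounds both factors
  of the denominator below by |n|. The comparison is with 1 / n^2, and three indices remain.\<close>

lemma abs_summable_exit_density:
  assumes "\<bar>u\<bar> < 1"
  shows "Infinite_Set_Sum.abs_summable_on (\<lambda>n. exit_density (u + 2 * of_int n)) ((UNIV :: int set))"
proof -
  have inv: "Infinite_Set_Sum.abs_summable_on (\<lambda>n. 1 / (real_of_int n)\<^sup>2) ((UNIV :: int set))"
  proof -
    have nat: "Infinite_Set_Sum.abs_summable_on (\<lambda>n. 1 / (real n)\<^sup>2) (UNIV)"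
      using inverse_power_summable[of 2, where 'a=real] by (simp add: abs_summable_on_nat_iff' field_simps)
    have "Infinite_Set_Sum.abs_summable_on (\<lambda>n. 1 / (real_of_int n)\<^sup>2) (range int)"
      using nat by (subst abs_summable_on_reindex_iff[symmetric]) auto
    moreover have "Infinite_Set_Sum.abs_summable_on (\<lambda>n. 1 / (real_of_int n)\<^sup>2) (range (\<lambda>n. - int n))"
      using nat by (subst abs_summable_on_reindex_iff[symmetric]) (auto simp: inj_def)
    ultimately have "Infinite_Set_Sum.abs_summable_on (\<lambda>n. 1 / (real_of_int n)\<^sup>2) (range int \<union> range (\<lambda>n. - int n))"
      by (rule abs_summable_on_union)
    moreover have "range int \<union> range (\<lambda>n. - int n) = UNIV"
      by (auto simp: image_iff) (metis int_cases2)
    ultimately show ?thesis by simp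
  qed
  have "Infinite_Set_Sum.abs_summable_on (\<lambda>n. exit_density (u + 2 * of_int n)) ({n::int. 2 \<le> \<bar>n\<bar>})"
  proof (rule abs_summable_on_comparison_test'[OF abs_summable_on_subset[OF inv]])
    fix n :: int assume "n \<in> {n. 2 \<le> \<bar>n\<bar>}"
    then have n: "2 \<le> \<bar>real_of_int n\<bar>" by simp
    let ?x = "u + 2 * real_of_int n"
    have x: "\<bar>real_of_int n\<bar> + 1 \<le> \<bar>?x\<bar>" using n assms by linarith
    then have x1: "1 < \<bar>?x\<bar>" using n by linarith
    have "(\<bar>real_of_int n\<bar> + 1)\<^sup>2 \<le> \<bar>?x\<bar>\<^sup>2" using x by (intro power_mono) auto
    moreover have "(\<bar>real_of_int n\<bar> + 1)\<^sup>2 = \<bar>real_of_int n\<bar>\<^sup>2 + 2 * \<bar>real_of_int n\<bar> + 1"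
      by (simp add: power2_eq_square algebra_simps)
    ultimately have "\<bar>real_of_int n\<bar>\<^sup>2 \<le> ?x\<^sup>2 - 1" by (simp add: power2_abs)
    then have s: "\<bar>real_of_int n\<bar> \<le> sqrt (?x\<^sup>2 - 1)" by (rule real_le_rsqrt)
    have "1 * (\<bar>real_of_int n\<bar> * \<bar>real_of_int n\<bar>) \<le> pi * (\<bar>?x\<bar> * sqrt (?x\<^sup>2 - 1))"
      using x s pi_ge_two by (intro mult_mono) auto
    moreover have "0 < \<bar>real_of_int n\<bar> * \<bar>real_of_int n\<bar>" using n by (intro mult_pos_pos) linarith+
    ultimately have "1 / (pi * (\<bar>?x\<bar> * sqrt (?x\<^sup>2 - 1))) \<le> 1 / (\<bar>real_of_int n\<bar> * \<bar>real_of_int n\<bar>)"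
      by (intro frac_le) simp_all
    then show "norm (exit_density (u + 2 * of_int n)) \<le> 1 / (real_of_int n)\<^sup>2"
      using x1 exit_density_nonneg[of ?x] by (simp add: exit_density_def power2_eq_square)
  qed simp
  moreover have "Infinite_Set_Sum.abs_summable_on (\<lambda>n. exit_density (u + 2 * of_int n)) ({-1, 0, 1::int})"
    by (rule abs_summable_on_finite) simp
  ultimately have "Infinite_Set_Sum.abs_summable_on (\<lambda>n. exit_density (u + 2 * of_int n)) ({n::int. 2 \<le> \<bar>n\<bar>} \<union> {-1, 0, 1})"
    by (rule abs_summable_on_union)
  moreover have "{n::int. 2 \<le> \<bar>n\<bar>} \<union> {-1, 0, 1} = UNIV" by (auto simp: abs_if)
  ultimately show ?thesis by (simp only:)
qed

text \<open>The series in \<open>rho\<close> is pi times the sum of the exit density over the points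
  u + 2 n; the index 0 may be added because |u| < 1 lies off the support. The form as a nonnegative
  integral is the one that can be exchanged with Lebesgue measure.\<close>

lemma rho_eq:
  assumes w: "\<bar>w\<bar> < 1"
  defines "u \<equiv> 2 / pi * arcsin w"
  shows "ennreal (rho w) = ennreal (2 / (pi * sqrt (1 - w\<^sup>2))) * (\<integral>\<^sup>+n. exit_density (u + 2 * real_of_int n) \<partial>count_space (UNIV :: int set))"
    and "\<bar>u\<bar> < 1" and "0 \<le> rho w"
proof -
  have "\<bar>arcsin w\<bar> < pi / 2" using arcsin_lt_bounded[of w] w by (auto simp: abs_less_iff)
  then show u: "\<bar>u\<bar> < 1" by (simp add: u_def abs_mult field_simps)
  note s = abs_summable_exit_density[OF u]
  define g where "g n = exit_density (u + 2 * real_of_int n)" for n :: int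
  have g0: "g 0 = 0" using u by (simp add: g_def exit_density_def)
  have gn: "1 / (\<bar>u + 2 * of_int n\<bar> * sqrt ((u + 2 * of_int n)\<^sup>2 - 1)) = pi * g n" if "n \<noteq> 0" for n :: int
  proof -
    have "1 \<le> \<bar>real_of_int n\<bar>" using that by linarith
    then have "1 < \<bar>u + 2 * of_int n\<bar>" using u by linarith
    then show ?thesis by (simp add: g_def exit_density_def)
  qed
  have "(\<integral>\<^sup>+n. ennreal (g n) \<partial>count_space UNIV) = ennreal (infsetsum g UNIV)"
    by (rule nn_integral_conv_infsetsum) (use s in \<open>auto simp: g_def[abs_def]\<close>)
  also have "infsetsum g UNIV = infsum g UNIV"
    by (rule infsetsum_infsum) (use s in \<open>simp add: g_def[abs_def]\<close>)
  finally have 1: "(\<integral>\<^sup>+n. ennreal (g n) \<partial>count_space UNIV) = ennreal (infsum g UNIV)" .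
  have "infsum g UNIV = infsum g (UNIV - {0})"
    by (rule infsum_cong_neutral) (auto simp: g0)
  moreover have "(\<Sum>\<^sub>\<infinity>n\<in>UNIV - {0::int}. 1 / (\<bar>u + 2 * of_int n\<bar> * sqrt ((u + 2 * of_int n)\<^sup>2 - 1))) = (\<Sum>\<^sub>\<infinity>n\<in>UNIV - {0}. pi * g n)"
    by (rule infsum_cong) (use gn in auto)
  ultimately have r: "rho w = 2 / (pi * sqrt (1 - w\<^sup>2)) * infsum g UNIV"
    unfolding rho_def u_def[symmetric] by (simp add: infsum_cmult_right' power2_eq_square)
  have i0: "0 \<le> infsum g UNIV" by (rule infsum_nonneg) (simp add: g_def)
  have "w\<^sup>2 < 1" using w by (simp add: abs_square_less_1)
  then have c0: "0 \<le> 2 / (pi * sqrt (1 - w\<^sup>2))" by simp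
  show "0 \<le> rho w" unfolding r using i0 c0 by (rule mult_nonneg_nonneg[rotated])
  show "ennreal (rho w) = ennreal (2 / (pi * sqrt (1 - w\<^sup>2))) * (\<integral>\<^sup>+n. exit_density (u + 2 * real_of_int n) \<partial>count_space (UNIV :: int set))"
    unfolding r g_def[symmetric] 1 by (rule ennreal_mult[OF c0 i0])
qed

text \<open>Clamping the argument of arcsine gives a function that is measurable on the whole line
  and agrees with \<open>rho\<close> on (-1, 1); the sum is measurable as a nonnegative series
  enumerated by \<open>int_decode\<close>.\<close>

lemma borel_measurable_rho: "(\<lambda>w. indicator {-1<..<1} w * rho w) \<in> borel_measurable borel"
proof -
  define f where "f w = indicator {-1<..<1} w * (ennreal (2 / (pi * sqrt (1 - w\<^sup>2))) *
    (\<integral>\<^sup>+n. exit_density (2 / pi * arcsin (max (-1) (min 1 w)) + 2 * real_of_int n) \<partial>count_space (UNIV :: int set)))" for w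
  have [measurable]: "(\<lambda>w::real. arcsin (max (-1) (min 1 w))) \<in> borel_measurable borel"
    by (intro borel_measurable_continuous_onI continuous_on_arcsin continuous_intros) auto
  have "f \<in> borel_measurable borel"
    unfolding f_def nn_integral_count_space_int by measurable
  then have "(\<lambda>w. enn2real (f w)) \<in> borel_measurable borel" by simp
  moreover have "enn2real (f w) = indicator {-1<..<1} w * rho w" for w
  proof (cases "\<bar>w\<bar> < 1")
    case True
    then have "max (-1) (min 1 w) = w" by auto
    then have "f w = ennreal (rho w)" using True rho_eq(1)[OF True] by (simp add: f_def abs_less_iff)
    then show ?thesis using True rho_eq(3)[OF True] by (simp add: abs_less_iff)
  next
    case False
    then show ?thesis by (auto simp: f_def indicator_def)
  qed
  ultimately show ?thesis by simp
qed

lemma sin_shift: "sin (pi / 2 * (u + 2 * real_of_int n)) = (if even n then sin (pi / 2 * u) else - sin (pi / 2 * u))"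
proof -
  have e: "pi / 2 * (u + 2 * real_of_int n) = pi / 2 * u + pi * real_of_int n" by (simp add: algebra_simps)
  show ?thesis unfolding e sin_add by (simp add: cos_npi_int sin_npi_int)
qed

text \<open>On the cell around 2 n the sine equals \<plusminus>sin (pi u / 2). For odd n the
  reflection of u restores the sign, and evenness of the exit density turns the cell n into the cell
  -n. After this reindexing by \<sigma> all cells share the substitution w = sin (pi u / 2).\<close>

lemma nn_integral_exit_density:
  assumes A[measurable]: "A \<in> sets borel"
  shows "(\<integral>\<^sup>+x. indicator A (sin (pi / 2 * x)) * ennreal (exit_density x) \<partial>lborel) =
    (\<integral>\<^sup>+w. indicator A w * ennreal (indicator {-1<..<1} w * rho w) \<partial>lborel)"
proof -
  define T where "T n = (\<integral>\<^sup>+u. indicator A (sin (pi / 2 * u)) * ennreal (exit_density (u + 2 * real_of_int n)) * indicator {-1<..<1} u \<partial>lborel)" for n :: int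
  define \<sigma> where "\<sigma> n = (if even n then n else - n)" for n :: int
  have ne: "AE u in lborel. u \<noteq> (-1::real)" by (rule AE_lborel_singleton)
  have T: "(\<integral>\<^sup>+u. indicator A (sin (pi / 2 * (u + 2 * real_of_int n))) * ennreal (exit_density (u + 2 * real_of_int n)) * indicator {-1..<1} u \<partial>lborel) = T (\<sigma> n)" for n
  proof (cases "even n")
    case True
    then show ?thesis unfolding T_def \<sigma>_def sin_shift
      by (intro nn_integral_cong_AE) (use ne in eventually_elim, auto simp: indicator_def)
  next
    case False
    have "(\<integral>\<^sup>+u. indicator A (sin (pi / 2 * (u + 2 * real_of_int n))) * ennreal (exit_density (u + 2 * real_of_int n)) * indicator {-1..<1} u \<partial>lborel) =
       (\<integral>\<^sup>+u. indicator A (- sin (pi / 2 * u)) * ennreal (exit_density (u + 2 * real_of_int n)) * indicator {-1<..<1} u \<partial>lborel)"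
      unfolding sin_shift using False
      by (intro nn_integral_cong_AE) (use ne in eventually_elim, auto simp: indicator_def)
    also have "\<dots> = (\<integral>\<^sup>+u. indicator A (sin (pi / 2 * u)) * ennreal (exit_density (- u + 2 * real_of_int n)) * indicator {-1<..<1} (- u) \<partial>lborel)"
      by (subst nn_integral_real_affine[where c="-1" and t=0]) auto
    also have "\<dots> = T (- n)"
      unfolding T_def
    proof (rule nn_integral_cong)
      fix u :: real
      have "exit_density (- u + 2 * real_of_int n) = exit_density (u + 2 * real_of_int (- n))"
        using exit_density_minus[of "- u + 2 * real_of_int n"] by simp
      then show "indicator A (sin (pi / 2 * u)) * ennreal (exit_density (- u + 2 * real_of_int n)) * indicator {- 1<..<1} (- u) =
         indicator A (sin (pi / 2 * u)) * ennreal (exit_density (u + 2 * real_of_int (- n))) * indicator {- 1<..<1} u"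
        by (auto simp: indicator_def)
    qed
    finally show ?thesis using False by (simp add: \<sigma>_def)
  qed
  have bij: "bij \<sigma>" by (rule o_bij[of \<sigma>]) (auto simp: \<sigma>_def fun_eq_iff)
  have "(\<integral>\<^sup>+x. indicator A (sin (pi / 2 * x)) * ennreal (exit_density x) \<partial>lborel) = (\<integral>\<^sup>+n. T (\<sigma> n) \<partial>count_space UNIV)"
    unfolding T[symmetric] by (rule nn_integral_unfold_period) measurable
  also have "\<dots> = (\<integral>\<^sup>+n. T n \<partial>count_space UNIV)"
    by (rule nn_integral_bij_count_space[OF bij])
  also have "\<dots> = (\<integral>\<^sup>+u. (\<integral>\<^sup>+n. indicator A (sin (pi / 2 * u)) * ennreal (exit_density (u + 2 * real_of_int n)) * indicator {-1<..<1} u \<partial>count_space UNIV) \<partial>lborel)"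
    unfolding T_def by (rule nn_integral_count_space_int_swap) measurable
  also have "\<dots> = (\<integral>\<^sup>+u. ennreal ((indicator A (sin (pi / 2 * u)) * (indicator {-1<..<1} (sin (pi / 2 * u)) * rho (sin (pi / 2 * u)))) * (pi / 2 * cos (pi / 2 * u)) * indicator {-1..1} u) \<partial>lborel)"
  proof (rule nn_integral_cong_AE)
    have "AE u in lborel. u \<noteq> (1::real)" by (rule AE_lborel_singleton)
    with ne show "AE u in lborel. (\<integral>\<^sup>+n. indicator A (sin (pi / 2 * u)) * ennreal (exit_density (u + 2 * real_of_int n)) * indicator {-1<..<1} u \<partial>count_space UNIV) =
       ennreal ((indicator A (sin (pi / 2 * u)) * (indicator {-1<..<1} (sin (pi / 2 * u)) * rho (sin (pi / 2 * u)))) * (pi / 2 * cos (pi / 2 * u)) * indicator {-1..1} u)"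
    proof eventually_elim
      case (elim u)
      show ?case
      proof (cases "\<bar>u\<bar> < 1")
        case False
        then have "u \<notin> {-1..1}" "u \<notin> {-1<..<1}" using elim by (auto simp: abs_if split: if_splits)
        then show ?thesis by simp
      next
        case True
        let ?w = "sin (pi / 2 * u)"
        have au: "\<bar>pi / 2 * u\<bar> < pi / 2" using True by (simp add: abs_mult)
        then have c: "0 < cos (pi / 2 * u)" by (intro cos_gt_zero_pi) (auto simp: abs_less_iff)
        have sc: "1 - ?w\<^sup>2 = (cos (pi / 2 * u))\<^sup>2" by (simp add: cos_squared_eq)
        then have "?w\<^sup>2 < 1" using c by (smt (verit) zero_less_power)
        then have w: "\<bar>?w\<bar> < 1" by (simp add: abs_square_less_1)
        have asn: "arcsin ?w = pi / 2 * u" by (rule arcsin_sin) (use au in \<open>auto simp: abs_less_iff\<close>)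
        have u: "2 / pi * arcsin ?w = u" unfolding asn by simp
        have sq: "sqrt (1 - ?w\<^sup>2) = cos (pi / 2 * u)" unfolding sc using c by simp
        have "ennreal (rho ?w * (pi / 2 * cos (pi / 2 * u))) = ennreal (pi / 2 * cos (pi / 2 * u)) * ennreal (rho ?w)"
          by (subst mult.commute, rule ennreal_mult') (use c in simp)
        also have "\<dots> = ennreal (pi / 2 * cos (pi / 2 * u)) * ennreal (2 / (pi * cos (pi / 2 * u))) *
            (\<integral>\<^sup>+n. exit_density (u + 2 * real_of_int n) \<partial>count_space (UNIV :: int set))"
          unfolding rho_eq(1)[OF w] u sq by (simp add: mult.assoc)
        also have "ennreal (pi / 2 * cos (pi / 2 * u)) * ennreal (2 / (pi * cos (pi / 2 * u))) = 1"
          using c by (subst ennreal_mult'[symmetric]) auto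
        finally have "ennreal (rho ?w * (pi / 2 * cos (pi / 2 * u))) = (\<integral>\<^sup>+n. exit_density (u + 2 * real_of_int n) \<partial>count_space (UNIV :: int set))"
          by simp
        then show ?thesis
          using w True by (auto simp: abs_less_iff indicator_def)
      qed
    qed
  qed
  also have "\<dots> = (\<integral>\<^sup>+w. ennreal (indicator A w * (indicator {-1<..<1} w * rho w) * indicator {sin (pi / 2 * -1)..sin (pi / 2 * 1)} w) \<partial>lborel)"
  proof (rule nn_integral_substitution[symmetric, where g="\<lambda>u. sin (pi / 2 * u)" and g'="\<lambda>u. pi / 2 * cos (pi / 2 * u)" and a="-1" and b=1
      and f="\<lambda>w. indicator A w * (indicator {-1<..<1} w * rho w)"])
    show "set_borel_measurable borel {sin (pi / 2 * -1)..sin (pi / 2 * 1)} (\<lambda>w. indicator A w * (indicator {-1<..<1} w * rho w))"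
      unfolding set_borel_measurable_def using borel_measurable_rho by measurable
    show "((\<lambda>u. sin (pi / 2 * u)) has_real_derivative pi / 2 * cos (pi / 2 * u)) (at u)" for u
      by (rule derivative_eq_intros refl)+ simp
    show "0 \<le> pi / 2 * cos (pi / 2 * u)" if "u \<in> {-1..1}" for u
    proof -
      have "- (pi / 2) \<le> pi / 2 * u" "pi / 2 * u \<le> pi / 2" using that mult_left_mono[of "-1" u "pi / 2"] mult_left_mono[of u 1 "pi / 2"] by auto
      then show ?thesis using cos_ge_zero by simp
    qed
  qed (auto intro!: continuous_intros)
  also have "\<dots> = (\<integral>\<^sup>+w. indicator A w * ennreal (indicator {-1<..<1} w * rho w) \<partial>lborel)"
    by (intro nn_integral_cong) (auto simp: indicator_def)
  finally show ?thesis .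
qed

lemma (in prob_space) distributed_rho:
  fixes V :: "'a \<Rightarrow> real"
  assumes V[measurable]: "random_variable borel V" and V1: "AE \<omega> in M. \<bar>V \<omega>\<bar> \<le> 1"
    and tail: "\<And>v. -1 < v \<Longrightarrow> v < 1 \<Longrightarrow> prob {\<omega> \<in> space M. v < V \<omega>} = arccos v / pi"
  shows "distributed M lborel (\<lambda>\<omega>. sin (pi / 2 * (1 / V \<omega>))) (\<lambda>w. ennreal (indicator {-1<..<1} w * rho w))"
  unfolding distributed_def
proof (intro conjI)
  have [measurable]: "(\<lambda>w. indicator {-1<..<1} w * rho w) \<in> borel_measurable borel" by (rule borel_measurable_rho)
  show meas: "(\<lambda>w. ennreal (indicator {-1<..<1} w * rho w)) \<in> borel_measurable lborel" by simp
  show "(\<lambda>\<omega>. sin (pi / 2 * (1 / V \<omega>))) \<in> measurable M lborel" by simp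
  show "distr M lborel (\<lambda>\<omega>. sin (pi / 2 * (1 / V \<omega>))) = density lborel (\<lambda>w. ennreal (indicator {-1<..<1} w * rho w))"
  proof (rule measure_eqI)
    fix A assume "A \<in> sets (distr M lborel (\<lambda>\<omega>. sin (pi / 2 * (1 / V \<omega>))))"
    then have [measurable]: "A \<in> sets borel" by simp
    have "emeasure (distr M lborel (\<lambda>\<omega>. sin (pi / 2 * (1 / V \<omega>)))) A = (\<integral>\<^sup>+\<omega>. indicator A (sin (pi / 2 * (1 / V \<omega>))) \<partial>M)"
      by (subst nn_integral_indicator[symmetric], simp, subst nn_integral_distr) auto
    also have "\<dots> = (\<integral>\<^sup>+x. indicator A (sin (pi / 2 * x)) \<partial>distr M borel (\<lambda>\<omega>. 1 / V \<omega>))"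
      by (subst nn_integral_distr) auto
    also have "\<dots> = (\<integral>\<^sup>+x. ennreal (exit_density x) * indicator A (sin (pi / 2 * x)) \<partial>lborel)"
      by (subst distr_inverse_arcsine[OF assms], assumption+, subst nn_integral_density) auto
    also have "\<dots> = (\<integral>\<^sup>+w. indicator A w * ennreal (indicator {-1<..<1} w * rho w) \<partial>lborel)"
      using nn_integral_exit_density[of A] by (simp add: mult.commute)
    also have "\<dots> = (\<integral>\<^sup>+w. ennreal (indicator {-1<..<1} w * rho w) * indicator A w \<partial>lborel)"
      by (intro nn_integral_cong mult.commute)
    also have "\<dots> = emeasure (density lborel (\<lambda>w. ennreal (indicator {-1<..<1} w * rho w))) A"
      by (rule emeasure_density[OF meas, symmetric]) simp
    finally show "emeasure (distr M lborel (\<lambda>\<omega>. sin (pi / 2 * (1 / V \<omega>)))) A = emeasure (density lborel (\<lambda>w. ennreal (indicator {-1<..<1} w * rho w))) A" .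
  qed simp
qed

section \<open>Brownian motion\<close>

text \<open>Such a \<open>Z\<close> integrates holomorphic functions as harmonic measure from 0
  does. The bound holds at every sample point so that \<open>\<phi> (Z \<omega>)\<close> never
  leaves the domain of \<phi>; measurability refers to \<open>M\<close> itself, which the exit point
  as defined need not satisfy.\<close>

definition holomorphic_mean :: "'a measure \<Rightarrow> ('a \<Rightarrow> complex) \<Rightarrow> bool" where
  "holomorphic_mean M Z \<longleftrightarrow> Z \<in> borel_measurable M \<and> (\<forall>\<omega>. norm (Z \<omega>) \<le> 1) \<and>
    (\<forall>\<phi>. continuous_on (cball 0 1) \<phi> \<longrightarrow> \<phi> holomorphic_on ball 0 1 \<longrightarrow> (\<integral>\<omega>. \<phi> (Z \<omega>) \<partial>M) = \<phi> 0)"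

lemma holomorphic_meanD:
  assumes "holomorphic_mean M Z"
  shows "Z \<in> borel_measurable M" "norm (Z \<omega>) \<le> 1"
    "continuous_on (cball 0 1) \<phi> \<Longrightarrow> \<phi> holomorphic_on ball 0 1 \<Longrightarrow> (\<integral>\<omega>. \<phi> (Z \<omega>) \<partial>M) = \<phi> 0"
  using assms by (auto simp: holomorphic_mean_def)

lemma continuous_on_disc_extension:
  fixes \<phi> :: "complex \<Rightarrow> complex"
  assumes \<phi>: "continuous_on (cball 0 1) \<phi>"
  obtains f C where "f \<in> borel_measurable borel" "\<And>x. norm x \<le> 1 \<Longrightarrow> f x = \<phi> x" "\<And>x. norm x \<le> 1 \<Longrightarrow> norm (\<phi> x) \<le> C"
proof -
  have "(\<lambda>x. if x \<in> cball 0 1 then \<phi> x else 0) \<in> borel_measurable borel"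
    by (intro borel_measurable_continuous_on_if \<phi>) auto
  moreover have "bounded (\<phi> ` cball 0 1)" by (intro compact_imp_bounded compact_continuous_image \<phi>) auto
  then obtain C where "\<forall>y\<in>\<phi> ` cball 0 1. norm y \<le> C" unfolding bounded_iff by blast
  ultimately show thesis by (intro that[of "\<lambda>x. if x \<in> cball 0 1 then \<phi> x else 0" C]) auto
qed

text \<open>Dominated convergence. \<open>Y\<close> is a measurable version of the limit, set to 0
  where \<open>lim\<close> leaves the closed unit disc, because \<open>L\<close> is tied to the
  sequence only almost everywhere and may fail to be measurable.\<close>

lemma (in prob_space) holomorphic_mean_limit:
  assumes X: "\<And>n. holomorphic_mean M (X n)" and lim: "AE \<omega> in M. (\<lambda>n. X n \<omega>) \<longlonglongrightarrow> L \<omega>"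
  shows "\<exists>Y. holomorphic_mean M Y \<and> (AE \<omega> in M. Y \<omega> = L \<omega>)"
proof -
  note [measurable] = holomorphic_meanD(1)[OF X]
  note X1 = holomorphic_meanD(2)[OF X]
  define Y where "Y \<omega> = (if norm (lim (\<lambda>n. X n \<omega>)) \<le> 1 then lim (\<lambda>n. X n \<omega>) else 0)" for \<omega>
  have Ym[measurable]: "random_variable borel Y" unfolding Y_def by measurable
  have Y1: "norm (Y \<omega>) \<le> 1" for \<omega> by (simp add: Y_def)
  have YL: "AE \<omega> in M. Y \<omega> = L \<omega>"
    using lim
  proof eventually_elim
    case (elim \<omega>)
    have "norm (L \<omega>) \<le> 1"
      by (rule tendsto_upperbound[OF tendsto_norm[OF elim]]) (auto simp: X1)
    then show ?case using limI[OF elim] by (simp add: Y_def)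
  qed
  have "expectation (\<lambda>\<omega>. \<phi> (Y \<omega>)) = \<phi> 0"
    if \<phi>: "continuous_on (cball 0 1) \<phi>" "\<phi> holomorphic_on ball 0 1" for \<phi>
  proof -
    obtain f C where [measurable]: "f \<in> borel_measurable borel"
      and f: "\<And>x. norm x \<le> 1 \<Longrightarrow> f x = \<phi> x" and C: "\<And>x. norm x \<le> 1 \<Longrightarrow> norm (\<phi> x) \<le> C"
      by (rule continuous_on_disc_extension[OF \<phi>(1)]) blast
    have fX: "f (X n \<omega>) = \<phi> (X n \<omega>)" and fY: "f (Y \<omega>) = \<phi> (Y \<omega>)" for n \<omega> by (simp_all add: f X1 Y1)
    have "(\<lambda>n. expectation (\<lambda>\<omega>. f (X n \<omega>))) \<longlonglongrightarrow> expectation (\<lambda>\<omega>. f (Y \<omega>))"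
    proof (rule integral_dominated_convergence[where w="\<lambda>_. C"])
      show "AE \<omega> in M. (\<lambda>n. f (X n \<omega>)) \<longlonglongrightarrow> f (Y \<omega>)"
        using lim YL
      proof eventually_elim
        case (elim \<omega>)
        then have "(\<lambda>n. X n \<omega>) \<longlonglongrightarrow> Y \<omega>" by simp
        then show ?case unfolding fX fY
          by (rule continuous_on_tendsto_compose[OF \<phi>(1)]) (auto simp: X1 Y1)
      qed
      show "AE \<omega> in M. norm (f (X n \<omega>)) \<le> C" for n using C X1 by (simp add: fX)
    qed auto
    then have "(\<lambda>n. \<phi> 0) \<longlonglongrightarrow> expectation (\<lambda>\<omega>. f (Y \<omega>))" by (simp add: fX holomorphic_meanD(3)[OF X \<phi>])
    then show ?thesis by (simp add: fY LIMSEQ_const_iff)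
  qed
  with Ym Y1 YL show ?thesis unfolding holomorphic_mean_def by blast
qed

context planar_brownian_motion
begin

lemma distr_rotate_increment:
  assumes "0 \<le> s" "s < t" "norm u = 1"
  shows "distr M borel (\<lambda>\<omega>. u * (B t \<omega> - B s \<omega>)) = distr M borel (\<lambda>\<omega>. B t \<omega> - B s \<omega>)"
proof (rule distr_rotate_complex_normal[OF _ indep_coordinates normal_Re normal_Im])
  have [measurable]: "random_variable borel (B s)" "random_variable borel (B t)"
    using random_variable assms by auto
  show "random_variable borel (\<lambda>\<omega>. B t \<omega> - B s \<omega>)" by measurable
qed (use assms in auto)

lemma holomorphic_mean_increment_chain:
  assumes G: "branch_step F \<rho> r G" and "\<rho> < 1" and h: "0 < h"
  shows "holomorphic_mean M (\<lambda>\<omega>. branch_chain G (\<lambda>i. B (real (Suc i) * h) \<omega> - B (real i * h) \<omega>) n)"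
proof -
  define X where "X i \<omega> = B (real (Suc i) * h) \<omega> - B (real i * h) \<omega>" for i \<omega>
  have Xm: "random_variable borel (X i)" for i
  proof -
    have [measurable]: "random_variable borel (B (real (Suc i) * h))" "random_variable borel (B (real i * h))"
      by (rule random_variable, use h in simp)+
    show ?thesis unfolding X_def by measurable
  qed
  have lt: "real i * h < real (Suc i) * h" for i using h by simp
  have ind: "indep_vars (\<lambda>_. borel) X {..<n}"
    using indep_increments[of "\<lambda>i. real i * h" n] h by (simp add: X_def[abs_def] mono_def mult_right_mono)
  have rot: "distr M borel (\<lambda>\<omega>. u * X i \<omega>) = distr M borel (X i)" if "norm u = 1" for u i
    unfolding X_def by (rule distr_rotate_increment[OF _ lt that]) (use h in simp)
  have "G \<in> borel_measurable borel" using G by (simp add: branch_step_def)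
  then have "(\<lambda>\<omega>. branch_chain G (\<lambda>i. X i \<omega>) n) \<in> borel_measurable M"
    by (rule measurable_branch_chain) (rule Xm)
  moreover have "expectation (\<lambda>\<omega>. \<phi> (branch_chain G (\<lambda>i. X i \<omega>) n)) = \<phi> 0"
    if "continuous_on (cball 0 1) \<phi>" "\<phi> holomorphic_on ball 0 1" for \<phi>
    by (rule expectation_branch_chain[OF G \<open>\<rho> < 1\<close> Xm ind rot that])
  ultimately have "holomorphic_mean M (\<lambda>\<omega>. branch_chain G (\<lambda>i. X i \<omega>) n)"
    using norm_branch_chain_less_1[OF G] by (simp add: holomorphic_mean_def less_imp_le)
  then show ?thesis by (simp add: X_def)
qed

text \<open>Two limits of bounded variables with the mean value property: refinement of the grid at
  a fixed freezing radius, then the radius tending to 1. Only countably many exceptional null sets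
  arise.\<close>

lemma stopped_lift_mean:
  assumes T: "0 < T"
  shows "\<exists>Z. holomorphic_mean M Z \<and> (AE \<omega> in M. Z \<omega> = stopped_lift disc_map (\<lambda>t. B t \<omega>) T)"
proof -
  \<comment> \<open>The 2 keeps the first radius positive.\<close>
  define \<rho> where "\<rho> j = 1 - 1 / (real j + 2)" for j
  have \<rho>: "0 < \<rho> j" "\<rho> j < 1" for j by (auto simp: \<rho>_def field_simps)
  have \<rho>lim: "\<rho> \<longlonglongrightarrow> 1" unfolding \<rho>_def by real_asymp
  have "\<exists>p. branch_step disc_map (\<rho> j) (fst p) (snd p)" for j
    using branch_step_exists[OF disc_map_holomorphic deriv_disc_map_nonzero \<rho>, of j] by auto
  then obtain p where "\<And>j. branch_step disc_map (\<rho> j) (fst (p j)) (snd (p j))" by metis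
  then obtain r G where G: "\<And>j. branch_step disc_map (\<rho> j) (r j) (G j)"
    by (rule that[of "\<lambda>j. fst (p j)" "\<lambda>j. snd (p j)"])
  define c where "c j n \<omega> = branch_chain (G j) (\<lambda>i. B (real (Suc i) * (T / 2^n)) \<omega> - B (real i * (T / 2^n)) \<omega>) (2^n)" for j n \<omega>
  have h: "0 < T / 2^n" for n using T by simp
  have good: "AE \<omega> in M. continuous_on {0..} (\<lambda>t. B t \<omega>) \<and> B 0 \<omega> = 0"
    using continuous_paths start_0 by eventually_elim auto
  define A where "A \<omega> = lift_times disc_map (\<lambda>t. B t \<omega>)" for \<omega>
  \<comment> \<open>The time supplied by the grid limit depends on the path; a choice fixes it as a
    function of \<omega>, with no measurability claimed.\<close>
  define U where "U j \<omega> = (SOME u. u \<in> A \<omega> \<and> u \<le> T \<and> (u = T \<or> \<rho> j \<le> norm (the_lift disc_map (\<lambda>t. B t \<omega>) u)) \<and>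
      (\<lambda>n. c j n \<omega>) \<longlonglongrightarrow> the_lift disc_map (\<lambda>t. B t \<omega>) u)" for j \<omega>
  have U: "U j \<omega> \<in> A \<omega> \<and> U j \<omega> \<le> T \<and> (U j \<omega> = T \<or> \<rho> j \<le> norm (the_lift disc_map (\<lambda>t. B t \<omega>) (U j \<omega>))) \<and>
      (\<lambda>n. c j n \<omega>) \<longlonglongrightarrow> the_lift disc_map (\<lambda>t. B t \<omega>) (U j \<omega>)"
    if "continuous_on {0..} (\<lambda>t. B t \<omega>) \<and> B 0 \<omega> = 0" for j \<omega>
  proof -
    interpret path_lifting disc_map "\<lambda>t. B t \<omega>" using path_lifting_disc_map that by blast
    have "\<exists>u. u \<in> A \<omega> \<and> u \<le> T \<and> (u = T \<or> \<rho> j \<le> norm (the_lift disc_map (\<lambda>t. B t \<omega>) u)) \<and>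
      (\<lambda>n. c j n \<omega>) \<longlonglongrightarrow> the_lift disc_map (\<lambda>t. B t \<omega>) u"
      using chain_limit[OF G[of j], of T] T unfolding A_def c_def by auto
    then show ?thesis unfolding U_def by (rule someI_ex)
  qed
  have c: "holomorphic_mean M (c j n)" for j n
    unfolding c_def[abs_def] by (rule holomorphic_mean_increment_chain[OF G[of j] \<rho>(2) h])
  have "\<exists>Y. holomorphic_mean M Y \<and> (AE \<omega> in M. Y \<omega> = the_lift disc_map (\<lambda>t. B t \<omega>) (U j \<omega>))" for j
  proof (rule holomorphic_mean_limit[OF c])
    show "AE \<omega> in M. (\<lambda>n. c j n \<omega>) \<longlonglongrightarrow> the_lift disc_map (\<lambda>t. B t \<omega>) (U j \<omega>)"
      using good by eventually_elim (use U in blast)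
  qed
  then obtain Y where Y: "\<And>j. holomorphic_mean M (Y j)"
      "\<And>j. AE \<omega> in M. Y j \<omega> = the_lift disc_map (\<lambda>t. B t \<omega>) (U j \<omega>)"
    by metis
  have "AE \<omega> in M. \<forall>j. Y j \<omega> = the_lift disc_map (\<lambda>t. B t \<omega>) (U j \<omega>)"
    using Y(2) by (simp add: AE_all_countable)
  then have "AE \<omega> in M. (\<lambda>j. Y j \<omega>) \<longlonglongrightarrow> stopped_lift disc_map (\<lambda>t. B t \<omega>) T"
    using good
  proof eventually_elim
    case (elim \<omega>)
    interpret path_lifting disc_map "\<lambda>t. B t \<omega>" using path_lifting_disc_map elim(2) by blast
    note bc = elim(2)[THEN conjunct1] elim(2)[THEN conjunct2]
    have "(\<lambda>j. the_lift disc_map (\<lambda>t. B t \<omega>) (U j \<omega>)) \<longlonglongrightarrow> stopped_lift disc_map (\<lambda>t. B t \<omega>) T"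
    proof (rule stopped_lift_limit[OF less_imp_le[OF T] _ _ _ _ \<rho>lim])
      show "(the_lift disc_map (\<lambda>t. B t \<omega>) \<longlongrightarrow> exit_point disc_map (\<lambda>t. B t \<omega>)) (at_left (Sup (lift_times disc_map (\<lambda>t. B t \<omega>))))"
        if "T \<notin> lift_times disc_map (\<lambda>t. B t \<omega>)"
        using exit_point_disc_map(1)[OF bc that] T by simp
    qed (use U[OF elim(2)] in \<open>auto simp: A_def\<close>)
    then show ?case using elim(1) by simp
  qed
  from holomorphic_mean_limit[OF Y(1) this] show ?thesis .
qed

end

section \<open>Test functions on the disc and the law of the exit point\<close>

lemma norm_sin_le_exp: "norm (sin w) \<le> exp (norm (w::complex))"
proof -
  have "norm (sin w) = norm (exp (\<i> * w) - exp (- (\<i> * w))) / 2"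
    by (simp add: sin_exp_eq norm_divide norm_mult)
  also have "\<dots> \<le> (norm (exp (\<i> * w)) + norm (exp (- (\<i> * w)))) / 2"
    by (intro divide_right_mono norm_triangle_ineq4) simp
  also have "\<dots> \<le> (exp (norm w) + exp (norm w)) / 2"
    using norm_exp[of "\<i> * w"] norm_exp[of "- (\<i> * w)"] by (intro divide_right_mono add_mono) (simp_all add: norm_mult)
  finally show ?thesis by simp
qed

text \<open>The argument of the sine has modulus at most pi / \<kappa>. Conversely, when the path is
  far out, a lift must be near \<plusminus>\<i>.\<close>

lemma norm_disc_map_le:
  assumes "norm \<zeta> < 1" "0 < \<kappa>" "\<kappa> \<le> norm (1 + \<zeta>\<^sup>2)"
  shows "norm (disc_map \<zeta>) \<le> exp (pi / \<kappa>)"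
proof -
  have "norm (of_real pi * \<zeta> / (1 + \<zeta>\<^sup>2)) = pi * norm \<zeta> / norm (1 + \<zeta>\<^sup>2)" by (simp add: norm_divide norm_mult)
  also have "\<dots> \<le> pi * 1 / \<kappa>" using assms by (intro frac_le mult_left_mono) auto
  finally have "exp (norm (of_real pi * \<zeta> / (1 + \<zeta>\<^sup>2))) \<le> exp (pi / \<kappa>)" by simp
  with norm_sin_le_exp[of "of_real pi * \<zeta> / (1 + \<zeta>\<^sup>2)"] show ?thesis unfolding disc_map_def by linarith
qed

lemma (in prob_space) integrable_holomorphic_mean:
  assumes hm: "holomorphic_mean M Z" and \<phi>: "continuous_on (cball 0 1) \<phi>"
  shows "integrable M (\<lambda>\<omega>. \<phi> (Z \<omega>) :: complex)"
proof -
  note [measurable] = holomorphic_meanD(1)[OF hm]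
  obtain f C where [measurable]: "f \<in> borel_measurable borel"
    and f: "\<And>x. norm x \<le> 1 \<Longrightarrow> f x = \<phi> x" and C: "\<And>x. norm x \<le> 1 \<Longrightarrow> norm (\<phi> x) \<le> C"
    by (rule continuous_on_disc_extension[OF \<phi>]) blast
  have "integrable M (\<lambda>\<omega>. f (Z \<omega>))"
  proof (rule integrable_const_bound[where B=C])
    show "AE \<omega> in M. norm (f (Z \<omega>)) \<le> C" by (simp add: f C holomorphic_meanD(2)[OF hm])
  qed measurable
  then show ?thesis by (simp add: f holomorphic_meanD(2)[OF hm])
qed

lemma Re_one_minus_pos: "norm c \<le> 1 \<Longrightarrow> norm z \<le> 1 \<Longrightarrow> c * z \<noteq> 1 \<Longrightarrow> 0 < Re (1 - c * (z::complex))"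
proof -
  assume c: "norm c \<le> 1" "norm z \<le> 1" "c * z \<noteq> 1"
  have n: "norm (c * z) \<le> 1" using c by (simp add: norm_mult mult_le_one)
  then have r: "Re (c * z) \<le> 1" using complex_Re_le_cmod[of "c * z"] by linarith
  have "Re (c * z) \<noteq> 1"
  proof
    assume e: "Re (c * z) = 1"
    have "(Re (c * z))\<^sup>2 + (Im (c * z))\<^sup>2 \<le> 1" using n by (simp add: cmod_def)
    then have "Im (c * z) = 0" unfolding e by simp
    with e c(3) show False by (simp add: complex_eq_iff)
  qed
  with r show ?thesis by simp
qed

lemma Ln_one_minus_admissible:
  assumes "norm c < 1"
  shows "continuous_on (cball 0 1) (\<lambda>z. Ln (1 - c * z))" "(\<lambda>z. Ln (1 - c * z)) holomorphic_on ball 0 1"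
proof -
  have "1 - c * z \<notin> \<real>\<^sub>\<le>\<^sub>0" if "norm z \<le> 1" for z
  proof -
    have "norm (c * z) < 1" using that assms by (simp add: norm_mult) (metis mult_left_le norm_ge_zero order.strict_trans1)
    then have "c * z \<noteq> 1" by auto
    with Re_one_minus_pos[of c z] assms that have "0 < Re (1 - c * z)" by simp
    then show ?thesis by (auto simp: complex_nonpos_Reals_iff)
  qed
  then show "continuous_on (cball 0 1) (\<lambda>z. Ln (1 - c * z))" "(\<lambda>z. Ln (1 - c * z)) holomorphic_on ball 0 1"
    by (intro continuous_intros holomorphic_intros; auto)+
qed

text \<open>The nonnegative harmonic function \<open>ln 2 - ln \<bar>1 + (1 - \<kappa>) \<zeta>\<^sup>2\<bar>\<close> is large near \<open>\<plusminus>\<i>\<close>,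
  the points of the circle that correspond to infinity.\<close>

lemma (in prob_space) prob_near_infinity:
  assumes hm: "holomorphic_mean M Z" and \<kappa>: "0 < \<kappa>" "\<kappa> < 1"
  shows "prob {\<omega> \<in> space M. norm (1 + (Z \<omega>)\<^sup>2) < \<kappa>} \<le> ln 2 / (- ln \<kappa>)"
proof -
  note Z[measurable] = holomorphic_meanD(1)[OF hm] and Z1 = holomorphic_meanD(2)[OF hm] and mean = holomorphic_meanD(3)[OF hm]
  \<comment> \<open>A factor below 1 keeps the logarithm continuous on the closed disc; its distance
    \<kappa> from 1 is matched to the size of the neighbourhood.\<close>
  define a where "a = 1 - \<kappa>"
  have a: "0 < a" "a < 1" using \<kappa> by (auto simp: a_def)
  define \<phi> where "\<phi> \<zeta> = of_real (ln 2) - Ln (1 + of_real a * \<zeta>\<^sup>2)" for \<zeta>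
  have pos: "0 < Re (1 + of_real a * \<zeta>\<^sup>2)" if "norm \<zeta> \<le> 1" for \<zeta> :: complex
  proof -
    have "norm (of_real a * \<zeta>\<^sup>2) \<le> a * 1"
      using that a by (simp add: norm_mult norm_power power_le_one)
    then have "\<bar>Re (of_real a * \<zeta>\<^sup>2)\<bar> < 1" using abs_Re_le_cmod[of "of_real a * \<zeta>\<^sup>2"] a by linarith
    then show ?thesis by simp
  qed
  have np: "1 + of_real a * \<zeta>\<^sup>2 \<notin> \<real>\<^sub>\<le>\<^sub>0" if "norm \<zeta> \<le> 1" for \<zeta> :: complex
    using pos[OF that] by (auto simp: complex_nonpos_Reals_iff)
  have c: "continuous_on (cball 0 1) \<phi>" unfolding \<phi>_def by (intro continuous_intros) (use np in auto)
  have h: "\<phi> holomorphic_on ball 0 1" unfolding \<phi>_def by (intro holomorphic_intros) (use np in auto)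
  have int: "integrable M (\<lambda>\<omega>. \<phi> (Z \<omega>))" by (rule integrable_holomorphic_mean[OF hm c])
  define u where "u \<omega> = Re (\<phi> (Z \<omega>))" for \<omega>
  have nz: "0 < norm (1 + of_real a * (Z \<omega>)\<^sup>2)" for \<omega>
    using pos[OF Z1[of \<omega>]] by (metis less_irrefl zero_complex.sel(1) zero_less_norm_iff)
  have u: "u \<omega> = ln 2 - ln (norm (1 + of_real a * (Z \<omega>)\<^sup>2))" for \<omega>
    using nz[of \<omega>] by (simp add: u_def \<phi>_def Re_Ln)
  have "integrable M u" unfolding u_def by (rule integrable_Re[OF int])
  have "expectation u = Re (expectation (\<lambda>\<omega>. \<phi> (Z \<omega>)))" unfolding u_def by (rule integral_Re[OF int])
  also have "\<dots> = ln 2" using mean[OF c h] by (simp add: \<phi>_def)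
  finally have Eu: "expectation u = ln 2" .
  have u0: "0 \<le> u \<omega>" for \<omega>
  proof -
    have "norm (1 + of_real a * (Z \<omega>)\<^sup>2) \<le> 1 + a * (norm (Z \<omega>))\<^sup>2"
      using norm_triangle_ineq[of 1 "of_real a * (Z \<omega>)\<^sup>2"] a by (simp add: norm_mult norm_power)
    also have "\<dots> \<le> 1 + 1 * 1" using Z1[of \<omega>] a by (intro add_mono mult_mono) (auto simp: power_le_one)
    finally show ?thesis unfolding u using nz[of \<omega>] by simp
  qed
  have lk: "0 < - ln \<kappa>" using \<kappa> by simp
  have "prob {\<omega> \<in> space M. norm (1 + (Z \<omega>)\<^sup>2) < \<kappa>} \<le> prob {\<omega> \<in> space M. - ln \<kappa> \<le> u \<omega>}"
  proof (rule finite_measure_mono)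
    show "{\<omega> \<in> space M. norm (1 + (Z \<omega>)\<^sup>2) < \<kappa>} \<subseteq> {\<omega> \<in> space M. - ln \<kappa> \<le> u \<omega>}"
    proof clarify
      fix \<omega> assume w: "norm (1 + (Z \<omega>)\<^sup>2) < \<kappa>"
      \<comment> \<open>In the neighbourhood the modulus of 1 + a Z^2 is at most 2 \<kappa>, and the
        constant ln 2 in \<phi> absorbs the factor 2, so Markov's inequality applies with level - ln
        \<kappa>.\<close>
      have "1 + of_real a * (Z \<omega>)\<^sup>2 = (1 + (Z \<omega>)\<^sup>2) - of_real \<kappa> * (Z \<omega>)\<^sup>2" by (simp add: a_def algebra_simps)
      then have "norm (1 + of_real a * (Z \<omega>)\<^sup>2) \<le> norm (1 + (Z \<omega>)\<^sup>2) + norm (of_real \<kappa> * (Z \<omega>)\<^sup>2)"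
        by (metis norm_triangle_ineq4)
      also have "norm (of_real \<kappa> * (Z \<omega>)\<^sup>2) \<le> \<kappa> * 1"
        using Z1[of \<omega>] \<kappa> by (simp add: norm_mult norm_power power_le_one)
      finally have "norm (1 + of_real a * (Z \<omega>)\<^sup>2) \<le> 2 * \<kappa>" using w by simp
      then have "ln (norm (1 + of_real a * (Z \<omega>)\<^sup>2)) \<le> ln (2 * \<kappa>)" using nz[of \<omega>] \<kappa>(1) by (subst ln_le_cancel_iff) auto
      also have "\<dots> = ln 2 + ln \<kappa>" using \<kappa> by (simp add: ln_mult)
      finally show "- ln \<kappa> \<le> u \<omega>" unfolding u by simp
    qed
    show "{\<omega> \<in> space M. - ln \<kappa> \<le> u \<omega>} \<in> events" using \<open>integrable M u\<close> by measurable
  qed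
  also have "\<dots> \<le> expectation u / (- ln \<kappa>)"
    by (rule integral_Markov_inequality_measure[where A="{}"]) (use \<open>integrable M u\<close> u0 lk in auto)
  finally show ?thesis by (simp add: Eu)
qed

text \<open>Polar form 1 - exp (i \<beta>) = 2 sin (\<beta> / 2) exp (i (\<beta> - pi) / 2), with
  the angle in the principal range.\<close>

lemma Im_Ln_one_minus_exp:
  assumes "0 < \<beta>" "\<beta> < 2 * pi"
  shows "Im (Ln (1 - exp (\<i> * of_real \<beta>))) = (\<beta> - pi) / 2"
proof -
  have s: "0 < 2 * sin (\<beta> / 2)" using assms by (simp add: sin_gt_zero)
  define w where "w = of_real (ln (2 * sin (\<beta> / 2))) + \<i> * of_real ((\<beta> - pi) / 2)"
  have "exp w = of_real (2 * sin (\<beta> / 2)) * (cos ((\<beta> - pi) / 2) + \<i> * sin ((\<beta> - pi) / 2))"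
    by (simp only: w_def exp_add exp_Euler cos_of_real sin_of_real exp_of_real exp_ln[OF s])
  also have "cos ((\<beta> - pi) / 2) = sin (\<beta> / 2)" by (simp add: diff_divide_distrib cos_diff)
  also have "sin ((\<beta> - pi) / 2) = - cos (\<beta> / 2)" by (simp add: diff_divide_distrib sin_diff)
  also have "of_real (2 * sin (\<beta> / 2)) * (complex_of_real (sin (\<beta> / 2)) + \<i> * of_real (- cos (\<beta> / 2))) = 1 - exp (\<i> * of_real \<beta>)"
  proof -
    have "cos \<beta> = 1 - 2 * (sin (\<beta> / 2))\<^sup>2" using cos_double_sin[of "\<beta> / 2"] by simp
    moreover have "sin \<beta> = 2 * sin (\<beta> / 2) * cos (\<beta> / 2)" using sin_double[of "\<beta> / 2"] by simp
    ultimately show ?thesis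
      by (simp add: complex_eq_iff exp_Euler cos_of_real sin_of_real power2_eq_square)
  qed
  finally have "1 - exp (\<i> * of_real \<beta>) = exp w" by simp
  moreover have "Ln (exp w) = w"
    by (rule Ln_exp) (use assms in \<open>auto simp: w_def\<close>)
  ultimately show ?thesis by (simp add: w_def)
qed

text \<open>As functions of the angle of z, the two imaginary parts are sawtooths of slope 1/2 with
  jumps at \<alpha> and -\<alpha>; in the difference the slopes cancel and a step function of the
  arc Re z > cos \<alpha> remains.\<close>

lemma Im_Ln_arc:
  assumes \<alpha>: "0 < \<alpha>" "\<alpha> < pi" and z: "norm z = 1" and ne: "z \<noteq> cis \<alpha>" "z \<noteq> cis (- \<alpha>)"
  shows "Im (Ln (1 - cis (- \<alpha>) * z)) - Im (Ln (1 - cis \<alpha> * z)) = (if cos \<alpha> < Re z then pi else 0) - \<alpha>"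
proof -
  define \<theta> where "\<theta> = Arg z"
  have \<theta>: "- pi < \<theta>" "\<theta> \<le> pi" using Arg_bounded[of z] by (auto simp: \<theta>_def)
  have z0: "z \<noteq> 0" using z by auto
  have zc: "z = cis \<theta>" using cis_Arg[OF z0] z by (simp add: \<theta>_def sgn_div_norm)
  have n: "\<theta> \<noteq> \<alpha>" "\<theta> \<noteq> - \<alpha>" using ne zc by auto
  have e1: "cis (- \<alpha>) * z = cis (\<theta> - \<alpha>)" "cis \<alpha> * z = cis (\<theta> + \<alpha>)" by (simp_all add: zc cis_mult add.commute)
  have A1: "Im (Ln (1 - cis \<beta>)) = (\<beta> - pi) / 2" if "0 < \<beta>" "\<beta> < 2 * pi" for \<beta>
    using Im_Ln_one_minus_exp[OF that] by (simp add: cis_conv_exp)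
  have A2: "Im (Ln (1 - cis \<beta>)) = (\<beta> + pi) / 2" if "- 2 * pi < \<beta>" "\<beta> < 0" for \<beta>
  proof -
    have "cis (\<beta> + 2 * pi) = cis \<beta>" by (simp add: cis.ctr)
    with A1[of "\<beta> + 2 * pi"] that show ?thesis by simp
  qed
  have Rz: "Re z = cos \<theta>" by (simp add: zc)
  have cos_abs: "cos \<bar>\<theta>\<bar> = cos \<theta>" by (simp add: abs_if)
  consider "\<bar>\<theta>\<bar> < \<alpha>" | "\<alpha> < \<theta>" | "\<theta> < - \<alpha>" using n by linarith
  then show ?thesis
  proof cases
    case 1
    have "cos \<alpha> < cos \<bar>\<theta>\<bar>" by (rule cos_monotone_0_pi) (use 1 \<alpha> in auto)
    then have "cos \<alpha> < Re z" by (simp add: Rz cos_abs)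
    moreover have "Im (Ln (1 - cis (\<theta> - \<alpha>))) = (\<theta> - \<alpha> + pi) / 2" by (rule A2) (use 1 \<alpha> in auto)
    moreover have "Im (Ln (1 - cis (\<theta> + \<alpha>))) = (\<theta> + \<alpha> - pi) / 2" by (rule A1) (use 1 \<alpha> in auto)
    ultimately show ?thesis unfolding e1 by (simp add: field_simps)
  next
    case 2
    have "cos \<theta> < cos \<alpha>" by (rule cos_monotone_0_pi) (use 2 \<alpha> \<theta> in auto)
    then have "\<not> cos \<alpha> < Re z" by (simp add: Rz)
    moreover have "Im (Ln (1 - cis (\<theta> - \<alpha>))) = (\<theta> - \<alpha> - pi) / 2" by (rule A1) (use 2 \<alpha> \<theta> in auto)
    moreover have "Im (Ln (1 - cis (\<theta> + \<alpha>))) = (\<theta> + \<alpha> - pi) / 2" by (rule A1) (use 2 \<alpha> \<theta> in auto)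
    ultimately show ?thesis unfolding e1 by (simp add: field_simps)
  next
    case 3
    have "cos \<bar>\<theta>\<bar> < cos \<alpha>" by (rule cos_monotone_0_pi) (use 3 \<alpha> \<theta> in auto)
    then have "\<not> cos \<alpha> < Re z" by (simp add: Rz cos_abs)
    moreover have "Im (Ln (1 - cis (\<theta> - \<alpha>))) = (\<theta> - \<alpha> + pi) / 2" by (rule A2) (use 3 \<alpha> \<theta> in auto)
    moreover have "Im (Ln (1 - cis (\<theta> + \<alpha>))) = (\<theta> + \<alpha> + pi) / 2" by (rule A2) (use 3 \<alpha> \<theta> in auto)
    ultimately show ?thesis unfolding e1 by (simp add: field_simps)
  qed
qed

text \<open>The functions ((1 + cnj a z) / 2)^n peak at \<open>a\<close>: they equal 1 there, tend
  to 0 elsewhere in the closed disc, and have value 2^(-n) at 0.\<close>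

lemma (in prob_space) no_atom_on_circle:
  assumes hm: "holomorphic_mean M Z" and a: "norm a = 1"
  shows "AE \<omega> in M. Z \<omega> \<noteq> a"
proof -
  note Z[measurable] = holomorphic_meanD(1)[OF hm] and Z1 = holomorphic_meanD(2)[OF hm] and mean = holomorphic_meanD(3)[OF hm]
  have aa: "cnj a * a = 1" using a by (simp add: complex_norm_square[symmetric] mult.commute)
  let ?I = "\<lambda>\<omega>. complex_of_real (indicator {\<omega> \<in> space M. Z \<omega> = a} \<omega>)"
  have "(\<lambda>n. expectation (\<lambda>\<omega>. ((1 + cnj a * Z \<omega>) / 2) ^ n)) \<longlonglongrightarrow> expectation ?I"
  proof (rule integral_dominated_convergence[where w="\<lambda>_. 1"])
    have half: "norm ((1 + cnj a * Z \<omega>) / 2) \<le> 1" for \<omega>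
    proof -
      have "norm (1 + cnj a * Z \<omega>) \<le> 1 + norm (cnj a * Z \<omega>)" by (metis norm_one norm_triangle_ineq)
      also have "\<dots> \<le> 2" using Z1[of \<omega>] a by (simp add: norm_mult)
      finally show ?thesis by (simp add: norm_divide)
    qed
    then show "AE \<omega> in M. norm (((1 + cnj a * Z \<omega>) / 2) ^ n) \<le> 1" for n
      by (simp add: norm_power power_le_one)
    show "AE \<omega> in M. (\<lambda>n. ((1 + cnj a * Z \<omega>) / 2) ^ n) \<longlonglongrightarrow> ?I \<omega>"
    proof (rule AE_I2)
      fix \<omega> assume w: "\<omega> \<in> space M"
      show "(\<lambda>n. ((1 + cnj a * Z \<omega>) / 2) ^ n) \<longlonglongrightarrow> ?I \<omega>"
      proof (cases "Z \<omega> = a")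
        case True
        then show ?thesis using w by (simp add: aa)
      next
        case False
        have "cnj a * Z \<omega> \<noteq> 1"
        proof
          assume "cnj a * Z \<omega> = 1"
          then have "cnj a * Z \<omega> = cnj a * a" using aa by simp
          with False a show False by auto
        qed
        then have "0 < Re (1 - cnj a * Z \<omega>)" using Re_one_minus_pos[of "cnj a" "Z \<omega>"] a Z1 by simp
        then have r: "Re (cnj a * Z \<omega>) < 1" by simp
        let ?w = "cnj a * Z \<omega>"
        have "(norm (1 + ?w))\<^sup>2 = 1 + 2 * Re ?w + (norm ?w)\<^sup>2"
          unfolding cmod_power2 by (simp add: power2_eq_square algebra_simps)
        also have "(norm ?w)\<^sup>2 \<le> 1" using Z1[of \<omega>] a by (simp add: norm_mult power_le_one)
        finally have "(norm (1 + ?w))\<^sup>2 < 2\<^sup>2" using r by simp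
        then have "norm (1 + ?w) < 2" by (rule power2_less_imp_less) simp
        then have "norm ((1 + ?w) / 2) < 1" by (simp add: norm_divide)
        then have "(\<lambda>n. ((1 + ?w) / 2) ^ n) \<longlonglongrightarrow> 0" by (rule LIMSEQ_power_zero)
        then show ?thesis using False by simp
      qed
    qed
  qed auto
  moreover have "expectation (\<lambda>\<omega>. ((1 + cnj a * Z \<omega>) / 2) ^ n) = (1 / 2) ^ n" for n
  proof -
    have "continuous_on (cball 0 1) (\<lambda>z. ((1 + cnj a * z) / 2) ^ n)" by (intro continuous_intros) simp
    moreover have "(\<lambda>z. ((1 + cnj a * z) / 2) ^ n) holomorphic_on ball 0 1" by (intro holomorphic_intros) simp
    ultimately show ?thesis using mean[of "\<lambda>z. ((1 + cnj a * z) / 2) ^ n"] by simp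
  qed
  ultimately have "(\<lambda>n. (1 / 2 :: complex) ^ n) \<longlonglongrightarrow> expectation ?I" by simp
  moreover have "(\<lambda>n. (1 / 2 :: complex) ^ n) \<longlonglongrightarrow> 0" by (rule LIMSEQ_power_zero) (simp add: norm_divide)
  ultimately have "expectation ?I = 0" by (rule LIMSEQ_unique)
  then have "prob {\<omega> \<in> space M. Z \<omega> = a} = 0" by simp
  then show ?thesis by (subst (asm) prob_eq_0) auto
qed

text \<open>The difference of logarithms vanishes at 0, so the limiting step function has mean 0,
  which determines the probability. Radii \<open>r n\<close> below 1 keep the test functions
  continuous on the closed disc; each imaginary part stays below pi / 2 in modulus, and convergence
  can fail only at the two ends of the arc, which carry no mass.\<close>

lemma (in prob_space) uniform_circle_tail:
  assumes hm: "holomorphic_mean M Z" and Zc: "AE \<omega> in M. norm (Z \<omega>) = 1"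
    and v: "-1 < v" "v < 1"
  shows "prob {\<omega> \<in> space M. v < Re (Z \<omega>)} = arccos v / pi"
proof -
  note Z[measurable] = holomorphic_meanD(1)[OF hm] and Z1 = holomorphic_meanD(2)[OF hm] and mean = holomorphic_meanD(3)[OF hm]
  define \<alpha> where "\<alpha> = arccos v"
  have \<alpha>: "0 < \<alpha>" "\<alpha> < pi" "cos \<alpha> = v" using arccos_lt_bounded[of v] v by (auto simp: \<alpha>_def)
  define r where "r n = 1 - 1 / (real n + 2)" for n
  have r: "0 < r n" "r n < 1" for n by (auto simp: r_def field_simps)
  have rlim: "r \<longlonglongrightarrow> 1" unfolding r_def by real_asymp
  define \<phi> where "\<phi> n z = Ln (1 - of_real (r n) * cis (- \<alpha>) * z) - Ln (1 - of_real (r n) * cis \<alpha> * z)" for n z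
  have nr: "norm (of_real (r n) * cis \<beta>) < 1" for n \<beta> using r[of n] by (simp add: norm_mult)
  have c: "continuous_on (cball 0 1) (\<phi> n)" and h: "\<phi> n holomorphic_on ball 0 1" for n
    unfolding \<phi>_def by (intro continuous_intros holomorphic_intros Ln_one_minus_admissible nr)+
  have int: "integrable M (\<lambda>\<omega>. \<phi> n (Z \<omega>))" for n by (rule integrable_holomorphic_mean[OF hm c])
  have E0: "expectation (\<lambda>\<omega>. Im (\<phi> n (Z \<omega>))) = 0" for n
    using integral_Im[OF int[of n]] mean[OF c h, of n] by (simp add: \<phi>_def)
  let ?f = "\<lambda>\<omega>. pi * indicator {\<omega> \<in> space M. v < Re (Z \<omega>)} \<omega> - \<alpha>"
  have "(\<lambda>n. expectation (\<lambda>\<omega>. Im (\<phi> n (Z \<omega>)))) \<longlonglongrightarrow> expectation ?f"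
  proof (rule integral_dominated_convergence[where w="\<lambda>_. pi"])
    show "AE \<omega> in M. norm (Im (\<phi> n (Z \<omega>))) \<le> pi" for n
    proof (rule AE_I2)
      fix \<omega>
      have "\<bar>Im (Ln (1 - of_real (r n) * cis \<beta> * Z \<omega>))\<bar> < pi / 2" for \<beta>
      proof (rule Re_Ln_pos_lt_imp, rule Re_one_minus_pos)
        show "norm (of_real (r n) * cis \<beta>) \<le> 1" using nr[of n \<beta>] by simp
        have "norm (of_real (r n) * cis \<beta> * Z \<omega>) \<le> norm (of_real (r n) * cis \<beta>) * 1"
          using Z1[of \<omega>] unfolding norm_mult[of "of_real (r n) * cis \<beta>"] by (intro mult_left_mono) auto
        then show "of_real (r n) * cis \<beta> * Z \<omega> \<noteq> 1" using nr[of n \<beta>] by auto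
      qed (rule Z1)
      from this[of \<alpha>] this[of "- \<alpha>"] show "norm (Im (\<phi> n (Z \<omega>))) \<le> pi" by (simp add: \<phi>_def abs_if split: if_splits)
    qed
    have "AE \<omega> in M. Z \<omega> \<noteq> cis \<alpha>" "AE \<omega> in M. Z \<omega> \<noteq> cis (- \<alpha>)"
      by (rule no_atom_on_circle[OF hm]; simp)+
    with Zc AE_space show "AE \<omega> in M. (\<lambda>n. Im (\<phi> n (Z \<omega>))) \<longlonglongrightarrow> ?f \<omega>"
    proof eventually_elim
      case (elim \<omega>)
      have lim: "(\<lambda>n. Ln (1 - of_real (r n) * cis \<beta> * Z \<omega>)) \<longlonglongrightarrow> Ln (1 - of_real 1 * cis \<beta> * Z \<omega>)"
        if "Z \<omega> \<noteq> cis (- \<beta>)" for \<beta>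
      proof (intro tendsto_intros rlim)
        have "cis \<beta> * Z \<omega> \<noteq> 1"
        proof
          assume "cis \<beta> * Z \<omega> = 1"
          then have "cis (- \<beta>) * (cis \<beta> * Z \<omega>) = cis (- \<beta>)" by simp
          then have "Z \<omega> = cis (- \<beta>)" by (simp add: mult.assoc[symmetric] cis_mult)
          with that show False by simp
        qed
        then have "0 < Re (1 - cis \<beta> * Z \<omega>)" by (intro Re_one_minus_pos) (auto simp: Z1)
        then show "1 - of_real 1 * cis \<beta> * Z \<omega> \<notin> \<real>\<^sub>\<le>\<^sub>0" by (auto simp: complex_nonpos_Reals_iff)
      qed
      have "(\<lambda>n. Im (\<phi> n (Z \<omega>))) \<longlonglongrightarrow> Im (Ln (1 - of_real 1 * cis (- \<alpha>) * Z \<omega>) - Ln (1 - of_real 1 * cis \<alpha> * Z \<omega>))"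
        unfolding \<phi>_def by (intro tendsto_Im tendsto_diff lim) (use elim in auto)
      moreover have "Im (Ln (1 - of_real 1 * cis (- \<alpha>) * Z \<omega>) - Ln (1 - of_real 1 * cis \<alpha> * Z \<omega>)) = ?f \<omega>"
        using Im_Ln_arc[OF \<alpha>(1,2), of "Z \<omega>"] elim by (simp add: \<alpha>(3))
      ultimately show ?case by simp
    qed
    show "(\<lambda>\<omega>. Im (\<phi> n (Z \<omega>))) \<in> borel_measurable M" for n
      using borel_measurable_integrable[OF int[of n]] by measurable
  qed auto
  then have "(\<lambda>n. 0) \<longlonglongrightarrow> expectation ?f" by (simp only: E0)
  then have "expectation ?f = 0" by (simp add: LIMSEQ_const_iff)
  moreover have "expectation ?f = pi * prob {\<omega> \<in> space M. v < Re (Z \<omega>)} - \<alpha>"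
  proof -
    have [measurable]: "{\<omega> \<in> space M. v < Re (Z \<omega>)} \<in> events" by measurable
    then have "integrable M (\<lambda>\<omega>. pi * indicator {\<omega> \<in> space M. v < Re (Z \<omega>)} \<omega>)"
      by (intro integrable_mult_right integrable_real_indicator) (simp_all add: emeasure_eq_measure)
    then show ?thesis by (subst Bochner_Integration.integral_diff) (simp_all add: prob_space)
  qed
  ultimately show ?thesis by (simp add: \<alpha>_def field_simps)
qed

section \<open>Almost sure exit in finite time\<close>

context planar_brownian_motion
begin

lemma AE_good_path: "AE \<omega> in M. continuous_on {0..} (\<lambda>t. B t \<omega>) \<and> B 0 \<omega> = 0"
  using continuous_paths start_0 by eventually_elim auto

text \<open>The normal density with variance \<open>t\<close> never exceeds 1 / sqrt (2 pi t). For
  large \<open>t\<close> the path is therefore outside any fixed strip with probability close to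
  1.\<close>

lemma prob_Re_increment_le:
  assumes t: "0 < t" and R: "0 \<le> R"
  shows "prob {\<omega> \<in> space M. \<bar>Re (B t \<omega> - B 0 \<omega>)\<bar> \<le> R} \<le> 2 * R / sqrt (2 * pi * t)"
proof -
  let ?X = "\<lambda>\<omega>. Re (B t \<omega> - B 0 \<omega>)"
  have D: "distributed M lborel ?X (normal_density 0 (sqrt t))" using normal_Re[of 0 t] t by simp
  have "emeasure M (?X -` {-R..R} \<inter> space M) = (\<integral>\<^sup>+x. ennreal (normal_density 0 (sqrt t) x) * indicator {-R..R} x \<partial>lborel)"
    by (rule distributed_emeasure[OF D]) simp
  also have "\<dots> \<le> (\<integral>\<^sup>+x. ennreal (1 / sqrt (2 * pi * t)) * indicator {-R..R} x \<partial>lborel)"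
  proof (intro nn_integral_mono mult_right_mono ennreal_leI)
    fix x :: real
    have "1 / sqrt (2 * pi * t) * exp (- (x - 0)\<^sup>2 / (2 * (sqrt t)\<^sup>2)) \<le> 1 / sqrt (2 * pi * t) * 1"
      using t by (intro mult_left_mono) auto
    then show "normal_density 0 (sqrt t) x \<le> 1 / sqrt (2 * pi * t)"
      using t by (simp add: normal_density_def)
  qed simp
  also have "\<dots> = ennreal (1 / sqrt (2 * pi * t)) * ennreal (2 * R)"
    using R by (subst nn_integral_cmult_indicator) auto
  also have "\<dots> = ennreal (2 * R / sqrt (2 * pi * t))" using R t by (subst ennreal_mult[symmetric]) auto
  finally have "ennreal (prob (?X -` {-R..R} \<inter> space M)) \<le> ennreal (2 * R / sqrt (2 * pi * t))"
    by (simp add: emeasure_eq_measure)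
  then have "prob (?X -` {-R..R} \<inter> space M) \<le> 2 * R / sqrt (2 * pi * t)"
    using R t by (subst (asm) ennreal_le_iff) auto
  moreover have "?X -` {-R..R} \<inter> space M = {\<omega> \<in> space M. \<bar>?X \<omega>\<bar> \<le> R}" by (auto simp: abs_le_iff)
  ultimately show ?thesis by simp
qed

text \<open>Survival of the lift up to a late time needs either a path point in a bounded region or
  a lift point near \<plusminus>\<i>. The first becomes unlikely as time grows with \<kappa> fixed,
  the second as \<kappa> tends to 0.\<close>

lemma exit_point_mean:
  "\<exists>Z. holomorphic_mean M Z \<and>
    (AE \<omega> in M. Z \<omega> = exit_point disc_map (\<lambda>t. B t \<omega>) \<and> (\<exists>T\<ge>0. T \<notin> lift_times disc_map (\<lambda>t. B t \<omega>)))"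
proof -
  define b where "b \<omega> = (\<lambda>t. B t \<omega>)" for \<omega>
  have "\<exists>Z. holomorphic_mean M Z \<and> (AE \<omega> in M. Z \<omega> = stopped_lift disc_map (b \<omega>) (real (Suc m)))" for m
    unfolding b_def by (rule stopped_lift_mean) simp
  then obtain Z where hm: "\<And>m. holomorphic_mean M (Z m)"
    and Zs: "\<And>m. AE \<omega> in M. Z m \<omega> = stopped_lift disc_map (b \<omega>) (real (Suc m))"
    by metis
  note Zm[measurable] = holomorphic_meanD(1)[OF hm]
  define E where "E m = {\<omega> \<in> space M. norm (Z m \<omega>) < 1}" for m
  have Em[measurable]: "E m \<in> events" for m unfolding E_def by measurable
  have Bm: "random_variable borel (B t)" if "0 \<le> t" for t using random_variable[OF that] .
  have lifted: "AE \<omega> in M. norm (Z m \<omega>) < 1 \<longrightarrow> disc_map (Z m \<omega>) = B (real (Suc m)) \<omega> - B 0 \<omega> \<and> real (Suc m) \<in> lift_times disc_map (b \<omega>)" for m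
    using Zs[of m] AE_good_path
  proof eventually_elim
    case (elim \<omega>)
    have bc: "continuous_on {0..} (b \<omega>)" "b \<omega> 0 = 0" using elim(2) by (auto simp: b_def)
    interpret path_lifting disc_map "b \<omega>" using path_lifting_disc_map bc by blast
    show ?case
    proof (cases "real (Suc m) \<in> lift_times disc_map (b \<omega>)")
      case True
      then show ?thesis using is_lift_the_lift[OF True] elim bc(2) by (simp add: stopped_lift_def is_lift_def b_def)
    next
      case False
      then have "norm (Z m \<omega>) = 1" using exit_point_disc_map(2)[OF bc False] elim(1) by (simp add: stopped_lift_def)
      then show ?thesis by simp
    qed
  qed
  \<comment> \<open>Up to null sets \<open>E m\<close> is survival of the lift to time m + 1, so
    \<open>p\<close> is the probability that the lift never exits.\<close>
  define p where "p = prob (\<Inter>m. E m)"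
  have bound: "p \<le> 2 * exp (pi / \<kappa>) / sqrt (2 * pi * real (Suc m)) + ln 2 / (- ln \<kappa>)" if \<kappa>: "0 < \<kappa>" "\<kappa> < 1" for m \<kappa>
  proof -
    let ?S = "{\<omega> \<in> space M. \<bar>Re (B (real (Suc m)) \<omega> - B 0 \<omega>)\<bar> \<le> exp (pi / \<kappa>)}"
    let ?N = "{\<omega> \<in> space M. norm (1 + (Z m \<omega>)\<^sup>2) < \<kappa>}"
    have [measurable]: "random_variable borel (B (real (Suc m)))" "random_variable borel (B 0)" by (rule Bm, simp)+
    have S: "?S \<in> events" by measurable
    have N: "?N \<in> events" by measurable
    have "p \<le> prob (E m)" unfolding p_def by (rule finite_measure_mono) auto
    also have "\<dots> \<le> prob (?S \<union> ?N)"
    proof (rule finite_measure_mono_AE)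
      show "AE \<omega> in M. \<omega> \<in> E m \<longrightarrow> \<omega> \<in> ?S \<union> ?N"
        using lifted[of m]
      proof eventually_elim
        case (elim \<omega>)
        show ?case
        proof
          assume w: "\<omega> \<in> E m"
          then have n: "norm (Z m \<omega>) < 1" "\<omega> \<in> space M" by (auto simp: E_def)
          show "\<omega> \<in> ?S \<union> ?N"
          proof (cases "norm (1 + (Z m \<omega>)\<^sup>2) < \<kappa>")
            case False
            then have "norm (disc_map (Z m \<omega>)) \<le> exp (pi / \<kappa>)" using norm_disc_map_le[OF n(1) \<kappa>(1)] by simp
            then have "norm (B (real (Suc m)) \<omega> - B 0 \<omega>) \<le> exp (pi / \<kappa>)" using elim n by simp
            then have "\<bar>Re (B (real (Suc m)) \<omega> - B 0 \<omega>)\<bar> \<le> exp (pi / \<kappa>)"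
              using abs_Re_le_cmod[of "B (real (Suc m)) \<omega> - B 0 \<omega>"] by linarith
            with n(2) show ?thesis by blast
          qed (use n in blast)
        qed
      qed
    qed (use S N in auto)
    also have "\<dots> \<le> prob ?S + prob ?N" by (rule measure_Un_le[OF S N])
    also have "\<dots> \<le> 2 * exp (pi / \<kappa>) / sqrt (2 * pi * real (Suc m)) + ln 2 / (- ln \<kappa>)"
      by (intro add_mono prob_Re_increment_le prob_near_infinity[OF hm \<kappa>]) auto
    finally show ?thesis .
  qed
  have p_le: "p \<le> ln 2 / (- ln \<kappa>)" if \<kappa>: "0 < \<kappa>" "\<kappa> < 1" for \<kappa>
  proof (rule LIMSEQ_le_const)
    define C where "C = exp (pi / \<kappa>)"
    define D where "D = ln 2 / (- ln \<kappa>)"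
    have "(\<lambda>m. 2 * C / sqrt (2 * pi * real (Suc m)) + D) \<longlonglongrightarrow> D" by real_asymp
    then show "(\<lambda>m. 2 * exp (pi / \<kappa>) / sqrt (2 * pi * real (Suc m)) + ln 2 / (- ln \<kappa>)) \<longlonglongrightarrow> ln 2 / (- ln \<kappa>)"
      by (simp add: C_def D_def)
    show "\<exists>N. \<forall>n\<ge>N. p \<le> 2 * exp (pi / \<kappa>) / sqrt (2 * pi * real (Suc n)) + ln 2 / (- ln \<kappa>)"
      using bound[OF \<kappa>] by blast
  qed
  \<comment> \<open>The choice of \<kappa> makes - ln \<kappa> the integer n + 1.\<close>
  have "p \<le> ln 2 / real (Suc n)" for n
    using p_le[of "exp (- real (Suc n))"] by (simp add: add.commute)
  then have "p \<le> 0"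
    by (intro LIMSEQ_le_const[where X="\<lambda>n. ln 2 / real (Suc n)"]) (real_asymp, blast)
  then have "prob (\<Inter>m. E m) = 0" by (simp add: p_def measure_le_0_iff)
  then have "AE \<omega> in M. \<omega> \<notin> (\<Inter>m. E m)"
    by (intro AE_not_in) (auto simp: null_sets_def emeasure_eq_measure)
  moreover have "AE \<omega> in M. \<forall>m. Z m \<omega> = stopped_lift disc_map (b \<omega>) (real (Suc m))"
    using Zs by (simp add: AE_all_countable)
  ultimately have exits: "AE \<omega> in M. (\<exists>T\<ge>0. T \<notin> lift_times disc_map (b \<omega>)) \<and> (\<lambda>m. Z m \<omega>) \<longlonglongrightarrow> exit_point disc_map (b \<omega>)"
    using AE_good_path AE_space
  proof eventually_elim
    case (elim \<omega>)
    have bc: "continuous_on {0..} (b \<omega>)" "b \<omega> 0 = 0" using elim(3) by (auto simp: b_def)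
    interpret path_lifting disc_map "b \<omega>" using path_lifting_disc_map bc by blast
    obtain m where m: "\<not> norm (Z m \<omega>) < 1" using elim(1,4) by (auto simp: E_def)
    have out: "real (Suc m) \<notin> lift_times disc_map (b \<omega>)"
    proof
      assume T: "real (Suc m) \<in> lift_times disc_map (b \<omega>)"
      from is_lift_the_lift[OF T] have "norm (the_lift disc_map (b \<omega>) (real (Suc m))) < 1" by (simp add: is_lift_def)
      with T m elim(2) show False by (simp add: stopped_lift_def)
    qed
    have "Z n \<omega> = exit_point disc_map (b \<omega>)" if "m \<le> n" for n
    proof -
      have "real (Suc n) \<notin> lift_times disc_map (b \<omega>)"
        using lift_times_mono[of "real (Suc n)" "real (Suc m)"] out that by auto
      then show ?thesis using elim(2) by (simp add: stopped_lift_def)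
    qed
    then have "\<forall>\<^sub>F n in sequentially. Z n \<omega> = exit_point disc_map (b \<omega>)" by (auto simp: eventually_sequentially)
    then have "(\<lambda>m. Z m \<omega>) \<longlonglongrightarrow> exit_point disc_map (b \<omega>)" by (rule tendsto_eventually)
    moreover have "\<exists>T\<ge>0. T \<notin> lift_times disc_map (b \<omega>)" using out of_nat_0_le_iff by blast
    ultimately show ?case by blast
  qed
  then have "AE \<omega> in M. (\<lambda>m. Z m \<omega>) \<longlonglongrightarrow> exit_point disc_map (b \<omega>)" by eventually_elim blast
  from holomorphic_mean_limit[OF hm this] obtain Y where "holomorphic_mean M Y"
      and Y: "AE \<omega> in M. Y \<omega> = exit_point disc_map (b \<omega>)"
    by blast
  moreover have "AE \<omega> in M. Y \<omega> = exit_point disc_map (\<lambda>t. B t \<omega>) \<and> (\<exists>T\<ge>0. T \<notin> lift_times disc_map (\<lambda>t. B t \<omega>))"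
    using Y exits by eventually_elim (auto simp: b_def)
  ultimately show ?thesis by blast
qed

end

section \<open>The winding time and its law\<close>

lemma tau_hat_eq:
  assumes b: "continuous_on {0..} b" "b 0 = 0" and T: "T \<notin> lift_times disc_map b" "0 \<le> T"
    and nz: "cos (pi / 2 * (1 / Re (exit_point disc_map b))) \<noteq> 0"
  shows "tau_hat b = ereal (Sup (lift_times disc_map b))"
    and "B_tau_hat b = of_real (sin (pi / 2 * (1 / Re (exit_point disc_map b))))"
proof -
  let ?\<tau> = "Sup (lift_times disc_map b)"
  have mem: "?\<tau> \<in> winding_times b" by (rule winding_at_exit[OF b T nz])
  \<comment> \<open>A winding time before \<tau> would lie in the lifetime of the lift, where every
    crossing closes up to a null-homotopic loop.\<close>
  have le: "?\<tau> \<le> t" if t: "t \<in> winding_times b" for t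
  proof (rule ccontr)
    assume "\<not> ?\<tau> \<le> t"
    moreover have "0 \<le> t" "b t \<in> slit" "\<not> null_homotopic_loop (- {-1, 1}) (closed_up_path b t)"
      using t by (auto simp: winding_times_def)
    ultimately have "t \<in> lift_times disc_map b"
      using path_lifting.lift_times_eq(1)[OF path_lifting_disc_map[OF b] T] by auto
    from null_homotopic_before_exit[OF b this \<open>b t \<in> slit\<close>] show False
      using \<open>\<not> null_homotopic_loop (- {-1, 1}) (closed_up_path b t)\<close> by blast
  qed
  show tau: "tau_hat b = ereal ?\<tau>"
    unfolding tau_hat_def
    by (rule antisym[OF Inf_lower Inf_greatest]) (use mem le in auto)
  show "B_tau_hat b = of_real (sin (pi / 2 * (1 / Re (exit_point disc_map b))))"
    unfolding B_tau_hat_def tau using exit_point_disc_map(4)[OF b T] by simp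
qed

text \<open>\<open>X\<close> may fail to be measurable for \<open>M\<close>, but it differs from
  \<open>Y\<close> only inside a null set, which the completion absorbs.\<close>

lemma (in prob_space) distributed_completion_cong_AE:
  fixes X Y :: "'a \<Rightarrow> real"
  assumes Y: "distributed M lborel Y f" and XY: "AE \<omega> in M. X \<omega> = Y \<omega>"
  shows "distributed (completion M) lborel X f"
proof -
  have Ym: "Y \<in> measurable M lborel" and Yd: "distr M lborel Y = density lborel f" and fm: "f \<in> borel_measurable lborel"
    using Y by (auto simp: distributed_def)
  have Yc: "Y \<in> measurable (completion M) lborel" by (rule measurable_completion[OF Ym])
  have XYc: "AE \<omega> in completion M. X \<omega> = Y \<omega>" by (rule AE_completion[OF XY])
  have Xc: "X \<in> measurable (completion M) lborel"
  proof (rule measurableI)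
    fix A :: "real set" assume A: "A \<in> sets lborel"
    show "X -` A \<inter> space (completion M) \<in> sets (completion M)"
    proof (rule completion.in_sets_AE)
      show "Y -` A \<inter> space (completion M) \<in> sets (completion M)" by (rule measurable_sets[OF Yc A])
      show "AE \<omega> in completion M. (\<omega> \<in> Y -` A \<inter> space (completion M)) = (\<omega> \<in> X -` A \<inter> space (completion M))"
        using XYc by eventually_elim simp
    qed simp
  qed simp
  have "distr (completion M) lborel X = distr (completion M) lborel Y"
    by (rule distr_cong_AE[OF refl refl XYc Xc Yc])
  also have "\<dots> = density lborel f" using distr_completion[OF Ym] Yd by simp
  finally show ?thesis using Xc fm by (simp add: distributed_def)
qed

theorem mainTheorem15:
  fixes M :: "'w measure" and B :: "real \<Rightarrow> 'w \<Rightarrow> complex"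
  assumes "planar_brownian_motion M B"
  shows "(AE \<omega> in M. tau_hat (\<lambda>t. B t \<omega>) < \<infinity>) \<and>
    (AE \<omega> in M. B_tau_hat (\<lambda>t. B t \<omega>) \<in> slit) \<and>
    distributed (completion M) lborel (\<lambda>\<omega>. Re (B_tau_hat (\<lambda>t. B t \<omega>)))
      (\<lambda>w. ennreal (indicator {-1<..<1} w * rho w))"
proof -
  interpret planar_brownian_motion M B by fact
  obtain Z where hm: "holomorphic_mean M Z"
    and Ze: "AE \<omega> in M. Z \<omega> = exit_point disc_map (\<lambda>t. B t \<omega>) \<and> (\<exists>T\<ge>0. T \<notin> lift_times disc_map (\<lambda>t. B t \<omega>))"
    using exit_point_mean by blast
  note Z[measurable] = holomorphic_meanD(1)[OF hm] and Z1 = holomorphic_meanD(2)[OF hm]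
  have Zc: "AE \<omega> in M. norm (Z \<omega>) = 1"
    using Ze AE_good_path
  proof eventually_elim
    case (elim \<omega>)
    then obtain T where T: "T \<notin> lift_times disc_map (\<lambda>t. B t \<omega>)" "0 \<le> T" by blast
    from exit_point_disc_map(2)[OF elim(2)[THEN conjunct1] elim(2)[THEN conjunct2] T] elim(1)
    show ?case by simp
  qed
  define Y where "Y \<omega> = sin (pi / 2 * (1 / Re (Z \<omega>)))" for \<omega>
  have D: "distributed M lborel Y (\<lambda>w. ennreal (indicator {-1<..<1} w * rho w))"
    unfolding Y_def
  proof (rule distributed_rho)
    show "AE \<omega> in M. \<bar>Re (Z \<omega>)\<bar> \<le> 1"
    proof (rule AE_I2)
      fix \<omega>
      show "\<bar>Re (Z \<omega>)\<bar> \<le> 1" using abs_Re_le_cmod[of "Z \<omega>"] Z1[of \<omega>] by linarith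
    qed
    show "prob {\<omega> \<in> space M. v < Re (Z \<omega>)} = arccos v / pi" if "-1 < v" "v < 1" for v
      by (rule uniform_circle_tail[OF hm Zc that])
  qed measurable
  \<comment> \<open>Having a density supported in (-1, 1), \<open>Y\<close> almost surely avoids
    \<plusminus>1. This gives the nonvanishing cosine at the exit: exits at the branch values are
    excluded by the law itself, without a separate proof that Brownian motion misses points.\<close>
  have "AE w in density lborel (\<lambda>w. ennreal (indicator {-1<..<1} w * rho w)). \<bar>w\<bar> < 1"
    using D by (subst AE_density) (auto simp: distributed_def indicator_def abs_less_iff)
  moreover have "distr M lborel Y = density lborel (\<lambda>w. ennreal (indicator {-1<..<1} w * rho w))"
    using D unfolding distributed_def by blast
  ultimately have "AE w in distr M lborel Y. \<bar>w\<bar> < 1" by (simp only:)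
  then have Y1: "AE \<omega> in M. \<bar>Y \<omega>\<bar> < 1"
    using D by (subst (asm) AE_distr_iff) (auto simp: distributed_def)
  have main: "AE \<omega> in M. tau_hat (\<lambda>t. B t \<omega>) < \<infinity> \<and> B_tau_hat (\<lambda>t. B t \<omega>) = of_real (Y \<omega>) \<and> \<bar>Y \<omega>\<bar> < 1"
    using Ze AE_good_path Y1
  proof eventually_elim
    case (elim \<omega>)
    obtain T where T: "T \<notin> lift_times disc_map (\<lambda>t. B t \<omega>)" "0 \<le> T" using elim(1) by blast
    have nz: "cos (pi / 2 * (1 / Re (exit_point disc_map (\<lambda>t. B t \<omega>)))) \<noteq> 0"
    proof
      assume c: "cos (pi / 2 * (1 / Re (exit_point disc_map (\<lambda>t. B t \<omega>)))) = 0"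
      have "(Y \<omega>)\<^sup>2 = 1" unfolding Y_def elim(1)[THEN conjunct1] sin_squared_eq c by simp
      then have "\<bar>Y \<omega>\<bar> = 1" by (auto simp: power2_eq_1_iff)
      with elim(3) show False by simp
    qed
    note tau_hat_eq[OF elim(2)[THEN conjunct1] elim(2)[THEN conjunct2] T nz]
    then show ?case using elim by (simp add: Y_def)
  qed
  have "AE \<omega> in M. tau_hat (\<lambda>t. B t \<omega>) < \<infinity>" using main by eventually_elim simp
  moreover have "AE \<omega> in M. B_tau_hat (\<lambda>t. B t \<omega>) \<in> slit"
    using main by eventually_elim (auto simp: slit_def abs_less_iff)
  moreover have "AE \<omega> in M. Re (B_tau_hat (\<lambda>t. B t \<omega>)) = Y \<omega>" using main by eventually_elim simp
  from distributed_completion_cong_AE[OF D this]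
  have "distributed (completion M) lborel (\<lambda>\<omega>. Re (B_tau_hat (\<lambda>t. B t \<omega>))) (\<lambda>w. ennreal (indicator {-1<..<1} w * rho w))" .
  ultimately show ?thesis by blast
qed

end
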